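(* Suppose that the discrete spaces and quadrature schemes satisfy assumptions (A1)–(A4) listed in the context, for a positive integer $k$. Then the direct finite element method: find $(\sigma_h^-,u_h^-,u_h^+)\in Q_h^-\times V_h^-\times V_{g,h}^+$ such that $$ \left\{\begin{aligned} a_h(\sigma_h^-,u_h^+;\tau_h^-,v_h^+)+b_h(u_h^-;\tau_h^-,v_h^+)&=(f^+,v_h^+)_{\Omega^+,h}+\langle g,\tau_h^-\cdot\boldsymbol n\rangle_{\Gamma_b,h},\\ b_h(v_h^-;\sigma_h^-,u_h^+)&=-(f^-,v_h^-)_{\Omega^-,h}, \end{aligned}\right. \qquad\forall(\tau_h^-,v_h^-,v_h^+)\in Q_h^-\times V_h^-\times V_h^+, $$ is well defined, namely, there exists a unique solution $(\sigma_h^-,u_h^-,u_h^+)\in Q_h^-\times V_h^-\times V_{g,h}^+$ and $$|||(\sigma_h^-,u_h^+)|||_{1,h}+|||u_h^-|||_{0,h}\lesssim\|f\|_{0,\Omega}+\|g\|_{\frac12,\Gamma_b}.$$ Moreover, the solution admits the optimal convergence $$|||(\sigma^--\sigma_h^-,u^+-u_h^+)|||_{1,h}+|||u^--u_h^-|||_{0,h}\lesssim h^k,$$ provided that $u\in H^{k+1}(\Omega^+\cup\Omega^-)\cap H^1(\Omega)$.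
   Context: Continuous problem. $\Omega\subset\mathbb R^2$ is a bounded convex polygonal domain, and $\Gamma=\partial\Omega^+\cap\partial\Omega^-$ is a Lipschitz interface dividing $\Omega$ into disjoint subdomains $\Omega^\pm$; $\beta=\beta^\pm>0$ constant in $\Omega^\pm$; $f\in L^2(\Omega)$, $g\in H^{1/2}(\partial\Omega)$. $u$ solves $-\nabla\cdot(\beta\nabla u)=f$ in $\Omega^+\cup\Omega^-$, $[u]=0$ and $[\beta\nabla u\cdot\boldsymbol n]=0$ across $\Gamma$, $u=g$ on $\partial\Omega$. $\boldsymbol n$ is the unit normal pointing out of $\Omega^-$; $\Gamma_b=\partial\Omega\cap\partial\Omega^-$; $u^\pm=u|_{\Omega^\pm}$, $f^\pm=f|_{\Omega^\pm}$, $\sigma^-=\beta^-\nabla u^-$. Functions on $\Omega^\pm$ are identified, without change of notation, with bounded Sobolev extensions to $\Omega$. $H^m(\Omega^+\cup\Omega^-)$ is the space of functions whose restrictions to $\Omega^\pm$ are in $H^m(\Omega^\pm)$. With $V^+=\{v\in H^1(\Omega^+):v=0\text{ on }\partial\Omega\cap\partial\Omega^+\}$, $V_g^+$ the same with $v=g$ there, $V^-=L^2(\Omega^-)$ and $Q^-=H(\mathrm{div},\Omega^-)$, the triple $(\sigma^-,u^-,u^+)\in Q^-\times V^-\times V_g^+$ satisfies $a(\sigma^-,u^+;\tau^-,v^+)+b(u^-;\tau^-,v^+)=(f^+,v^+)_{\Omega^+}+\langle g,\tau^-\cdot\boldsymbol n\rangle_{\Gamma_b}$ and $b(v^-;\sigma^-,u^+)=-(f^-,v^-)_{\Omega^-}$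 for all $(\tau^-,v^-,v^+)\in Q^-\times V^-\times V^+$, where $a(\sigma,u;\tau,v)=\frac1{\beta^-}(\sigma,\tau)_{\Omega^-}+(\beta^+\nabla u,\nabla v)_{\Omega^+}+\langle\sigma\cdot\boldsymbol n,v\rangle_\Gamma-\langle u,\tau\cdot\boldsymbol n\rangle_\Gamma$ and $b(w;\tau,v)=(\nabla\cdot\tau,w)_{\Omega^-}$. Discretization. $\mathcal T_h$ is a triangulation of $\Omega$ with mesh size $h=\max_K h_K$, not fitted to $\Gamma$. An element is a non-interface element if $\Gamma$ does not intersect it, or meets an edge only at its vertices, or the whole edge lies on $\Gamma$; otherwise it is an interface element. $\mathcal T_h^\pm$ is the union of all non-interface elements in $\Omega^\pm$ and all interface elements. $K^\pm=K\cap\Omega^\pm$, $\Gamma_K=K\cap\Gamma$. Given shape function spaces $S_u^+(K),S_\sigma^-(K),S_u^-(K)$ (of conforming $H^1$, $H(\mathrm{div})$ and $L^2$ elements, respectively): $V_h^+=\{v\in H^1(\Omega^+):v|_K\in S_u^+(K)\ \forall K\in\mathcal T_h^+,\ v=0\text{ on }\partial\Omega\cap\partial\Omega^+\}$; $V_{g,h}^+$ is the analogous space with the Dirichlet boundary condition $g$ on $\partial\Omega\cap\partial\Omega^+$; $Q_h^-=\{\tau\in H(\mathrm{div},\Omega^-):\tau|_K\in S_\sigma^-(K)\ \forall K\in\mathcal T_h^-\}$; $V_h^-=\{v\in L^2(\Omega^-):v|_K\in S_u^-(K)\ \forall K\in\mathcal T_h^-\}$. Given quadrature schemes define discrete inner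 products $(\cdot,\cdot)_{K^\pm,h}$, $\langle\cdot,\cdot\rangle_{\Gamma_K,h}$ and $\langle\cdot,\cdot\rangle_{\Gamma_b,h}$; one sets $\langle\cdot,\cdot\rangle_{\Gamma,h}=\sum_{K:\Gamma_K\ne\emptyset}\langle\cdot,\cdot\rangle_{\Gamma_K,h}$ and $(\cdot,\cdot)_{\Omega^s,h}=\sum_{K:K^s\neq\emptyset}(\cdot,\cdot)_{K^s,h}$, $s=+,-$. The discrete forms are $$a_h(\sigma,u;\tau,v)=\tfrac1{\beta^-}(\sigma,\tau)_{\Omega^-,h}+(\beta^+\nabla u,\nabla v)_{\Omega^+,h}+\langle\sigma\cdot\boldsymbol n,v\rangle_{\Gamma,h}-\langle\tau\cdot\boldsymbol n,u\rangle_{\Gamma,h},\qquad b_h(w;\tau,v)=(\nabla\cdot\tau,w)_{\Omega^-,h}.$$ With $\|w\|_{\Omega^s,h}=\sqrt{(w,w)_{\Omega^s,h}}$, set $|||(\tau,v)|||_{1,h}^2=\frac1{\beta^-}\|\tau\|_{\Omega^-,h}^2+\|\nabla\cdot\tau\|_{\Omega^-,h}^2+\beta^+\|\nabla v\|_{\Omega^+,h}^2$ and $|||w|||_{0,h}=\|w\|_{\Omega^-,h}$. $A\lesssim B$ means $A\le CB$ with $C>0$ independent of the mesh size $h$. Assumptions. (A1) Boundedness: for discrete functions, $\|w_h\|_{0,\Omega^s}\lesssim\|w_h\|_{\Omega^s,h}\lesssim\|w_h\|_{0,\Omega^s}$ ($s=+,-$), $|a_h(\sigma_h^-,u_h^+;\tau_h^-,v_h^+)|\lesssim|||(\sigma_h^-,u_h^+)|||_{1,h}\,|||(\tau_h^-,v_h^+)|||_{1,h}$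 and $|b_h(v_h^-;\sigma_h^-,u_h^+)|\lesssim|||v_h^-|||_{0,h}\,|||(\sigma_h^-,u_h^+)|||_{1,h}$. (A2) Inf-sup: $\displaystyle\inf_{0\ne v_h^-\in V_h^-}\sup_{(\tau_h^-,v_h^+)\in Q_h^-\times V_h^+}\frac{b_h(v_h^-;\tau_h^-,v_h^+)}{|||(\tau_h^-,v_h^+)|||_{1,h}\,|||v_h^-|||_{0,h}}\ge\alpha>0$, with $\alpha$ independent of $h$. (A3) Approximation: $\nabla\cdot Q_h^-\subset V_h^-$ and, provided $u\in H^{k+1}(\Omega^+\cup\Omega^-)\cap H^1(\Omega)$, $\displaystyle\inf_{(\tau_h^-,v_h^+)\in Q_h^-\times V_h^+}|||(\sigma^--\tau_h^-,u^+-v_h^+)|||_{1,h}+\inf_{v_h^-\in V_h^-}|||u^--v_h^-|||_{0,h}\lesssim h^k$. (A4) Quadrature accuracy: provided $u\in H^{k+1}(\Omega^+\cup\Omega^-)\cap H^1(\Omega)$, each of the following is $\lesssim h^k$, where suprema are over $(\tau_h^-,v_h^+)\in Q_h^-\times V_h^+$ or $v_h^-\in V_h^-$ (nonzero): $\sup\frac{|a(\sigma^-,u^+;\tau_h^-,v_h^+)-a_h(\sigma^-,u^+;\tau_h^-,v_h^+)|}{|||(\tau_h^-,v_h^+)|||_{1,h}}$; $\sup\frac{|b(u^-;\tau_h^-,v_h^+)-b_h(u^-;\tau_h^-,v_h^+)|}{|||(\tau_h^-,v_h^+)|||_{1,h}}+\sup\frac{|b(v_h^-;\sigma^-,u^+)-b_h(v_h^-;\sigma^-,u^+)|}{|||v_h^-|||_{0,h}}$;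 $\sup\frac{|(f^+,v_h^+)_{\Omega^+}-(f^+,v_h^+)_{\Omega^+,h}|}{|||(\tau_h^-,v_h^+)|||_{1,h}}+\sup\frac{|(f^-,v_h^-)_{\Omega^-}-(f^-,v_h^-)_{\Omega^-,h}|}{|||v_h^-|||_{0,h}}$; $\sup\frac{|\langle g,\tau_h^-\cdot\boldsymbol n\rangle_{\Gamma_b}-\langle g,\tau_h^-\cdot\boldsymbol n\rangle_{\Gamma_b,h}|}{|||(\tau_h^-,v_h^+)|||_{1,h}}$.
   Formalization: Added: V_{g,h}^+ nonempty; gradient seminorm definite on V^+; the a_h bound of (A1) also at errors (σ^-−τ_h, u^+−v_h); discrete loads bounded by the data norms; (A3) approximates u^+ from V_{g,h}^+; stability bound only for g=0 on ∂Ω∩∂Ω^+. *)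

theory Defs
  imports "HOL-Analysis.Analysis"
begin

section \<open>Lebesgue and Sobolev spaces on subsets of the plane\<close>

type_synonym pt = "real ^ 2"
type_synonym sfun = "pt \<Rightarrow> real"
type_synonym vfun = "pt \<Rightarrow> pt"

text \<open>
  Elements of \<open>L\<^sup>2(U)\<close>, \<open>H\<^sup>m(U)\<close>, \<open>H(div, U)\<close> are represented by total functions whose values
  outside \<open>U\<close> are irrelevant; two functions represent the same element iff they satisfy \<open>ae_eq U\<close>.
\<close>

definition ae_eq :: "pt set \<Rightarrow> (pt \<Rightarrow> 'b) \<Rightarrow> (pt \<Rightarrow> 'b) \<Rightarrow> bool" where
  "ae_eq U v w \<longleftrightarrow> (AE x in lebesgue_on U. v x = w x)"

definition L2 :: "pt set \<Rightarrow> (pt \<Rightarrow> 'b::euclidean_space) set" where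
  "L2 U = {w. w \<in> borel_measurable (lebesgue_on U) \<and>
              integrable (lebesgue_on U) (\<lambda>x. (norm (w x))\<^sup>2)}"

definition l2_inner :: "pt set \<Rightarrow> (pt \<Rightarrow> 'b::euclidean_space) \<Rightarrow> (pt \<Rightarrow> 'b) \<Rightarrow> real" where
  "l2_inner U v w = (\<integral>x. v x \<bullet> w x \<partial>(lebesgue_on U))"

definition l2_norm :: "pt set \<Rightarrow> (pt \<Rightarrow> 'b::euclidean_space) \<Rightarrow> real" where
  "l2_norm U w = sqrt (l2_inner U w w)"

primrec C_k :: "nat \<Rightarrow> sfun \<Rightarrow> bool" where
  "C_k 0 f \<longleftrightarrow> continuous_on UNIV f"
| "C_k (Suc n) f \<longleftrightarrow> (\<forall>x. f differentiable at x) \<and>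
                     (\<forall>d. C_k n (\<lambda>x. frechet_derivative f (at x) d))"

definition smooth :: "sfun \<Rightarrow> bool" where
  "smooth f \<longleftrightarrow> (\<forall>n. C_k n f)"

definition classical_grad :: "sfun \<Rightarrow> vfun" where
  "classical_grad f x = (\<chi> i. frechet_derivative f (at x) (axis i 1))"

definition test_functions :: "pt set \<Rightarrow> sfun set" where
  "test_functions U = {\<phi>. smooth \<phi> \<and> compact (closure {x. \<phi> x \<noteq> 0}) \<and> closure {x. \<phi> x \<noteq> 0} \<subseteq> U}"

definition weak_grad :: "pt set \<Rightarrow> sfun \<Rightarrow> vfun \<Rightarrow> bool" where
  "weak_grad U v G \<longleftrightarrow> (\<forall>\<phi>\<in>test_functions U.
     (\<integral>x. v x *\<^sub>R classical_grad \<phi> x \<partial>(lebesgue_on U)) = - (\<integral>x. \<phi> x *\<^sub>R G x \<partial>(lebesgue_on U)))"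

definition weak_div :: "pt set \<Rightarrow> vfun \<Rightarrow> sfun \<Rightarrow> bool" where
  "weak_div U \<tau> d \<longleftrightarrow> (\<forall>\<phi>\<in>test_functions U.
     (\<integral>x. \<tau> x \<bullet> classical_grad \<phi> x \<partial>(lebesgue_on U)) = - (\<integral>x. \<phi> x * d x \<partial>(lebesgue_on U)))"

primrec Hm :: "nat \<Rightarrow> pt set \<Rightarrow> sfun set" where
  "Hm 0 U = L2 U"
| "Hm (Suc m) U = {v \<in> L2 U. \<exists>G. weak_grad U v G \<and> (\<forall>i. (\<lambda>x. G x $ i) \<in> Hm m U)}"

abbreviation H1 :: "pt set \<Rightarrow> sfun set" where
  "H1 \<equiv> Hm 1"

definition Hdiv :: "pt set \<Rightarrow> vfun set" where
  "Hdiv U = {\<tau> \<in> L2 U. \<exists>d\<in>L2 U. weak_div U \<tau> d}"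

text \<open>Representatives of the weak gradient and the weak divergence (unique up to \<open>ae_eq U\<close>).\<close>

definition grad :: "pt set \<Rightarrow> sfun \<Rightarrow> vfun" where
  "grad U v = (SOME G. G \<in> L2 U \<and> weak_grad U v G)"

definition dvg :: "pt set \<Rightarrow> vfun \<Rightarrow> sfun" where
  "dvg U \<tau> = (SOME d. d \<in> L2 U \<and> weak_div U \<tau> d)"


section \<open>Boundary values\<close>

text \<open>One-dimensional Hausdorff measure, i.e. arc length.\<close>

definition hausdorff1 :: "pt set \<Rightarrow> ennreal" where
  "hausdorff1 S = (SUP \<delta>\<in>{0::real<..}.
     INF A\<in>{A :: nat \<Rightarrow> pt set. S \<subseteq> (\<Union>n. A n) \<and> (\<forall>n. bounded (A n) \<and> diameter (A n) \<le> \<delta>)}.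
       (\<Sum>n. ennreal (diameter (A n))))"

definition arc_length_on :: "pt set \<Rightarrow> pt measure" where
  "arc_length_on S = restrict_space (measure_of UNIV (sets borel) hausdorff1) S"

text \<open>
  \<open>has_trace U S v p\<close>: the trace on \<open>S \<subseteq> \<partial>U\<close> of \<open>v \<in> H\<^sup>1(U)\<close> is \<open>p\<close>, the trace operator being the
  continuous extension of the restriction of functions that are smooth up to the boundary.
\<close>

definition has_trace :: "pt set \<Rightarrow> pt set \<Rightarrow> sfun \<Rightarrow> sfun \<Rightarrow> bool" where
  "has_trace U S v p \<longleftrightarrow> p \<in> borel_measurable (arc_length_on S) \<and>
     (\<exists>\<phi> :: nat \<Rightarrow> sfun. (\<forall>n. smooth (\<phi> n)) \<and>
        (\<lambda>n. l2_norm U (\<lambda>x. \<phi> n x - v x)) \<longlonglongrightarrow> 0 \<and>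
        (\<lambda>n. l2_norm U (\<lambda>x. classical_grad (\<phi> n) x - grad U v x)) \<longlonglongrightarrow> 0 \<and>
        (\<lambda>n. \<integral>\<^sup>+x. ennreal ((\<phi> n x - p x)\<^sup>2) \<partial>(arc_length_on S)) \<longlonglongrightarrow> 0)"

text \<open>Sobolev--Slobodeckij space and norm of order one half on a curve.\<close>

definition H_half :: "pt set \<Rightarrow> sfun set" where
  "H_half S = {g. g \<in> borel_measurable (arc_length_on S) \<and>
     integrable (arc_length_on S) (\<lambda>x. (g x)\<^sup>2) \<and>
     integrable (arc_length_on S \<Otimes>\<^sub>M arc_length_on S) (\<lambda>(x, y). (g x - g y)\<^sup>2 / (dist x y)\<^sup>2)}"

definition half_norm :: "pt set \<Rightarrow> sfun \<Rightarrow> real" where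
  "half_norm S g = sqrt ((\<integral>x. (g x)\<^sup>2 \<partial>(arc_length_on S)) +
     (\<integral>x. (\<integral>y. (g x - g y)\<^sup>2 / (dist x y)\<^sup>2 \<partial>(arc_length_on S)) \<partial>(arc_length_on S)))"

definition bilinear_on ::
  "('x \<Rightarrow> 'a::real_vector) set \<Rightarrow> ('x \<Rightarrow> 'b::real_vector) set \<Rightarrow>
   (('x \<Rightarrow> 'a) \<Rightarrow> ('x \<Rightarrow> 'b) \<Rightarrow> real) \<Rightarrow> bool" where
  "bilinear_on X Y p \<longleftrightarrow>
     (\<forall>a\<in>X. \<forall>b\<in>X. \<forall>c\<in>Y. \<forall>r s. p (\<lambda>x. r *\<^sub>R a x + s *\<^sub>R b x) c = r * p a c + s * p b c) \<and>
     (\<forall>a\<in>X. \<forall>b\<in>Y. \<forall>c\<in>Y. \<forall>r s. p a (\<lambda>x. r *\<^sub>R b x + s *\<^sub>R c x) = r * p a b + s * p a c)"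


section \<open>The interface problem\<close>

datatype side = Plus | Minus

text \<open>
  \<open>pairG \<tau> v\<close> stands for \<open>\<langle>\<tau>\<cdot>n, v\<rangle>\<close> on the interface, \<open>v\<close> being a function on the plus side, and
  \<open>pairB g \<tau>\<close> for \<open>\<langle>g, \<tau>\<cdot>n\<rangle>\<close> on the outer boundary of the minus side; see \<open>normal_trace_pairings\<close>.
\<close>

record setting =
  Om :: "pt set"
  Oms :: "side \<Rightarrow> pt set"
  beta :: "side \<Rightarrow> real"
  pairG :: "vfun \<Rightarrow> sfun \<Rightarrow> real"
  pairB :: "sfun \<Rightarrow> vfun \<Rightarrow> real"

definition interface :: "setting \<Rightarrow> pt set" where
  "interface P = frontier (Oms P Plus) \<inter> frontier (Oms P Minus)"

definition outer :: "setting \<Rightarrow> side \<Rightarrow> pt set" where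
  "outer P s = frontier (Om P) \<inter> frontier (Oms P s)"

definition lipschitz_interface :: "setting \<Rightarrow> bool" where
  "lipschitz_interface P \<longleftrightarrow> (\<forall>x\<in>interface P. \<exists>r>0. \<exists>e1 e2 L. \<exists>\<phi> :: real \<Rightarrow> real.
     norm e1 = 1 \<and> norm e2 = 1 \<and> e1 \<bullet> e2 = 0 \<and> L-lipschitz_on UNIV \<phi> \<and>
     (\<forall>y\<in>ball x r \<inter> Om P.
        (y \<in> Oms P Plus \<longleftrightarrow> \<phi> ((y - x) \<bullet> e1) < (y - x) \<bullet> e2) \<and>
        (y \<in> Oms P Minus \<longleftrightarrow> (y - x) \<bullet> e2 < \<phi> ((y - x) \<bullet> e1))))"

definition interface_geometry :: "setting \<Rightarrow> bool" where
  "interface_geometry P \<longleftrightarrow>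
     open (Om P) \<and> convex (Om P) \<and> Om P \<noteq> {} \<and> polytope (closure (Om P)) \<and>
     (\<forall>s. open (Oms P s) \<and> connected (Oms P s) \<and> Oms P s \<noteq> {}) \<and>
     Oms P Plus \<inter> Oms P Minus = {} \<and>
     Om P - interface P = Oms P Plus \<union> Oms P Minus \<and>
     lipschitz_interface P \<and> (\<forall>s. beta P s > 0)"

text \<open>
  The normal trace of \<open>\<tau> \<in> H(div, \<Omega>\<^sup>-)\<close> on \<open>\<partial>\<Omega>\<^sup>- = \<Gamma> \<union> \<Gamma>\<^sub>b\<close> is defined by Green's formula. Its
  restriction to \<open>\<Gamma>\<close> resp. \<open>\<Gamma>\<^sub>b\<close> acts canonically only on traces that extend by zero to the other part
  (in particular on \<open>V\<^sup>+\<close>), since the two parts may touch at points of \<open>\<partial>\<Omega>\<close>. Hence the two pairings are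
  taken to be any bilinear splitting of the duality: each depends only on the trace on its own part,
  and together they give Green's formula. This determines them wherever they are canonical.
\<close>

definition normal_trace_pairings :: "setting \<Rightarrow> bool" where
  "normal_trace_pairings P \<longleftrightarrow>
     bilinear_on (Hdiv (Oms P Minus)) (H1 (Oms P Plus)) (pairG P) \<and>
     bilinear_on (H_half (frontier (Om P))) (Hdiv (Oms P Minus)) (pairB P) \<and>
     (\<forall>\<tau>\<in>Hdiv (Oms P Minus). \<forall>\<tau>'\<in>Hdiv (Oms P Minus). ae_eq (Oms P Minus) \<tau> \<tau>' \<longrightarrow>
        (\<forall>v\<in>H1 (Oms P Plus). pairG P \<tau> v = pairG P \<tau>' v) \<and>
        (\<forall>g\<in>H_half (frontier (Om P)). pairB P g \<tau> = pairB P g \<tau>')) \<and>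
     (\<forall>\<tau>\<in>Hdiv (Oms P Minus). \<forall>v\<in>H1 (Oms P Plus).
        has_trace (Oms P Plus) (interface P) v (\<lambda>x. 0) \<longrightarrow> pairG P \<tau> v = 0) \<and>
     (\<forall>\<tau>\<in>Hdiv (Oms P Minus). \<forall>g\<in>H_half (frontier (Om P)).
        (AE x in arc_length_on (outer P Minus). g x = 0) \<longrightarrow> pairB P g \<tau> = 0) \<and>
     (\<forall>\<tau>\<in>Hdiv (Oms P Minus). \<forall>w\<in>H1 (Om P). \<forall>g\<in>H_half (frontier (Om P)).
        has_trace (Om P) (frontier (Om P)) w g \<longrightarrow>
        pairG P \<tau> w + pairB P g \<tau> =
          l2_inner (Oms P Minus) (dvg (Oms P Minus) \<tau>) w +
          l2_inner (Oms P Minus) \<tau> (grad (Oms P Minus) w))"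

text \<open>\<open>V_plus P g\<close> is \<open>V\<^sup>+\<^sub>g\<close>; \<open>V\<^sup>+\<close> is the case \<open>g = 0\<close>.\<close>

definition V_plus :: "setting \<Rightarrow> sfun \<Rightarrow> sfun set" where
  "V_plus P g = {v \<in> H1 (Oms P Plus). has_trace (Oms P Plus) (outer P Plus) v g}"

text \<open>
  \<open>|\<cdot>|\<^sub>1\<close> is a norm on \<open>V\<^sup>+\<close>, i.e. \<open>\<partial>\<Omega> \<inter> \<partial>\<Omega>\<^sup>+\<close> is not negligible. Otherwise \<open>V\<^sup>+\<close> contains the constants
  and \<open>|||\<cdot>|||\<^sub>1\<^sub>,\<^sub>h\<close> is not a norm.
\<close>

definition seminorm_definite :: "setting \<Rightarrow> bool" where
  "seminorm_definite P \<longleftrightarrow> (\<forall>v\<in>V_plus P (\<lambda>x. 0).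
     ae_eq (Oms P Plus) (grad (Oms P Plus) v) (\<lambda>x. 0) \<longrightarrow> ae_eq (Oms P Plus) v (\<lambda>x. 0))"

definition flux :: "setting \<Rightarrow> side \<Rightarrow> sfun \<Rightarrow> vfun" where
  "flux P s u x = beta P s *\<^sub>R grad (Oms P s) u x"

text \<open>
  \<open>[u] = 0\<close> is \<open>u \<in> H\<^sup>1(\<Omega>)\<close>. In \<open>[\<beta>\<nabla>u\<cdot>n] = 0\<close> the normal trace of the flux from the plus side is again
  given by Green's formula, now on \<open>\<Omega>\<^sup>+\<close>, whose outward normal on \<open>\<Gamma>\<close> is \<open>-n\<close>.
\<close>

definition solves_interface_problem :: "setting \<Rightarrow> sfun \<Rightarrow> sfun \<Rightarrow> sfun \<Rightarrow> bool" where
  "solves_interface_problem P f g u \<longleftrightarrow>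
     u \<in> H1 (Om P) \<and> has_trace (Om P) (frontier (Om P)) u g \<and>
     (\<forall>s. weak_div (Oms P s) (flux P s u) (\<lambda>x. - f x)) \<and>
     (\<forall>v\<in>V_plus P (\<lambda>x. 0).
        pairG P (flux P Minus u) v =
          - (l2_inner (Oms P Plus) (dvg (Oms P Plus) (flux P Plus u)) v +
             l2_inner (Oms P Plus) (flux P Plus u) (grad (Oms P Plus) v)))"

definition a_form :: "setting \<Rightarrow> vfun \<Rightarrow> sfun \<Rightarrow> vfun \<Rightarrow> sfun \<Rightarrow> real" where
  "a_form P \<sigma> u \<tau> v =
     1 / beta P Minus * l2_inner (Oms P Minus) \<sigma> \<tau> +
     l2_inner (Oms P Plus) (\<lambda>x. beta P Plus *\<^sub>R grad (Oms P Plus) u x) (grad (Oms P Plus) v) +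
     pairG P \<sigma> v - pairG P \<tau> u"

definition b_form :: "setting \<Rightarrow> sfun \<Rightarrow> vfun \<Rightarrow> real" where
  "b_form P w \<tau> = l2_inner (Oms P Minus) (dvg (Oms P Minus) \<tau>) w"

text \<open>\<open>u \<in> H\<^sup>k\<^sup>+\<^sup>1(\<Omega>\<^sup>+ \<union> \<Omega>\<^sup>-) \<inter> H\<^sup>1(\<Omega>)\<close>\<close>

definition regular :: "setting \<Rightarrow> nat \<Rightarrow> sfun \<Rightarrow> bool" where
  "regular P k u \<longleftrightarrow> (\<forall>s. u \<in> Hm (k + 1) (Oms P s)) \<and> u \<in> H1 (Om P)"


section \<open>The discretization\<close>

text \<open>
  \<open>Su s K\<close> and \<open>Ssig K\<close> are the shape function spaces, \<open>quad s K\<close> is the discrete inner product on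
  \<open>K\<^sup>s\<close>, \<open>quadG K \<tau> v\<close> is the discrete \<open>\<langle>\<tau>\<cdot>n, v\<rangle>\<close> on \<open>\<Gamma>\<^sub>K\<close>, and \<open>quadB g \<tau>\<close> the discrete \<open>\<langle>g, \<tau>\<cdot>n\<rangle>\<close> on
  \<open>\<Gamma>\<^sub>b\<close>. The last two take the fields themselves as arguments, with the traces left implicit.
\<close>

record discretization =
  mesh :: "pt set set"
  Su :: "side \<Rightarrow> pt set \<Rightarrow> sfun set"
  Ssig :: "pt set \<Rightarrow> vfun set"
  quad :: "side \<Rightarrow> pt set \<Rightarrow> sfun \<Rightarrow> sfun \<Rightarrow> real"
  quadG :: "pt set \<Rightarrow> vfun \<Rightarrow> sfun \<Rightarrow> real"
  quadB :: "sfun \<Rightarrow> vfun \<Rightarrow> real"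

definition mesh_size :: "discretization \<Rightarrow> real" where
  "mesh_size D = Max (diameter ` mesh D)"

text \<open>An element is cut unless it meets \<open>\<Gamma>\<close> only in vertices and in entire edges lying on \<open>\<Gamma>\<close>.\<close>

definition interface_element :: "setting \<Rightarrow> pt set \<Rightarrow> bool" where
  "interface_element P K \<longleftrightarrow>
     \<not> K \<inter> interface P \<subseteq> {x. x extreme_point_of K} \<union> \<Union>{e. e edge_of K \<and> e \<subseteq> interface P}"

definition mesh_side :: "setting \<Rightarrow> discretization \<Rightarrow> side \<Rightarrow> pt set set" where
  "mesh_side P D s = {K \<in> mesh D. interface_element P K \<or> interior K \<subseteq> Oms P s}"

definition finite_dim_space :: "('x \<Rightarrow> 'a::real_vector) set \<Rightarrow> bool" where
  "finite_dim_space S \<longleftrightarrow> (\<exists>B. finite B \<and> S = {(\<lambda>x. \<Sum>b\<in>B. c b *\<^sub>R b x) | c :: ('x \<Rightarrow> 'a) \<Rightarrow> real. True})"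

text \<open>
  Well-definedness modulo \<open>ae_eq\<close> does not exclude rules based on point values: on the functions to
  which such a rule is meant to be applied, nodes are evaluated on the continuous representative.
\<close>

definition discrete_inner_product :: "pt set \<Rightarrow> (sfun \<Rightarrow> sfun \<Rightarrow> real) \<Rightarrow> bool" where
  "discrete_inner_product U q \<longleftrightarrow>
     bilinear_on (L2 U) (L2 U) q \<and>
     (\<forall>v\<in>L2 U. \<forall>w\<in>L2 U. q v w = q w v) \<and> (\<forall>v\<in>L2 U. 0 \<le> q v v) \<and>
     (\<forall>v\<in>L2 U. \<forall>v'\<in>L2 U. \<forall>w\<in>L2 U. ae_eq U v v' \<longrightarrow> q v w = q v' w)"

definition valid_discretization :: "setting \<Rightarrow> discretization \<Rightarrow> bool" where
  "valid_discretization P D \<longleftrightarrow>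
     triangulation (mesh D) \<and> (\<forall>K\<in>mesh D. 2 simplex K) \<and> \<Union>(mesh D) = closure (Om P) \<and>
     (\<forall>K\<in>mesh D.
        (\<forall>s. finite_dim_space (Su D s K)) \<and> finite_dim_space (Ssig D K) \<and>
        Su D Plus K \<subseteq> H1 (interior K) \<and> Su D Minus K \<subseteq> L2 K \<and> Ssig D K \<subseteq> Hdiv (interior K) \<and>
        (\<forall>s. discrete_inner_product (K \<inter> Oms P s) (quad D s K)) \<and>
        bilinear_on (Hdiv (Oms P Minus)) (H1 (Oms P Plus)) (quadG D K) \<and>
        (\<forall>\<tau>\<in>Hdiv (Oms P Minus). \<forall>\<tau>'\<in>Hdiv (Oms P Minus). \<forall>v\<in>H1 (Oms P Plus). \<forall>v'\<in>H1 (Oms P Plus).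
           ae_eq (Oms P Minus) \<tau> \<tau>' \<and> ae_eq (Oms P Plus) v v' \<longrightarrow> quadG D K \<tau> v = quadG D K \<tau>' v')) \<and>
     bilinear_on (H_half (frontier (Om P))) (Hdiv (Oms P Minus)) (quadB D) \<and>
     (\<forall>g\<in>H_half (frontier (Om P)). \<forall>\<tau>\<in>Hdiv (Oms P Minus). \<forall>\<tau>'\<in>Hdiv (Oms P Minus).
        ae_eq (Oms P Minus) \<tau> \<tau>' \<longrightarrow> quadB D g \<tau> = quadB D g \<tau>')"

text \<open>\<open>Vp_h P D g\<close> is \<open>V\<^sup>+\<^sub>g\<^sub>,\<^sub>h\<close>; \<open>V\<^sup>+\<^sub>h\<close> is the case \<open>g = 0\<close>.\<close>

definition Vp_h :: "setting \<Rightarrow> discretization \<Rightarrow> sfun \<Rightarrow> sfun set" where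
  "Vp_h P D g = {v \<in> H1 (Oms P Plus).
     (\<forall>K\<in>mesh_side P D Plus. \<exists>p\<in>Su D Plus K. ae_eq (K \<inter> Oms P Plus) v p) \<and>
     has_trace (Oms P Plus) (outer P Plus) v g}"

abbreviation Vp0_h :: "setting \<Rightarrow> discretization \<Rightarrow> sfun set" where
  "Vp0_h P D \<equiv> Vp_h P D (\<lambda>x. 0)"

definition Q_h :: "setting \<Rightarrow> discretization \<Rightarrow> vfun set" where
  "Q_h P D = {\<tau> \<in> Hdiv (Oms P Minus).
     \<forall>K\<in>mesh_side P D Minus. \<exists>p\<in>Ssig D K. ae_eq (K \<inter> Oms P Minus) \<tau> p}"

definition Vm_h :: "setting \<Rightarrow> discretization \<Rightarrow> sfun set" where
  "Vm_h P D = {v \<in> L2 (Oms P Minus).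
     \<forall>K\<in>mesh_side P D Minus. \<exists>p\<in>Su D Minus K. ae_eq (K \<inter> Oms P Minus) v p}"

definition inner_h :: "setting \<Rightarrow> discretization \<Rightarrow> side \<Rightarrow> sfun \<Rightarrow> sfun \<Rightarrow> real" where
  "inner_h P D s v w = (\<Sum>K\<in>{K \<in> mesh D. K \<inter> Oms P s \<noteq> {}}. quad D s K v w)"

definition vinner_h :: "setting \<Rightarrow> discretization \<Rightarrow> side \<Rightarrow> vfun \<Rightarrow> vfun \<Rightarrow> real" where
  "vinner_h P D s \<sigma> \<tau> = (\<Sum>j\<in>UNIV. inner_h P D s (\<lambda>x. \<sigma> x $ j) (\<lambda>x. \<tau> x $ j))"

definition norm_h :: "setting \<Rightarrow> discretization \<Rightarrow> side \<Rightarrow> sfun \<Rightarrow> real" where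
  "norm_h P D s w = sqrt (inner_h P D s w w)"

definition vnorm_h :: "setting \<Rightarrow> discretization \<Rightarrow> side \<Rightarrow> vfun \<Rightarrow> real" where
  "vnorm_h P D s \<tau> = sqrt (vinner_h P D s \<tau> \<tau>)"

definition pairG_h :: "setting \<Rightarrow> discretization \<Rightarrow> vfun \<Rightarrow> sfun \<Rightarrow> real" where
  "pairG_h P D \<tau> v = (\<Sum>K\<in>{K \<in> mesh D. K \<inter> interface P \<noteq> {}}. quadG D K \<tau> v)"

definition a_h :: "setting \<Rightarrow> discretization \<Rightarrow> vfun \<Rightarrow> sfun \<Rightarrow> vfun \<Rightarrow> sfun \<Rightarrow> real" where
  "a_h P D \<sigma> u \<tau> v =
     1 / beta P Minus * vinner_h P D Minus \<sigma> \<tau> +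
     vinner_h P D Plus (\<lambda>x. beta P Plus *\<^sub>R grad (Oms P Plus) u x) (grad (Oms P Plus) v) +
     pairG_h P D \<sigma> v - pairG_h P D \<tau> u"

definition b_h :: "setting \<Rightarrow> discretization \<Rightarrow> sfun \<Rightarrow> vfun \<Rightarrow> real" where
  "b_h P D w \<tau> = inner_h P D Minus (dvg (Oms P Minus) \<tau>) w"

definition norm1_h :: "setting \<Rightarrow> discretization \<Rightarrow> vfun \<Rightarrow> sfun \<Rightarrow> real" where
  "norm1_h P D \<tau> v = sqrt (1 / beta P Minus * (vnorm_h P D Minus \<tau>)\<^sup>2 +
     (norm_h P D Minus (dvg (Oms P Minus) \<tau>))\<^sup>2 +
     beta P Plus * (vnorm_h P D Plus (grad (Oms P Plus) v))\<^sup>2)"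

abbreviation norm0_h :: "setting \<Rightarrow> discretization \<Rightarrow> sfun \<Rightarrow> real" where
  "norm0_h P D w \<equiv> norm_h P D Minus w"

definition direct_fem_solution ::
  "setting \<Rightarrow> discretization \<Rightarrow> sfun \<Rightarrow> sfun \<Rightarrow> vfun \<Rightarrow> sfun \<Rightarrow> sfun \<Rightarrow> bool" where
  "direct_fem_solution P D f g \<sigma>\<^sub>h um\<^sub>h up\<^sub>h \<longleftrightarrow>
     \<sigma>\<^sub>h \<in> Q_h P D \<and> um\<^sub>h \<in> Vm_h P D \<and> up\<^sub>h \<in> Vp_h P D g \<and>
     (\<forall>\<tau>\<in>Q_h P D. \<forall>v\<in>Vp0_h P D.
        a_h P D \<sigma>\<^sub>h up\<^sub>h \<tau> v + b_h P D um\<^sub>h \<tau> = inner_h P D Plus f v + quadB D g \<tau>) \<and>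
     (\<forall>w\<in>Vm_h P D. b_h P D w \<sigma>\<^sub>h = - inner_h P D Minus f w)"


section \<open>Assumptions on a family of discretizations\<close>

text \<open>
  \<open>D i\<close> ranges over the meshes; a bound \<open>\<lesssim>\<close> means that one constant serves all \<open>i\<close>. In HOL
  \<open>x / 0 = 0\<close>, so arguments of norm zero do not contribute to the suprema below.
\<close>

definition boundedness :: "setting \<Rightarrow> ('i \<Rightarrow> discretization) \<Rightarrow> bool" where
  "boundedness P D \<longleftrightarrow> (\<exists>C>0. \<forall>i.
     (\<forall>w\<in>Vm_h P (D i). l2_norm (Oms P Minus) w \<le> C * norm_h P (D i) Minus w \<and>
                        norm_h P (D i) Minus w \<le> C * l2_norm (Oms P Minus) w) \<and>
     (\<forall>\<tau>\<in>Q_h P (D i). l2_norm (Oms P Minus) \<tau> \<le> C * vnorm_h P (D i) Minus \<tau> \<and>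
                       vnorm_h P (D i) Minus \<tau> \<le> C * l2_norm (Oms P Minus) \<tau>) \<and>
     (\<forall>v\<in>Vp0_h P (D i). l2_norm (Oms P Plus) v \<le> C * norm_h P (D i) Plus v \<and>
                         norm_h P (D i) Plus v \<le> C * l2_norm (Oms P Plus) v) \<and>
     (\<forall>v\<in>Vp0_h P (D i). let G = grad (Oms P Plus) v in
                         l2_norm (Oms P Plus) G \<le> C * vnorm_h P (D i) Plus G \<and>
                         vnorm_h P (D i) Plus G \<le> C * l2_norm (Oms P Plus) G) \<and>
     (\<forall>\<sigma>\<in>Q_h P (D i). \<forall>u\<in>Vp0_h P (D i). \<forall>\<tau>\<in>Q_h P (D i). \<forall>v\<in>Vp0_h P (D i).
        \<bar>a_h P (D i) \<sigma> u \<tau> v\<bar> \<le> C * (norm1_h P (D i) \<sigma> u * norm1_h P (D i) \<tau> v)) \<and>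
     (\<forall>w\<in>Vm_h P (D i). \<forall>\<sigma>\<in>Q_h P (D i). \<forall>u\<in>Vp0_h P (D i).
        \<bar>b_h P (D i) w \<sigma>\<bar> \<le> C * (norm0_h P (D i) w * norm1_h P (D i) \<sigma> u)))"

text \<open>
  Boundedness of \<open>a_h\<close> on the errors of discrete approximations. The volume terms are bounded by
  Cauchy--Schwarz; for the quadrature on \<open>\<Gamma>\<close> this does not follow from the bound on discrete functions.
\<close>

definition boundedness_on_errors :: "setting \<Rightarrow> ('i \<Rightarrow> discretization) \<Rightarrow> nat \<Rightarrow> sfun \<Rightarrow> sfun \<Rightarrow> bool" where
  "boundedness_on_errors P D k g u \<longleftrightarrow> (regular P k u \<longrightarrow> (\<exists>C>0. \<forall>i.
     \<forall>\<sigma>'\<in>Q_h P (D i). \<forall>u'\<in>Vp_h P (D i) g. \<forall>\<tau>\<in>Q_h P (D i). \<forall>v\<in>Vp0_h P (D i).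
       \<bar>a_h P (D i) (\<lambda>x. flux P Minus u x - \<sigma>' x) (\<lambda>x. u x - u' x) \<tau> v\<bar>
         \<le> C * (norm1_h P (D i) (\<lambda>x. flux P Minus u x - \<sigma>' x) (\<lambda>x. u x - u' x) * norm1_h P (D i) \<tau> v)))"

text \<open>
  Boundedness of the discrete right-hand sides by the norms of the data, uniformly over a set of data
  \<open>(f, g)\<close>.
\<close>

definition bounded_loads :: "setting \<Rightarrow> ('i \<Rightarrow> discretization) \<Rightarrow> (sfun \<times> sfun) set \<Rightarrow> bool" where
  "bounded_loads P D FG \<longleftrightarrow> (\<exists>C>0. \<forall>(f, g)\<in>FG. \<forall>i.
     (\<forall>\<tau>\<in>Q_h P (D i). \<forall>v\<in>Vp0_h P (D i).
        \<bar>inner_h P (D i) Plus f v\<bar> \<le> C * (l2_norm (Om P) f * norm1_h P (D i) \<tau> v) \<and>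
        \<bar>quadB (D i) g \<tau>\<bar> \<le> C * (half_norm (outer P Minus) g * norm1_h P (D i) \<tau> v)) \<and>
     (\<forall>w\<in>Vm_h P (D i). \<bar>inner_h P (D i) Minus f w\<bar> \<le> C * (l2_norm (Om P) f * norm0_h P (D i) w)))"

definition inf_sup :: "setting \<Rightarrow> ('i \<Rightarrow> discretization) \<Rightarrow> bool" where
  "inf_sup P D \<longleftrightarrow> (\<exists>\<alpha>>0. \<forall>i.
     ereal \<alpha> \<le> (INF w\<in>{w \<in> Vm_h P (D i). \<not> ae_eq (Oms P Minus) w (\<lambda>x. 0)}.
                  SUP (\<tau>, v)\<in>Q_h P (D i) \<times> Vp0_h P (D i).
                    ereal (b_h P (D i) w \<tau> / (norm1_h P (D i) \<tau> v * norm0_h P (D i) w))))"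

definition div_inclusion :: "setting \<Rightarrow> ('i \<Rightarrow> discretization) \<Rightarrow> bool" where
  "div_inclusion P D \<longleftrightarrow> (\<forall>i. \<forall>\<tau>\<in>Q_h P (D i). dvg (Oms P Minus) \<tau> \<in> Vm_h P (D i))"

text \<open>\<open>u\<^sup>+\<close> has boundary values \<open>g\<close>, so it is approximated from \<open>V\<^sup>+\<^sub>g\<^sub>,\<^sub>h\<close>, which is \<open>V\<^sup>+\<^sub>h\<close> if \<open>g = 0\<close> there.\<close>

definition approximation_property :: "setting \<Rightarrow> ('i \<Rightarrow> discretization) \<Rightarrow> nat \<Rightarrow> sfun \<Rightarrow> sfun \<Rightarrow> bool" where
  "approximation_property P D k g u \<longleftrightarrow> (regular P k u \<longrightarrow> (\<exists>C>0. \<forall>i.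
     (INF (\<tau>, v)\<in>Q_h P (D i) \<times> Vp_h P (D i) g.
        ereal (norm1_h P (D i) (\<lambda>x. flux P Minus u x - \<tau> x) (\<lambda>x. u x - v x))) +
     (INF w\<in>Vm_h P (D i). ereal (norm0_h P (D i) (\<lambda>x. u x - w x)))
       \<le> ereal (C * mesh_size (D i) ^ k)))"

definition quadrature_accuracy ::
  "setting \<Rightarrow> ('i \<Rightarrow> discretization) \<Rightarrow> nat \<Rightarrow> sfun \<Rightarrow> sfun \<Rightarrow> sfun \<Rightarrow> bool" where
  "quadrature_accuracy P D k f g u \<longleftrightarrow> (regular P k u \<longrightarrow> (\<exists>C>0. \<forall>i.
     (SUP (\<tau>, v)\<in>Q_h P (D i) \<times> Vp0_h P (D i).
        ereal (\<bar>a_form P (flux P Minus u) u \<tau> v - a_h P (D i) (flux P Minus u) u \<tau> v\<bar> /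
               norm1_h P (D i) \<tau> v))
       \<le> ereal (C * mesh_size (D i) ^ k) \<and>
     (SUP (\<tau>, v)\<in>Q_h P (D i) \<times> Vp0_h P (D i).
        ereal (\<bar>b_form P u \<tau> - b_h P (D i) u \<tau>\<bar> / norm1_h P (D i) \<tau> v)) +
     (SUP w\<in>Vm_h P (D i).
        ereal (\<bar>b_form P w (flux P Minus u) - b_h P (D i) w (flux P Minus u)\<bar> / norm0_h P (D i) w))
       \<le> ereal (C * mesh_size (D i) ^ k) \<and>
     (SUP (\<tau>, v)\<in>Q_h P (D i) \<times> Vp0_h P (D i).
        ereal (\<bar>l2_inner (Oms P Plus) f v - inner_h P (D i) Plus f v\<bar> / norm1_h P (D i) \<tau> v)) +
     (SUP w\<in>Vm_h P (D i).
        ereal (\<bar>l2_inner (Oms P Minus) f w - inner_h P (D i) Minus f w\<bar> / norm0_h P (D i) w))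
       \<le> ereal (C * mesh_size (D i) ^ k) \<and>
     (SUP (\<tau>, v)\<in>Q_h P (D i) \<times> Vp0_h P (D i).
        ereal (\<bar>pairB P g \<tau> - quadB (D i) g \<tau>\<bar> / norm1_h P (D i) \<tau> v))
       \<le> ereal (C * mesh_size (D i) ^ k)))"

end

theory Submission
  imports Defs "HOL-Library.Function_Algebras"
begin

text \<open>
  Since the interface pairings cancel, \<open>a_h(x; x)\<close> is \<open>|||x|||\<^sub>1\<^sub>,\<^sub>h\<^sup>2\<close> without its divergence part, and
  that part is recovered by testing the second equation with the divergence itself, which is
  admissible because \<open>div Q_h \<subseteq> V_h\<close>. Together with the inf-sup bound for the multiplier this gives
  \<open>n\<^sup>2 \<le> c M n + c M\<^sup>2\<close> for \<open>n = |||x|||\<^sub>1\<^sub>,\<^sub>h\<close> and \<open>M\<close> the size of the right-hand sides, hence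
  \<open>n \<le> (c + 1) M\<close> with a constant depending only on the bounds in (A1) and (A2).

  Uniqueness is the case \<open>M = 0\<close>, and existence follows because the discrete spaces are
  finite-dimensional modulo null functions. The error between the discrete solution and an
  approximation of the exact one solves the same system, with right-hand sides consisting of
  quadrature and approximation errors; the triangle inequality gives the convergence rate.

  The gradient and the divergence are chosen representatives, so they are linear only almost
  everywhere. This rests on the fundamental lemma of the calculus of variations, proved with the test
  functions built from \<open>exp (- 1 / t)\<close>.
\<close>

section \<open>Linear algebra modulo a null space\<close>

text \<open>Nothing here is definite. Values of a function off its domain are irrelevant, and a
  quadrature rule may vanish on nonzero functions, so norms are seminorms and linear algebra is done
  on sets of functions modulo null functions. Definiteness enters only where a zero norm must force
  null functions: there the norm comparison on discrete functions leads back to L2, and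
  \<open>seminorm_definite\<close> removes the constants left by a null gradient.

  The exact solution is not discrete, so bounds on discrete functions do not cover its error. For
  \<open>b_h\<close> Cauchy-Schwarz fills the gap, since the divergence is part of
  \<open>norm1_h\<close>. The interface quadrature in \<open>a_h\<close> is not controlled by any
  term of that norm, whence the separate constant for errors.

  A nonzero datum \<open>g\<close> makes the trial set affine. Existence subtracts a lift, and the
  error argument compares two elements with the same datum. The stability bound measures the
  solution itself, so it is stated for data that vanish on the plus part of the outer
  boundary.\<close>

instantiation "fun" :: (type, real_vector) real_vector
begin

definition scaleR_fun :: "real \<Rightarrow> ('a \<Rightarrow> 'b) \<Rightarrow> 'a \<Rightarrow> 'b" where
  "scaleR_fun r f = (\<lambda>x. r *\<^sub>R f x)"

instance
  by standard (simp_all add: scaleR_fun_def fun_eq_iff scaleR_add_right scaleR_add_left)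

end

lemma scaleR_fun_apply [simp]: "(r *\<^sub>R f) x = r *\<^sub>R f x"
  by (simp add: scaleR_fun_def)

lemma sum_fun_apply: "(\<Sum>i\<in>I. f i) x = (\<Sum>i\<in>I. f i x)"
  by (induction I rule: infinite_finite_induct) auto

section \<open>Functionals and forms that are linear only on a subspace\<close>

definition lin_on :: "'w::real_vector set \<Rightarrow> ('w \<Rightarrow> real) \<Rightarrow> bool" where
  "lin_on S L \<longleftrightarrow> (\<forall>x\<in>S. \<forall>y\<in>S. \<forall>r s. L (r *\<^sub>R x + s *\<^sub>R y) = r * L x + s * L y)"

lemma lin_onD: "lin_on S L \<Longrightarrow> x \<in> S \<Longrightarrow> y \<in> S \<Longrightarrow> L (r *\<^sub>R x + s *\<^sub>R y) = r * L x + s * L y"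
  by (simp add: lin_on_def)

lemma lin_on_0: "lin_on S L \<Longrightarrow> x \<in> S \<Longrightarrow> L 0 = 0"
  using lin_onD[of S L x x 0 0] by simp

lemma lin_on_add: "lin_on S L \<Longrightarrow> x \<in> S \<Longrightarrow> y \<in> S \<Longrightarrow> L (x + y) = L x + L y"
  using lin_onD[of S L x y 1 1] by simp

lemma lin_on_diff: "lin_on S L \<Longrightarrow> x \<in> S \<Longrightarrow> y \<in> S \<Longrightarrow> L (x - y) = L x - L y"
  using lin_onD[of S L x y 1 "-1"] by simp

lemma lin_on_scale: "lin_on S L \<Longrightarrow> x \<in> S \<Longrightarrow> L (r *\<^sub>R x) = r * L x"
  using lin_onD[of S L x x r 0] by simp

lemma lin_on_sum:
  assumes "subspace S" "lin_on S L" "\<And>i. i \<in> I \<Longrightarrow> e i \<in> S"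
  shows "L (\<Sum>i\<in>I. c i *\<^sub>R e i) = (\<Sum>i\<in>I. c i * L (e i))"
  using assms(3)
proof (induction I rule: infinite_finite_induct)
  case (insert i I)
  have "(\<Sum>i\<in>I. c i *\<^sub>R e i) \<in> S"
    using insert.prems by (intro subspace_sum subspace_scale assms(1)) auto
  then show ?case
    using insert lin_on_add[OF assms(2)] lin_on_scale[OF assms(2)]
    by (simp add: subspace_scale assms(1))
qed (use lin_on_0[OF assms(2) subspace_0[OF assms(1)]] in auto)

lemma lin_on_plus: "lin_on S L \<Longrightarrow> lin_on S M \<Longrightarrow> lin_on S (\<lambda>x. L x + M x)"
  by (simp add: lin_on_def algebra_simps)

lemma lin_on_minus: "lin_on S L \<Longrightarrow> lin_on S M \<Longrightarrow> lin_on S (\<lambda>x. L x - M x)"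
  by (simp add: lin_on_def algebra_simps)

lemma lin_on_times: "lin_on S L \<Longrightarrow> lin_on S (\<lambda>x. c * L x)"
  by (simp add: lin_on_def algebra_simps)

lemma lin_on_setsum: "(\<And>i. i \<in> I \<Longrightarrow> lin_on S (L i)) \<Longrightarrow> lin_on S (\<lambda>x. \<Sum>i\<in>I. L i x)"
  by (simp add: lin_on_def sum_distrib_left sum.distrib)

lemma lin_on_subset: "lin_on S L \<Longrightarrow> T \<subseteq> S \<Longrightarrow> lin_on T L"
  by (auto simp: lin_on_def)

lemma subspaceI_lincomb:
  assumes "0 \<in> S" "\<And>x y r s. x \<in> S \<Longrightarrow> y \<in> S \<Longrightarrow> r *\<^sub>R x + s *\<^sub>R y \<in> S"
  shows "subspace S"
  unfolding subspace_def
  using assms(1) assms(2)[of _ _ 1 1] assms(2)[of _ _ _ 0] by force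

lemma subspace_lincomb: "subspace S \<Longrightarrow> x \<in> S \<Longrightarrow> y \<in> S \<Longrightarrow> r *\<^sub>R x + s *\<^sub>R y \<in> S"
  by (simp add: subspace_add subspace_scale)

text \<open>Semidefinite only: an L2 product vanishes on null functions and a quadrature form
  possibly on others. The carrier \<open>S\<close> is needed because integrals and quadratures are
  bilinear only on suitable functions. Instances are the L2 products, the quadrature sums and the
  form behind \<open>norm1_h\<close>.\<close>

locale semi_inner =
  fixes S :: "'w::real_vector set" and q :: "'w \<Rightarrow> 'w \<Rightarrow> real"
  assumes sub: "subspace S"
    and lin: "z \<in> S \<Longrightarrow> lin_on S (\<lambda>x. q x z)"
    and sym: "x \<in> S \<Longrightarrow> y \<in> S \<Longrightarrow> q x y = q y x"
    and nonneg: "x \<in> S \<Longrightarrow> 0 \<le> q x x"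
begin

lemma lin_right: "z \<in> S \<Longrightarrow> lin_on S (q z)"
  using lin[of z] sym subspace_lincomb[OF sub] by (simp add: lin_on_def)

lemma expand:
  assumes "x \<in> S" "y \<in> S"
  shows "q (r *\<^sub>R x + s *\<^sub>R y) (r *\<^sub>R x + s *\<^sub>R y) = r\<^sup>2 * q x x + 2 * r * s * q x y + s\<^sup>2 * q y y"
proof -
  have z: "r *\<^sub>R x + s *\<^sub>R y \<in> S"
    by (rule subspace_lincomb[OF sub assms])
  show ?thesis
    using lin_onD[OF lin[OF z] assms] lin_onD[OF lin_right[OF assms(1)] assms]
      lin_onD[OF lin_right[OF assms(2)] assms] sym[OF assms]
    by (simp add: power2_eq_square algebra_simps)
qed

lemma cauchy_schwarz_square:
  assumes "x \<in> S" "y \<in> S"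
  shows "(q x y)\<^sup>2 \<le> q x x * q y y"
proof (cases "q y y = 0")
  case True
  have "q x y = 0"
  proof (rule ccontr)
    assume n: "q x y \<noteq> 0"
    \<comment> \<open>The value for which \<open>q x x + 2 * t * q x y\<close> is -1; the quadratic
      term in \<open>t\<close> is absent because \<open>q y y = 0\<close>.\<close>
    define t where "t = - (q x x + 1) / (2 * q x y)"
    have "0 \<le> q (1 *\<^sub>R x + t *\<^sub>R y) (1 *\<^sub>R x + t *\<^sub>R y)"
      by (intro nonneg subspace_lincomb sub assms)
    also have "\<dots> = q x x + 2 * t * q x y"
      unfolding expand[OF assms] using True by simp
    also have "\<dots> = -1"
      unfolding t_def using n by (simp add: field_simps)
    finally show False by simp
  qed
  then show ?thesis using True by simp
next
  case False
  then have p: "q y y > 0" using nonneg[OF assms(2)] by simp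
  \<comment> \<open>The vector is the component of \<open>x\<close> orthogonal to \<open>y\<close>,
    multiplied by \<open>q y y\<close> to avoid a division.\<close>
  have "0 \<le> q (q y y *\<^sub>R x + (- q x y) *\<^sub>R y) (q y y *\<^sub>R x + (- q x y) *\<^sub>R y)"
    by (intro nonneg subspace_lincomb sub assms)
  also have "\<dots> = q y y * (q x x * q y y - (q x y)\<^sup>2)"
    unfolding expand[OF assms] by (simp add: power2_eq_square algebra_simps)
  finally show ?thesis using p by (simp add: zero_le_mult_iff)
qed

lemma cauchy_schwarz:
  assumes "x \<in> S" "y \<in> S"
  shows "\<bar>q x y\<bar> \<le> sqrt (q x x) * sqrt (q y y)"
  using real_sqrt_le_mono[OF cauchy_schwarz_square[OF assms]] by (simp add: real_sqrt_mult)

lemma triangle: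
  assumes "x \<in> S" "y \<in> S"
  shows "sqrt (q (x + y) (x + y)) \<le> sqrt (q x x) + sqrt (q y y)"
proof (rule real_le_lsqrt)
  have "q (x + y) (x + y) = q x x + 2 * q x y + q y y"
    using expand[OF assms, of 1 1] by simp
  also have "\<dots> \<le> (sqrt (q x x) + sqrt (q y y))\<^sup>2"
    using cauchy_schwarz[OF assms] nonneg assms by (simp add: power2_sum)
  finally show "q (x + y) (x + y) \<le> (sqrt (q x x) + sqrt (q y y))\<^sup>2" .
qed (use nonneg assms in auto)

lemma scale_sqrt:
  assumes "x \<in> S"
  shows "sqrt (q (r *\<^sub>R x) (r *\<^sub>R x)) = \<bar>r\<bar> * sqrt (q x x)"
  using expand[OF assms assms, of r 0] by (simp add: real_sqrt_mult)

lemma diff_commute: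
  assumes "x \<in> S" "y \<in> S"
  shows "q (x - y) (x - y) = q (y - x) (y - x)"
  using expand[OF assms, of 1 "-1"] expand[OF assms, of "-1" 1] by simp

text \<open>In the error estimate \<open>x\<close> is exact, \<open>y\<close> a discrete
  approximation of it and \<open>z\<close> the discrete solution; the differences are oriented as
  they arise there.\<close>

lemma triangle_diff:
  assumes "x \<in> S" "y \<in> S" "z \<in> S"
  shows "sqrt (q (x - z) (x - z)) \<le> sqrt (q (x - y) (x - y)) + sqrt (q (z - y) (z - y))"
  using triangle[of "x - y" "y - z"] assms diff_commute[of y z] by (simp add: subspace_diff sub)

end

section \<open>Solving a nondegenerate linear problem modulo null vectors\<close>

lemma underdetermined_system:
  fixes A :: "'j \<Rightarrow> 'i \<Rightarrow> real"
  assumes "finite J" "finite I" "card J < card I"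
  shows "\<exists>c. (\<exists>i\<in>I. c i \<noteq> 0) \<and> (\<forall>j\<in>J. (\<Sum>i\<in>I. A j i * c i) = 0)"
  using assms
proof (induction J arbitrary: I A rule: finite_induct)
  case empty
  then have "I \<noteq> {}" by auto
  then show ?case by (intro exI[of _ "\<lambda>_. 1"]) auto
next
  case (insert j J)
  show ?case
  proof (cases "\<forall>i\<in>I. A j i = 0")
    case True
    obtain c where "(\<exists>i\<in>I. c i \<noteq> 0) \<and> (\<forall>j\<in>J. (\<Sum>i\<in>I. A j i * c i) = 0)"
      using insert.IH[of I A] insert.prems insert.hyps by auto
    with True show ?thesis by (intro exI[of _ c]) auto
  next
    case False
    then obtain p where p: "p \<in> I" "A j p \<noteq> 0" by blast
    \<comment> \<open>One step of Gaussian elimination: equation \<open>j\<close> with pivot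
      \<open>p\<close> removes the unknown \<open>p\<close> from the other equations. One equation
      and one unknown disappear, so the strict inequality of cardinalities survives.\<close>
    define A' where "A' k i = A k i - A k p * A j i / A j p" for k i
    obtain c where c: "\<exists>i\<in>I - {p}. c i \<noteq> 0" "\<forall>k\<in>J. (\<Sum>i\<in>I - {p}. A' k i * c i) = 0"
      using insert.IH[of "I - {p}" A'] insert.prems insert.hyps p by (auto simp: less_diff_conv)
    define s where "s = (\<Sum>i\<in>I - {p}. A j i * c i)"
    \<comment> \<open>The eliminated unknown is recovered from equation \<open>j\<close>.\<close>
    define c' where "c' = c(p := - s / A j p)"
    have eq: "(\<Sum>i\<in>I. A k i * c' i) = (\<Sum>i\<in>I - {p}. A k i * c i) - A k p * s / A j p" for k
      using insert.prems p by (simp add: sum.remove c'_def)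
    have "(\<Sum>i\<in>I. A k i * c' i) = 0" if "k \<in> insert j J" for k
    proof (cases "k = j")
      case True
      then show ?thesis using p by (simp add: eq s_def[symmetric])
    next
      case False
      then have "0 = (\<Sum>i\<in>I - {p}. A' k i * c i)" using that c by auto
      also have "\<dots> = (\<Sum>i\<in>I - {p}. A k i * c i) - A k p * s / A j p"
        by (simp add: A'_def s_def left_diff_distrib sum_subtractf sum_distrib_left
            sum_divide_distrib mult.assoc)
      finally show ?thesis by (simp add: eq)
    qed
    moreover have "\<exists>i\<in>I. c' i \<noteq> 0" using c by (auto simp: c'_def)
    ultimately show ?thesis by blast
  qed
qed

text \<open>
  Coordinates with respect to a spanning family need not be unique, so \<open>\<kappa>\<close> cannot be assumed linear.
\<close>

definition coordinates_modulo ::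
  "'w::real_vector set \<Rightarrow> 'w set \<Rightarrow> 'j set \<Rightarrow> ('w \<Rightarrow> 'j \<Rightarrow> real) \<Rightarrow> bool" where
  "coordinates_modulo W N J \<kappa> \<longleftrightarrow> finite J \<and> (\<forall>(n::nat) e c. (\<forall>i<n. e i \<in> W) \<longrightarrow>
     (\<forall>j\<in>J. (\<Sum>i<n. c i * \<kappa> (e i) j) = 0) \<longrightarrow> (\<Sum>i<n. c i *\<^sub>R e i) \<in> N)"

lemma coordinates_moduloD:
  fixes n :: nat
  assumes "coordinates_modulo W N J \<kappa>" "\<And>i. i < n \<Longrightarrow> e i \<in> W"
    and "\<And>j. j \<in> J \<Longrightarrow> (\<Sum>i<n. c i * \<kappa> (e i) j) = 0"
  shows "(\<Sum>i<n. c i *\<^sub>R e i) \<in> N"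
  using assms unfolding coordinates_modulo_def by blast

lemma coordinates_modulo_Times:
  assumes "coordinates_modulo W1 N1 J1 \<kappa>1" "coordinates_modulo W2 N2 J2 \<kappa>2"
  shows "coordinates_modulo (W1 \<times> W2) (N1 \<times> N2) (J1 <+> J2)
           (\<lambda>w. case_sum (\<kappa>1 (fst w)) (\<kappa>2 (snd w)))"
  unfolding coordinates_modulo_def
proof (intro conjI allI impI)
  show "finite (J1 <+> J2)" using assms by (simp add: coordinates_modulo_def)
  fix n :: nat and e :: "nat \<Rightarrow> 'a \<times> 'c" and c :: "nat \<Rightarrow> real"
  assume e: "\<forall>i<n. e i \<in> W1 \<times> W2"
    and z: "\<forall>j\<in>J1 <+> J2. (\<Sum>i<n. c i * case_sum (\<kappa>1 (fst (e i))) (\<kappa>2 (snd (e i))) j) = 0"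
  have "(\<Sum>i<n. c i *\<^sub>R fst (e i)) \<in> N1"
    using e z[rule_format, of "Inl _"]
    by (intro coordinates_moduloD[OF assms(1)]) (auto simp: mem_Times_iff)
  moreover have "(\<Sum>i<n. c i *\<^sub>R snd (e i)) \<in> N2"
    using e z[rule_format, of "Inr _"]
    by (intro coordinates_moduloD[OF assms(2)]) (auto simp: mem_Times_iff)
  ultimately show "(\<Sum>i<n. c i *\<^sub>R e i) \<in> N1 \<times> N2"
    by (simp add: mem_Times_iff fst_sum snd_sum)
qed

text \<open>Injectivity implies surjectivity in finite dimension, with \<open>N\<close> in the role
  of zero. A maximal family independent modulo \<open>N\<close> replaces a basis of the quotient,
  and \<open>null\<close> and \<open>Lnull\<close> extend the equations from this family to all of
  \<open>W\<close>.\<close>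

lemma nondegenerate_form_solvable_modulo:
  fixes B :: "'w::real_vector \<Rightarrow> 'w \<Rightarrow> real"
  assumes W: "subspace W" and coord: "coordinates_modulo W N J \<kappa>"
    and lin1: "\<And>y. y \<in> W \<Longrightarrow> lin_on W (\<lambda>x. B x y)" and lin2: "\<And>x. x \<in> W \<Longrightarrow> lin_on W (B x)"
    and null: "\<And>x n. x \<in> W \<Longrightarrow> n \<in> W \<Longrightarrow> n \<in> N \<Longrightarrow> B x n = 0"
    and L: "lin_on W L" and Lnull: "\<And>n. n \<in> W \<Longrightarrow> n \<in> N \<Longrightarrow> L n = 0"
    and nondegenerate: "\<And>x. x \<in> W \<Longrightarrow> \<forall>y\<in>W. B x y = 0 \<Longrightarrow> x \<in> N"
  shows "\<exists>x\<in>W. \<forall>y\<in>W. B x y = L y"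
proof -
  define ind where "ind n \<longleftrightarrow> (\<exists>e. (\<forall>i<n. e i \<in> W) \<and>
      (\<forall>c. (\<Sum>i<n. c i *\<^sub>R e i) \<in> N \<longrightarrow> (\<forall>i<n. c i = 0)))" for n :: nat
  have J: "finite J" using coord by (simp add: coordinates_modulo_def)
  \<comment> \<open>More than \<open>card J\<close> vectors have linearly dependent coordinate
    columns, and the corresponding nontrivial combination lies in \<open>N\<close>.\<close>
  have bound: "n \<le> card J" if ind: "ind n" for n
  proof (rule ccontr)
    assume "\<not> n \<le> card J"
    moreover obtain e where e: "\<forall>i<n. e i \<in> W" "\<forall>c. (\<Sum>i<n. c i *\<^sub>R e i) \<in> N \<longrightarrow> (\<forall>i<n. c i = 0)"
      using ind by (auto simp: ind_def)
    ultimately obtain c where c: "\<exists>i\<in>{..<n}. c i \<noteq> 0" "\<forall>j\<in>J. (\<Sum>i<n. \<kappa> (e i) j * c i) = 0"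
      using underdetermined_system[OF J, of "{..<n}" "\<lambda>j i. \<kappa> (e i) j"] by auto
    have "(\<Sum>i<n. c i *\<^sub>R e i) \<in> N"
      using coord e(1) c(2) by (auto simp: coordinates_modulo_def mult.commute)
    with e(2) c(1) show False by blast
  qed
  have "ind 0" by (auto simp: ind_def)
  then obtain n where n: "ind n" and max: "\<And>m. ind m \<Longrightarrow> m \<le> n"
    using GreatestI_nat[of ind 0 "card J"] Greatest_le_nat[of ind _ "card J"] bound by metis
  obtain e where eW: "\<And>i. i < n \<Longrightarrow> e i \<in> W"
    and eN: "\<And>c. (\<Sum>i<n. c i *\<^sub>R e i) \<in> N \<Longrightarrow> \<forall>i<n. c i = 0"
    using n by (auto simp: ind_def)
  have combW: "(\<Sum>i<n. c i *\<^sub>R e i) \<in> W" for c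
    by (intro subspace_sum subspace_scale W) (auto simp: eW)
  \<comment> \<open>There are \<open>n\<close> equations in \<open>n + 1\<close> unknowns. The extra
    column holds the right-hand side, so a nontrivial solution exists for free, and its last entry
    \<open>c n\<close> scales \<open>L\<close>.\<close>
  define A where "A j i = (if i < n then B (e i) (e j) else - L (e j))" for j i
  obtain c where c: "\<exists>i\<in>{..<Suc n}. c i \<noteq> 0" "\<forall>j<n. (\<Sum>i<Suc n. A j i * c i) = 0"
    using underdetermined_system[of "{..<n}" "{..<Suc n}" A] by auto
  define x where "x = (\<Sum>i<n. c i *\<^sub>R e i)"
  have xW: "x \<in> W" unfolding x_def by (rule combW)
  have basis: "B x (e j) = c n * L (e j)" if j: "j < n" for j
  proof -
    have "0 = (\<Sum>i<Suc n. A j i * c i)" using c j by simp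
    also have "\<dots> = (\<Sum>i<n. c i * B (e i) (e j)) - c n * L (e j)"
      by (simp add: A_def mult.commute)
    also have "(\<Sum>i<n. c i * B (e i) (e j)) = B x (e j)"
      unfolding x_def by (rule lin_on_sum[OF W lin1, symmetric]) (use j eW in auto)
    finally show ?thesis by simp
  qed
  \<comment> \<open>By maximality the family extended by \<open>y\<close> is dependent modulo
    \<open>N\<close>, so a nonzero multiple of \<open>y\<close> is a combination of the
    \<open>e i\<close> up to an element on which \<open>B x\<close> and \<open>L\<close>
    vanish.\<close>
  have all: "B x y = c n * L y" if y: "y \<in> W" for y
  proof -
    have "\<not> ind (Suc n)" using max[of "Suc n"] by auto
    moreover have "\<forall>i<Suc n. (e(n := y)) i \<in> W" using eW y by (auto simp: less_Suc_eq)
    ultimately obtain d where d: "(\<Sum>i<Suc n. d i *\<^sub>R (e(n := y)) i) \<in> N" "\<exists>i<Suc n. d i \<noteq> 0"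
      unfolding ind_def by blast
    define z where "z = (\<Sum>i<n. d i *\<^sub>R e i)"
    have zW: "z \<in> W" unfolding z_def by (rule combW)
    have sum: "(\<Sum>i<Suc n. d i *\<^sub>R (e(n := y)) i) = 1 *\<^sub>R z + d n *\<^sub>R y"
      by (simp add: z_def)
    have dn: "d n \<noteq> 0"
    proof
      assume "d n = 0"
      then have "z \<in> N" using d(1) sum by simp
      then have "\<forall>i<n. d i = 0" unfolding z_def by (rule eN)
      with d(2) \<open>d n = 0\<close> show False by (auto simp: less_Suc_eq)
    qed
    have N: "1 *\<^sub>R z + d n *\<^sub>R y \<in> N" "1 *\<^sub>R z + d n *\<^sub>R y \<in> W"
      using d(1) sum subspace_lincomb[OF W zW y, of 1 "d n"] by auto
    have "B x z = c n * L z"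
      unfolding z_def lin_on_sum[OF W lin2[OF xW], of "{..<n}" e d, OF eW, simplified]
        lin_on_sum[OF W L, of "{..<n}" e d, OF eW, simplified]
      by (simp add: sum_distrib_left basis mult.left_commute)
    moreover have "B x z + d n * B x y = 0"
      using null[OF xW N(2,1)] lin_onD[OF lin2[OF xW] zW y, of 1 "d n"] by simp
    moreover have "L z + d n * L y = 0"
      using Lnull[OF N(2,1)] lin_onD[OF L zW y, of 1 "d n"] by simp
    ultimately have "d n * (B x y) = d n * (c n * L y)"
      by (metis add_left_cancel distrib_left mult.left_commute mult_zero_right)
    then show ?thesis using dn by simp
  qed
  \<comment> \<open>Here nondegeneracy enters: with \<open>c n = 0\<close> the vector
    \<open>x\<close> would lie in \<open>N\<close>, and independence would make all coefficients
    vanish.\<close>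
  have cn: "c n \<noteq> 0"
  proof
    assume 0: "c n = 0"
    then have "x \<in> N" using nondegenerate[OF xW] all by simp
    then have "\<forall>i<n. c i = 0" unfolding x_def by (rule eN)
    with c(1) 0 show False by (auto simp: less_Suc_eq)
  qed
  have "B ((1 / c n) *\<^sub>R x) y = L y" if "y \<in> W" for y
    using lin_on_scale[OF lin1[OF that] xW, of "1 / c n"] all[OF that] cn by simp
  then show ?thesis using subspace_scale[OF W xW] by blast
qed

section \<open>Square-integrable functions and smooth test functions\<close>

lemma ae_eq_iff:
  "U \<in> sets lebesgue \<Longrightarrow> ae_eq U v w \<longleftrightarrow> (AE x in lebesgue. x \<in> U \<longrightarrow> v x = w x)"
  unfolding ae_eq_def by (subst AE_restrict_space_iff) auto

lemma ae_eq_mono: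
  assumes "ae_eq U v w" "U' \<subseteq> U" "U \<in> sets lebesgue" "U' \<in> sets lebesgue"
  shows "ae_eq U' v w"
  using assms(1,2) unfolding ae_eq_iff[OF assms(3)] ae_eq_iff[OF assms(4)] by auto

lemma ae_eq_refl [simp]: "ae_eq U v v"
  by (simp add: ae_eq_def)

lemma ae_eq_lincomb:
  fixes v w :: "pt \<Rightarrow> 'b::real_vector"
  assumes "ae_eq U v v'" "ae_eq U w w'"
  shows "ae_eq U (r *\<^sub>R v + s *\<^sub>R w) (r *\<^sub>R v' + s *\<^sub>R w')"
  using assms unfolding ae_eq_def by eventually_elim simp

lemma ae_eq_diff_0_iff:
  fixes v w :: "pt \<Rightarrow> 'b::real_vector"
  shows "ae_eq U (v - w) 0 \<longleftrightarrow> ae_eq U v w"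
  unfolding ae_eq_def by simp

lemma ae_eq_component: "ae_eq U v w \<Longrightarrow> ae_eq U (\<lambda>x. v x $ i) (\<lambda>x. w x $ i)"
  unfolding ae_eq_def by (auto elim: eventually_mono)

lemma L2_D:
  assumes "w \<in> L2 U"
  shows "w \<in> borel_measurable (lebesgue_on U)" "integrable (lebesgue_on U) (\<lambda>x. (norm (w x))\<^sup>2)"
  using assms by (auto simp: L2_def)

lemma integrable_inner_L2:
  assumes "v \<in> L2 U" "w \<in> L2 U"
  shows "integrable (lebesgue_on U) (\<lambda>x. v x \<bullet> w x)"
proof (rule Bochner_Integration.integrable_bound)
  show "integrable (lebesgue_on U) (\<lambda>x. (norm (v x))\<^sup>2 + (norm (w x))\<^sup>2)"
    by (intro Bochner_Integration.integrable_add L2_D assms)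
  show "(\<lambda>x. v x \<bullet> w x) \<in> borel_measurable (lebesgue_on U)"
    using L2_D(1)[OF assms(1)] L2_D(1)[OF assms(2)] by measurable
  have "\<bar>v x \<bullet> w x\<bar> \<le> (norm (v x))\<^sup>2 + (norm (w x))\<^sup>2" for x
  proof -
    have "\<bar>v x \<bullet> w x\<bar> \<le> norm (v x) * norm (w x)" by (rule Cauchy_Schwarz_ineq2)
    also have "\<dots> \<le> 2 * norm (v x) * norm (w x)" by simp
    also have "\<dots> \<le> (norm (v x))\<^sup>2 + (norm (w x))\<^sup>2" by (rule sum_squares_bound)
    finally show ?thesis .
  qed
  then show "AE x in lebesgue_on U. norm (v x \<bullet> w x) \<le> norm ((norm (v x))\<^sup>2 + (norm (w x))\<^sup>2)"
    by simp
qed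

lemma subspace_L2: "subspace (L2 U :: (pt \<Rightarrow> 'b::euclidean_space) set)"
proof (rule subspaceI_lincomb)
  show "(0 :: pt \<Rightarrow> 'b) \<in> L2 U" by (simp add: L2_def zero_fun_def)
  fix v w :: "pt \<Rightarrow> 'b" and r s
  assume vw: "v \<in> L2 U" "w \<in> L2 U"
  have "(norm ((r *\<^sub>R v + s *\<^sub>R w) x))\<^sup>2
      = r\<^sup>2 * (v x \<bullet> v x) + 2 * r * s * (v x \<bullet> w x) + s\<^sup>2 * (w x \<bullet> w x)" for x
    by (simp add: power2_norm_eq_inner inner_simps inner_commute)
      (simp add: power2_eq_square algebra_simps)
  moreover have "integrable (lebesgue_on U)
      (\<lambda>x. r\<^sup>2 * (v x \<bullet> v x) + 2 * r * s * (v x \<bullet> w x) + s\<^sup>2 * (w x \<bullet> w x))"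
    by (intro Bochner_Integration.integrable_add integrable_mult_right integrable_inner_L2 vw)
  moreover have "(\<lambda>x. r *\<^sub>R v x + s *\<^sub>R w x) \<in> borel_measurable (lebesgue_on U)"
    using L2_D(1)[OF vw(1)] L2_D(1)[OF vw(2)] by measurable
  ultimately show "r *\<^sub>R v + s *\<^sub>R w \<in> L2 U"
    by (simp add: L2_def plus_fun_def scaleR_fun_def)
qed

lemma lin_on_l2_inner: "z \<in> L2 U \<Longrightarrow> lin_on (L2 U) (\<lambda>x. l2_inner U x z)"
  unfolding lin_on_def l2_inner_def
  by (simp add: inner_add_left integrable_inner_L2)

interpretation L2: semi_inner "L2 U" "l2_inner U" for U
proof
  show "subspace (L2 U)" by (rule subspace_L2)
  show "lin_on (L2 U) (\<lambda>x. l2_inner U x z)" if "z \<in> L2 U" for z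
    by (rule lin_on_l2_inner[OF that])
qed (simp_all add: l2_inner_def inner_commute)

lemma l2_norm_nonneg: "0 \<le> l2_norm U w"
  by (simp add: l2_norm_def l2_inner_def)

lemma l2_inner_cong:
  assumes "ae_eq U v v'" "v \<in> L2 U" "v' \<in> L2 U" "w \<in> L2 U"
  shows "l2_inner U v w = l2_inner U v' w"
  unfolding l2_inner_def
proof (rule integral_cong_AE)
  show "AE x in lebesgue_on U. v x \<bullet> w x = v' x \<bullet> w x"
    using assms(1) unfolding ae_eq_def by eventually_elim simp
qed (use integrable_inner_L2 assms in auto)

lemma l2_norm_cong:
  assumes "ae_eq U v v'" "v \<in> L2 U" "v' \<in> L2 U"
  shows "l2_norm U v = l2_norm U v'"
  unfolding l2_norm_def
  using l2_inner_cong[OF assms assms(2)] l2_inner_cong[OF assms assms(3)] L2.sym[OF assms(2,3)]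
  by simp

lemma l2_norm_0: "l2_norm U 0 = 0"
  by (simp add: l2_norm_def l2_inner_def)

lemma l2_norm_eq_0_imp_ae:
  assumes "w \<in> L2 U" "l2_norm U w = 0"
  shows "ae_eq U w 0"
proof -
  have "AE x in lebesgue_on U. w x \<bullet> w x = 0"
    using assms integral_nonneg_eq_0_iff_AE[OF integrable_inner_L2[OF assms(1,1)]]
    by (simp add: l2_norm_def l2_inner_def)
  then show ?thesis by (simp add: ae_eq_def)
qed

lemma L2_mono:
  assumes "w \<in> L2 U" "U' \<subseteq> U" "U \<in> sets lebesgue" "U' \<in> sets lebesgue"
  shows "w \<in> L2 U'"
proof -
  have "set_integrable lebesgue U (\<lambda>x. (norm (w x))\<^sup>2)"
    using L2_D(2)[OF assms(1)] assms(3) by (simp add: integrable_restrict_space set_integrable_def)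
  then have "set_integrable lebesgue U' (\<lambda>x. (norm (w x))\<^sup>2)"
    by (rule set_integrable_subset) (use assms in auto)
  then show ?thesis
    using measurable_restrict_mono[OF L2_D(1)[OF assms(1)] assms(2)] assms(4)
    by (simp add: L2_def integrable_restrict_space set_integrable_def)
qed

lemma L2_vec_iff:
  fixes w :: vfun
  shows "w \<in> L2 U \<longleftrightarrow> (\<forall>i. (\<lambda>x. w x $ i) \<in> L2 U)"
proof
  assume w: "w \<in> L2 U"
  show "\<forall>i. (\<lambda>x. w x $ i) \<in> L2 U"
  proof
    fix i
    have m: "(\<lambda>x. w x $ i) \<in> borel_measurable (lebesgue_on U)"
      by (rule borel_measurable_continuous_on[OF _ L2_D(1)[OF w]]) (intro continuous_intros)
    have "integrable (lebesgue_on U) (\<lambda>x. (norm (w x $ i))\<^sup>2)"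
      by (rule Bochner_Integration.integrable_bound[OF L2_D(2)[OF w]])
        (use m in \<open>auto intro!: AE_I2 abs_le_square_iff[THEN iffD1] simp: component_le_norm_cart\<close>)
    then show "(\<lambda>x. w x $ i) \<in> L2 U" using m by (simp add: L2_def)
  qed
next
  assume w: "\<forall>i. (\<lambda>x. w x $ i) \<in> L2 U"
  then have m: "(\<lambda>x. w x $ i) \<in> borel_measurable (lebesgue_on U)" for i by (auto simp: L2_def)
  have "w \<in> borel_measurable (lebesgue_on U)"
    by (rule borel_measurable_euclidean_space[THEN iffD2])
      (use m in \<open>auto simp: Basis_vec_def inner_axis\<close>)
  moreover have "(norm (w x))\<^sup>2 = (\<Sum>i\<in>UNIV. (norm (w x $ i))\<^sup>2)" for x
    by (simp add: norm_vec_def L2_set_def sum_nonneg)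
  ultimately show "w \<in> L2 U" using w by (simp add: L2_def)
qed

text \<open>The closure of \<open>U\<close> is compact, so \<open>f\<close> is bounded on a set of
  finite measure. This serves test functions and the smooth approximants in the definition of a
  trace.\<close>

lemma continuous_in_L2:
  fixes f :: "pt \<Rightarrow> 'b::euclidean_space"
  assumes "continuous_on UNIV f" "bounded U" "U \<in> sets lebesgue"
  shows "f \<in> L2 U"
proof -
  have "bounded (f ` closure U)"
    using assms by (intro compact_imp_bounded compact_continuous_image)
      (auto intro: continuous_on_subset)
  then obtain B where B: "\<And>x. x \<in> U \<Longrightarrow> norm (f x) \<le> B"
    using closure_subset[of U] by (force simp: bounded_iff)
  have m: "f \<in> borel_measurable (lebesgue_on U)"
    using assms by (intro continuous_imp_measurable_on_sets_lebesgue) (auto intro: continuous_on_subset)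
  have "U \<in> lmeasurable" using assms bounded_set_imp_lmeasurable by blast
  then interpret finite_measure "lebesgue_on U"
    by (rule finite_measure_lebesgue_on)
  have "integrable (lebesgue_on U) (\<lambda>x. (norm (f x))\<^sup>2)"
    by (rule integrable_const_bound[where B = "B\<^sup>2"])
      (use m B in \<open>auto intro!: AE_I2 power_mono simp: space_restrict_space\<close>)
  then show ?thesis using m by (simp add: L2_def)
qed

section \<open>Smooth functions and smooth approximations of boxes\<close>

lemma C_k_Suc_D: "C_k (Suc n) f \<Longrightarrow> C_k n f"
proof (induction n arbitrary: f)
  case 0
  then show ?case
    by (auto intro!: continuous_at_imp_continuous_on differentiable_imp_continuous_within)
qed auto

lemma C_k_continuous: "C_k n f \<Longrightarrow> continuous_on UNIV f"
  by (induction n) (use C_k_Suc_D in auto)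

lemma C_k_lincomb:
  "C_k n f \<Longrightarrow> C_k n g \<Longrightarrow> C_k n (\<lambda>x. r * f x + s * g x)"
proof (induction n arbitrary: f g)
  case 0
  then show ?case by (auto intro!: continuous_intros)
next
  case (Suc n)
  have d: "((\<lambda>x. r * f x + s * g x) has_derivative
      (\<lambda>d. r * frechet_derivative f (at x) d + s * frechet_derivative g (at x) d)) (at x)" for x
    using Suc.prems by (auto intro!: derivative_intros simp: frechet_derivative_works[symmetric])
  show ?case
    using Suc d by (auto simp: frechet_derivative_at[OF d, symmetric] differentiable_def)
qed

lemma C_k_mult:
  "C_k n f \<Longrightarrow> C_k n g \<Longrightarrow> C_k n (\<lambda>x. f x * g x)"
proof (induction n arbitrary: f g)
  case 0
  then show ?case by (auto intro!: continuous_intros)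
next
  case (Suc n)
  have d: "((\<lambda>x. f x * g x) has_derivative
      (\<lambda>d. f x * frechet_derivative g (at x) d + frechet_derivative f (at x) d * g x)) (at x)" for x
    using Suc.prems by (auto intro!: derivative_intros simp: frechet_derivative_works[symmetric])
  have "C_k n (\<lambda>x. 1 * (f x * frechet_derivative g (at x) d) + 1 * (frechet_derivative f (at x) d * g x))" for d
    using Suc C_k_Suc_D[OF Suc.prems(1)] C_k_Suc_D[OF Suc.prems(2)]
    by (intro C_k_lincomb) auto
  then show ?case
    using d by (auto simp: frechet_derivative_at[OF d, symmetric] differentiable_def)
qed

lemma C_k_const: "C_k n (\<lambda>x. c)"
  by (induction n arbitrary: c) auto

lemma smooth_lincomb: "smooth f \<Longrightarrow> smooth g \<Longrightarrow> smooth (\<lambda>x. r * f x + s * g x)"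
  by (simp add: smooth_def C_k_lincomb)

lemma smooth_prod: "(\<And>i. i \<in> I \<Longrightarrow> smooth (f i)) \<Longrightarrow> smooth (\<lambda>x. \<Prod>i\<in>I. f i x)"
  by (induction I rule: infinite_finite_induct) (auto simp: smooth_def C_k_const C_k_mult)

lemma smooth_continuous: "smooth f \<Longrightarrow> continuous_on UNIV f"
  using C_k_continuous by (auto simp: smooth_def)

lemma smooth_differentiable: "smooth f \<Longrightarrow> f differentiable at x"
  by (simp add: smooth_def) (metis C_k.simps(2))

lemma continuous_classical_grad:
  assumes "smooth f"
  shows "continuous_on UNIV (classical_grad f)"
proof -
  have "C_k (Suc 0) f" using assms by (simp add: smooth_def del: C_k.simps)
  then show ?thesis
    unfolding classical_grad_def[abs_def] by (intro continuous_on_vec_lambda) simp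
qed

lemma classical_grad_lincomb:
  assumes "smooth f" "smooth g"
  shows "classical_grad (\<lambda>x. r * f x + s * g x) = r *\<^sub>R classical_grad f + s *\<^sub>R classical_grad g"
proof
  fix x
  have d: "((\<lambda>x. r * f x + s * g x) has_derivative
      (\<lambda>d. r * frechet_derivative f (at x) d + s * frechet_derivative g (at x) d)) (at x)"
    using smooth_differentiable[OF assms(1)] smooth_differentiable[OF assms(2)]
    by (auto intro!: derivative_intros simp: frechet_derivative_works[symmetric])
  show "classical_grad (\<lambda>x. r * f x + s * g x) x = (r *\<^sub>R classical_grad f + s *\<^sub>R classical_grad g) x"
    by (simp add: classical_grad_def frechet_derivative_at[OF d, symmetric] vec_eq_iff)
qed

text \<open>The power of \<open>t\<close> in the denominator closes the family under
  differentiation: the derivative of a member is a combination of two others. Smoothness of exp (- 1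
  / t), extended by zero, is then an induction over all \<open>m\<close> at once.\<close>

definition bump :: "nat \<Rightarrow> real \<Rightarrow> real" where
  "bump m t = (if t > 0 then exp (- 1 / t) / t ^ m else 0)"

text \<open>With s = 1 / t the limit from the right is that of s^m / exp s at infinity.\<close>

lemma bump_tendsto_0: "(bump m \<longlongrightarrow> 0) (at 0)"
proof (rule filterlim_split_at)
  have "eventually (\<lambda>t. bump m t = 0) (at_left 0)"
    unfolding eventually_at_filter by (auto simp: bump_def)
  then show "(bump m \<longlongrightarrow> 0) (at_left 0)" by (rule tendsto_eventually)
  have "((\<lambda>t. (inverse t) ^ m / exp (inverse t)) \<longlongrightarrow> (0::real)) (at_right 0)"
    by (rule filterlim_compose[OF tendsto_power_div_exp_0 filterlim_inverse_at_top_right])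
  moreover have "eventually (\<lambda>t::real. (inverse t) ^ m / exp (inverse t) = bump m t) (at_right 0)"
    unfolding eventually_at_filter
    by (auto simp: bump_def exp_minus field_simps)
  ultimately show "(bump m \<longlongrightarrow> 0) (at_right 0)" by (rule Lim_transform_eventually)
qed

lemma bump_deriv:
  "(bump m has_real_derivative (bump (m + 2) t - real m * bump (m + 1) t)) (at t)"
proof -
  consider "t > 0" | "t < 0" | "t = 0" by linarith
  then show ?thesis
  proof cases
    case 1
    have "((\<lambda>t. exp (- 1 / t) / t ^ m) has_real_derivative
        (bump (m + 2) t - real m * bump (m + 1) t)) (at t)"
      using 1
      by (auto intro!: derivative_eq_intros simp: bump_def field_simps power2_eq_square
          simp flip: power_Suc)
        (cases m; auto simp: field_simps)
    then show ?thesis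
      by (rule has_field_derivative_transform_within_open[where S = "{0<..}"])
        (use 1 in \<open>auto simp: bump_def\<close>)
  next
    case 2
    have "((\<lambda>t. 0) has_real_derivative (bump (m + 2) t - real m * bump (m + 1) t)) (at t)"
      using 2 by (simp add: bump_def)
    then show ?thesis
      by (rule has_field_derivative_transform_within_open[where S = "{..<0}"])
        (use 2 in \<open>auto simp: bump_def\<close>)
  next
    case 3
    \<comment> \<open>The difference quotient at 0 is again a member of the family,
      \<open>bump (Suc m)\<close>, and tends to 0.\<close>
    have "((\<lambda>h. bump m h / h) \<longlongrightarrow> 0) (at 0)"
      by (rule Lim_transform_eventually[OF bump_tendsto_0[of "Suc m"]])
        (auto simp: bump_def eventually_at_filter field_simps)
    then show ?thesis
      using 3 by (simp add: DERIV_def bump_def)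
  qed
qed

lemma smooth_bump_affine: "smooth (\<lambda>x. bump m (a \<bullet> x + b))"
proof -
  have "C_k n (\<lambda>x. bump m (a \<bullet> x + b))" for n
  proof (induction n arbitrary: m)
    case 0
    have "continuous_on UNIV (bump m)"
      by (intro continuous_at_imp_continuous_on ballI DERIV_isCont[OF bump_deriv])
    then have "continuous_on UNIV (\<lambda>x. bump m (a \<bullet> x + b))"
      by (rule continuous_on_compose2) (auto intro!: continuous_intros)
    then show ?case by simp
  next
    case (Suc n)
    have d: "((\<lambda>x. bump m (a \<bullet> x + b)) has_derivative
        (\<lambda>d. (bump (m + 2) (a \<bullet> x + b) - real m * bump (m + 1) (a \<bullet> x + b)) * (a \<bullet> d))) (at x)" for x
    proof -
      have "((\<lambda>x. a \<bullet> x + b) has_derivative (\<lambda>d. a \<bullet> d)) (at x)"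
        by (auto intro!: derivative_eq_intros)
      from has_derivative_compose[OF this bump_deriv[of m "a \<bullet> x + b", unfolded has_field_derivative_def]]
      show ?thesis .
    qed
    have "C_k n (\<lambda>x. (a \<bullet> d) * bump (m + 2) (a \<bullet> x + b)
        + (- (a \<bullet> d) * real m) * bump (m + 1) (a \<bullet> x + b))" for d
      by (intro C_k_lincomb Suc)
    moreover have "frechet_derivative (\<lambda>x. bump m (a \<bullet> x + b)) (at x) d
        = (a \<bullet> d) * bump (m + 2) (a \<bullet> x + b) + (- (a \<bullet> d) * real m) * bump (m + 1) (a \<bullet> x + b)" for x d
      unfolding frechet_derivative_at[OF d, symmetric] by (simp add: algebra_simps)
    moreover have "(\<lambda>x. bump m (a \<bullet> x + b)) differentiable at x" for x
      using d[of x] by (auto simp: differentiable_def)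
    ultimately show ?case by simp
  qed
  then show ?thesis by (simp add: smooth_def)
qed

lemma bump_0_bounds: "0 \<le> bump 0 t" "bump 0 t \<le> 1"
  by (auto simp: bump_def)

lemma bump_0_eq_0_iff: "bump 0 t = 0 \<longleftrightarrow> t \<le> 0"
  by (auto simp: bump_def)

text \<open>Dilation steepens the transition, since exp (- 1 / (n * t)) tends to 1 for every
  positive \<open>t\<close>. \<open>Suc n\<close> avoids the dilation factor 0, for which the
  function would vanish identically.\<close>

lemma bump_0_dilation_tendsto: "(\<lambda>n. bump 0 (real (Suc n) * t)) \<longlonglongrightarrow> (if t > 0 then 1 else 0)"
proof (cases "t > 0")
  case True
  have "(\<lambda>n. exp (- (1 / t) * inverse (real (Suc n)))) \<longlonglongrightarrow> exp (- (1 / t) * 0)"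
    by (intro tendsto_intros LIMSEQ_inverse_real_of_nat)
  moreover have "exp (- (1 / t) * inverse (real (Suc n))) = bump 0 (real (Suc n) * t)" for n
    using True mult_pos_pos[of "real (Suc n)" t] by (simp add: bump_def inverse_eq_divide mult.commute)
  ultimately show ?thesis using True by simp
next
  case False
  then have "bump 0 (real (Suc n) * t) = 0" for n
    by (simp add: bump_0_eq_0_iff mult_nonneg_nonpos)
  then show ?thesis using False by simp
qed

text \<open>Each factor is positive exactly on the inner side of one face. Hence all members are
  nonzero on the same open box, whatever \<open>n\<close>, while their values there increase towards
  1 and approximate its indicator.\<close>

definition box_bump :: "pt \<Rightarrow> pt \<Rightarrow> nat \<Rightarrow> sfun" where
  "box_bump a b n x =
     (\<Prod>i\<in>Basis. bump 0 (real (Suc n) * (x \<bullet> i - a \<bullet> i)) * bump 0 (real (Suc n) * (b \<bullet> i - x \<bullet> i)))"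

lemma smooth_box_bump: "smooth (box_bump a b n)"
proof -
  have "smooth (\<lambda>x. bump 0 (real (Suc n) * (x \<bullet> i - a \<bullet> i)) * bump 0 (real (Suc n) * (b \<bullet> i - x \<bullet> i)))" for i
  proof -
    have "smooth (\<lambda>x. bump 0 ((real (Suc n) *\<^sub>R i) \<bullet> x + (- real (Suc n) * (a \<bullet> i))))"
      "smooth (\<lambda>x. bump 0 ((- real (Suc n) *\<^sub>R i) \<bullet> x + real (Suc n) * (b \<bullet> i)))"
      by (rule smooth_bump_affine)+
    then show ?thesis
      unfolding smooth_def by (auto dest: C_k_mult simp: algebra_simps inner_commute)
  qed
  then show ?thesis
    unfolding box_bump_def[abs_def] by (intro smooth_prod)
qed

lemma box_bump_bounds: "0 \<le> box_bump a b n x" "box_bump a b n x \<le> 1"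
  unfolding box_bump_def
  by (auto intro!: prod_nonneg prod_le_1 mult_nonneg_nonneg mult_le_one simp: bump_0_bounds)

lemma support_box_bump: "{x. box_bump a b n x \<noteq> 0} = box a b"
  by (auto simp: box_bump_def bump_0_eq_0_iff mem_box not_le zero_less_mult_iff mult_le_0_iff)

lemma box_bump_test_function: "cbox a b \<subseteq> U \<Longrightarrow> box_bump a b n \<in> test_functions U"
  using closure_minimal[OF box_subset_cbox closed_cbox, of a b]
  by (auto simp: test_functions_def smooth_box_bump support_box_bump bounded_box)

lemma box_bump_tendsto: "(\<lambda>n. box_bump a b n x) \<longlonglongrightarrow> indicator (box a b) x"
proof -
  have "(\<lambda>n. box_bump a b n x) \<longlonglongrightarrow>
      (\<Prod>i\<in>Basis. (if x \<bullet> i - a \<bullet> i > 0 then 1 else 0) * (if b \<bullet> i - x \<bullet> i > 0 then 1 else 0))"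
    unfolding box_bump_def by (intro tendsto_intros bump_0_dilation_tendsto)
  also have "(\<Prod>i\<in>Basis. (if x \<bullet> i - a \<bullet> i > 0 then 1 else 0) * (if b \<bullet> i - x \<bullet> i > 0 then 1 else 0::real))
      = indicator (box a b) x"
    by (auto simp: indicator_def mem_box intro!: prod.neutral)
  finally show ?thesis .
qed

section \<open>Weak derivatives and traces\<close>

lemma set_integral_0_on_borel:
  fixes E :: sfun
  assumes E: "integrable lebesgue E" and box: "\<And>a b. (LINT x:box a b|lebesgue. E x) = 0"
    and total: "(LINT x|lebesgue. E x) = 0" and A: "A \<in> sets borel"
  shows "(LINT x:A|lebesgue. E x) = 0"
proof -
  let ?G = "range (\<lambda>(a, b). box a b :: pt set)"
  have sub: "B \<in> sets lebesgue" if "B \<in> sigma_sets UNIV ?G" for B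
  proof -
    have "B \<in> sets borel" using that by (simp add: borel_eq_box)
    then show ?thesis by simp
  qed
  have si: "set_integrable lebesgue B E" if "B \<in> sets lebesgue" for B
    unfolding set_integrable_def using integrable_mult_indicator[OF that E] by simp
  have "Int_stable ?G"
    unfolding Int_stable_def by (auto simp: box_Int_box)
  moreover have "?G \<subseteq> Pow UNIV" by simp
  moreover have "A \<in> sigma_sets UNIV ?G" using A by (simp add: borel_eq_box)
  ultimately show ?thesis
  proof (induction rule: sigma_sets_induct_disjoint)
    case (basic B)
    then show ?case using box by auto
  next
    case empty
    show ?case by (simp add: set_lebesgue_integral_def)
  next
    \<comment> \<open>The whole plane is not a box, so its integral comes from the hypothesis
      \<open>total\<close>.\<close>
    case (compl B)
    have c: "UNIV - B \<in> sets lebesgue"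
      using sets.compl_sets[OF sub[OF compl.hyps]] by simp
    have "(LINT x:UNIV|lebesgue. E x) = (LINT x:UNIV - B|lebesgue. E x) + (LINT x:B|lebesgue. E x)"
      using set_integral_Un[OF _ si[OF c] si[OF sub[OF compl.hyps]]] by (simp add: Diff_Int_distrib2)
    then show ?case using compl.IH total by (simp add: set_lebesgue_integral_def)
  next
    case (union B)
    have Bi: "B i \<in> sets lebesgue" for i using union.hyps sub by blast
    have "(LINT x:(\<Union>i. B i)|lebesgue. E x) = (\<Sum>i. (LINT x:(B i)|lebesgue. E x))"
      using union.hyps Bi
      by (intro lebesgue_integral_countable_add si sets.countable_UN) (auto simp: disjoint_family_on_def)
    then show ?case using union.IH by simp
  qed
qed

text \<open>A Lebesgue set agrees with its Borel main part up to a null set, so the integrals vanish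
  over all Lebesgue sets, and uniqueness of densities compares \<open>E\<close> with 0.\<close>

lemma AE_0_if_set_integral_0:
  fixes E :: sfun
  assumes E: "integrable lebesgue E" and borel: "\<And>A. A \<in> sets borel \<Longrightarrow> (LINT x:A|lebesgue. E x) = 0"
  shows "AE x in lebesgue. E x = 0"
proof (rule density_unique_real[OF E])
  fix A :: "pt set" assume A: "A \<in> sets lebesgue"
  let ?M = "main_part lborel A"
  have M: "?M \<in> sets lborel" using A by (rule main_part_sets)
  have "(LINT x:A|lebesgue. E x) = (LINT x:?M|lebesgue. E x)"
  proof (rule set_integral_cong_set)
    show "AE x in lebesgue. x \<in> ?M \<longleftrightarrow> x \<in> A"
      by (rule AE_completion[OF AE_in_main_part]) (use A in auto)
    show "set_borel_measurable lebesgue ?M E" "set_borel_measurable lebesgue A E"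
      unfolding set_borel_measurable_def using E A M
      by (auto intro!: borel_measurable_times borel_measurable_indicator)
  qed
  then show "(LINT x:A|lebesgue. E x) = (LINT x:A|lebesgue. 0)"
    using borel[of ?M] M by simp
qed auto

text \<open>Indicators of boxes are dominated limits of test functions, so integrals over boxes
  whose closed box lies in \<open>U\<close> vanish. Localised to one box, this gives vanishing
  almost everywhere there, and countably many closed boxes exhaust \<open>U\<close>.\<close>

lemma fundamental_lemma_calculus_of_variations:
  fixes f :: sfun
  assumes U: "open U" and f: "integrable (lebesgue_on U) f"
    and test: "\<And>\<phi>. \<phi> \<in> test_functions U \<Longrightarrow> (\<integral>x. \<phi> x * f x \<partial>lebesgue_on U) = 0"
  shows "ae_eq U f 0"
proof -
  define F where "F x = indicator U x * f x" for x
  have Us: "U \<in> sets lebesgue" using U by simp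
  have F: "integrable lebesgue F"
    using f Us by (simp add: integrable_restrict_space F_def[abs_def])
  have F_box: "(LINT x:box a b|lebesgue. F x) = 0" if ab: "cbox a b \<subseteq> U" for a b
  proof -
    have "(\<lambda>n. \<integral>x. box_bump a b n x * F x \<partial>lebesgue) \<longlonglongrightarrow> (\<integral>x. indicator (box a b) x * F x \<partial>lebesgue)"
    proof (rule integral_dominated_convergence[where w = "\<lambda>x. \<bar>F x\<bar>"])
      show "(\<lambda>x. box_bump a b n x * F x) \<in> borel_measurable lebesgue" for n
      proof (rule borel_measurable_times)
        show "box_bump a b n \<in> borel_measurable lebesgue"
          by (intro measurable_completion)
            (simp add: borel_measurable_continuous_onI smooth_continuous smooth_box_bump)
      qed (use F in auto)
      show "AE x in lebesgue. norm (box_bump a b n x * F x) \<le> \<bar>F x\<bar>" for n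
        using box_bump_bounds[of a b n]
        by (intro AE_I2) (simp add: abs_mult mult_left_le_one_le)
      show "AE x in lebesgue. (\<lambda>n. box_bump a b n x * F x) \<longlonglongrightarrow> indicator (box a b) x * F x"
        by (intro AE_I2 tendsto_intros box_bump_tendsto)
    qed (use F integrable_mult_indicator[of "box a b" lebesgue F] in auto)
    moreover have "(\<integral>x. box_bump a b n x * F x \<partial>lebesgue) = 0" for n
      using test[OF box_bump_test_function[OF ab, of n]] Us
      by (simp add: integral_restrict_space F_def mult.left_commute)
    ultimately have "(\<integral>x. indicator (box a b) x * F x \<partial>lebesgue) = 0"
      by (simp add: LIMSEQ_const_iff)
    then show ?thesis by (simp add: set_lebesgue_integral_def)
  qed
  have cb: "AE x in lebesgue. x \<in> cbox a b \<longrightarrow> F x = 0" if ab: "cbox a b \<subseteq> U" for a b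
  proof -
    \<comment> \<open>Integrals of \<open>F\<close> are known to vanish only over boxes inside
      \<open>U\<close>. After cutting off to one such box they vanish over every box of the plane,
      because the intersection of two boxes is a box.\<close>
    define E where "E x = indicator (box a b) x * F x" for x
    have E: "integrable lebesgue E"
      unfolding E_def using integrable_mult_indicator[of "box a b" lebesgue F] F by simp
    have E_box: "(LINT x:box c d|lebesgue. E x) = 0" for c d
    proof -
      obtain c' d' where eq: "box c d \<inter> box a b = box c' d'" by (auto simp: box_Int_box)
      have "(LINT x:box c d|lebesgue. E x) = (LINT x:box c' d'|lebesgue. F x)"
        unfolding set_lebesgue_integral_def E_def eq[symmetric] indicator_inter_arith
        by (simp add: mult.assoc)
      also have "\<dots> = 0"
      \<comment> \<open>If the open box is empty, the closed box with the same corners may be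
        nonempty and lie outside \<open>U\<close>, hence the separate case.\<close>
      proof (cases "box c' d' = {}")
        case False
        moreover have "box c' d' \<subseteq> box a b" using eq by blast
        ultimately have "cbox c' d' \<subseteq> cbox a b"
          using closure_minimal[OF subset_trans[OF _ box_subset_cbox] closed_cbox] by (metis closure_box)
        then show ?thesis using F_box ab by blast
      qed (simp add: set_lebesgue_integral_def)
      finally show ?thesis .
    qed
    have "(LINT x|lebesgue. E x) = 0"
      using F_box[OF ab] by (simp add: E_def set_lebesgue_integral_def)
    then have "AE x in lebesgue. E x = 0"
      by (intro AE_0_if_set_integral_0[OF E] set_integral_0_on_borel[OF E E_box])
    moreover have "AE x in lebesgue. x \<notin> cbox a b - box a b"
      by (rule AE_not_in) (simp add: negligible_iff_null_sets[symmetric] negligible_frontier_interval)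
    ultimately show ?thesis
      by eventually_elim (auto simp: E_def)
  qed
  obtain \<D> where D: "countable \<D>" "\<D> \<subseteq> Pow U" "\<And>X. X \<in> \<D> \<Longrightarrow> \<exists>a b. X = cbox a b" "\<Union>\<D> = U"
    using open_countable_Union_open_cbox[OF U] by metis
  have "AE x in lebesgue. \<forall>X\<in>\<D>. x \<in> X \<longrightarrow> F x = 0"
  proof (subst AE_ball_countable[OF D(1)], intro ballI)
    fix X assume X: "X \<in> \<D>"
    then obtain a b where "X = cbox a b" using D(3) by blast
    then show "AE x in lebesgue. x \<in> X \<longrightarrow> F x = 0" using cb[of a b] X D(2) by auto
  qed
  then have "AE x in lebesgue. x \<in> U \<longrightarrow> f x = 0"
    by eventually_elim (use D(4) in \<open>auto simp: F_def indicator_def split: if_splits\<close>)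
  then show ?thesis using Us by (simp add: ae_eq_iff)
qed

section \<open>Weak gradients and divergences\<close>

lemma test_function_L2:
  assumes "\<phi> \<in> test_functions U" "bounded V" "V \<in> sets lebesgue"
  shows "\<phi> \<in> L2 V" "classical_grad \<phi> \<in> L2 V"
  using assms continuous_classical_grad smooth_continuous
  by (auto simp: test_functions_def intro!: continuous_in_L2)

lemma classical_grad_outside_support:
  assumes "x \<notin> closure {x. \<phi> x \<noteq> 0}"
  shows "classical_grad \<phi> x = 0"
proof -
  have "((\<lambda>x. 0) has_derivative (\<lambda>d. 0)) (at x)" by simp
  then have "(\<phi> has_derivative (\<lambda>d. 0)) (at x)"
    by (rule has_derivative_transform_within_open[where s = "- closure {x. \<phi> x \<noteq> 0}"])
      (use assms closure_subset[of "{x. \<phi> x \<noteq> 0}"] in auto)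
  then show ?thesis
    by (simp add: classical_grad_def frechet_derivative_at[symmetric] vec_eq_iff)
qed

lemma integral_restrict_support:
  fixes h :: "pt \<Rightarrow> 'b::euclidean_space"
  assumes "U' \<subseteq> U" "U \<in> sets lebesgue" "U' \<in> sets lebesgue" "\<And>x. x \<notin> U' \<Longrightarrow> h x = 0"
  shows "(\<integral>x. h x \<partial>lebesgue_on U) = (\<integral>x. h x \<partial>lebesgue_on U')"
proof -
  have "(\<lambda>x. indicator U x *\<^sub>R h x) = (\<lambda>x. indicator U' x *\<^sub>R h x)"
    using assms by (auto simp: indicator_def fun_eq_iff)
  then show ?thesis using assms by (simp add: integral_restrict_space)
qed

lemma test_functions_mono: "U' \<subseteq> U \<Longrightarrow> test_functions U' \<subseteq> test_functions U"
  by (auto simp: test_functions_def)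

lemma test_function_outside:
  assumes "\<phi> \<in> test_functions U" "x \<notin> U"
  shows "\<phi> x = 0" "classical_grad \<phi> x = 0"
proof -
  have x: "x \<notin> closure {x. \<phi> x \<noteq> 0}" using assms by (auto simp: test_functions_def)
  then show "\<phi> x = 0" using closure_subset[of "{x. \<phi> x \<noteq> 0}"] by auto
  show "classical_grad \<phi> x = 0" by (rule classical_grad_outside_support[OF x])
qed

lemma weak_grad_mono:
  assumes "weak_grad U v G" "U' \<subseteq> U" "U \<in> sets lebesgue" "U' \<in> sets lebesgue"
  shows "weak_grad U' v G"
  unfolding weak_grad_def
proof
  fix \<phi> assume \<phi>: "\<phi> \<in> test_functions U'"
  then have "\<phi> \<in> test_functions U" using test_functions_mono[OF assms(2)] by blast
  then have "(\<integral>x. v x *\<^sub>R classical_grad \<phi> x \<partial>lebesgue_on U) = - (\<integral>x. \<phi> x *\<^sub>R G x \<partial>lebesgue_on U)"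
    using assms(1) by (simp add: weak_grad_def)
  then show "(\<integral>x. v x *\<^sub>R classical_grad \<phi> x \<partial>lebesgue_on U') = - (\<integral>x. \<phi> x *\<^sub>R G x \<partial>lebesgue_on U')"
    using integral_restrict_support[OF assms(2-4), of "\<lambda>x. v x *\<^sub>R classical_grad \<phi> x"]
      integral_restrict_support[OF assms(2-4), of "\<lambda>x. \<phi> x *\<^sub>R G x"]
      test_function_outside[OF \<phi>] by simp
qed

lemma L2_real_integrable: "v \<in> L2 U \<Longrightarrow> w \<in> L2 U \<Longrightarrow> integrable (lebesgue_on U) (\<lambda>x. v x * w x :: real)"
  using integrable_inner_L2[of v U w] by simp

lemma L2_scaleR_integrable:
  fixes w :: vfun
  assumes "v \<in> L2 U" "w \<in> L2 U"
  shows "integrable (lebesgue_on U) (\<lambda>x. v x *\<^sub>R w x)"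
proof (rule Bochner_Integration.integrable_bound)
  show "integrable (lebesgue_on U) (\<lambda>x. (norm (v x))\<^sup>2 + (norm (w x))\<^sup>2)"
    by (intro Bochner_Integration.integrable_add L2_D assms)
  show "(\<lambda>x. v x *\<^sub>R w x) \<in> borel_measurable (lebesgue_on U)"
    using L2_D(1)[OF assms(1)] L2_D(1)[OF assms(2)] by measurable
  have "\<bar>v x\<bar> * norm (w x) \<le> (norm (v x))\<^sup>2 + (norm (w x))\<^sup>2" for x
  proof -
    have "\<bar>v x\<bar> * norm (w x) \<le> 2 * \<bar>v x\<bar> * norm (w x)" by simp
    also have "\<dots> \<le> \<bar>v x\<bar>\<^sup>2 + (norm (w x))\<^sup>2" by (rule sum_squares_bound)
    finally show ?thesis by simp
  qed
  then show "AE x in lebesgue_on U. norm (v x *\<^sub>R w x) \<le> norm ((norm (v x))\<^sup>2 + (norm (w x))\<^sup>2)"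
    by simp
qed

lemma zero_L2: "0 \<in> L2 U"
  by (rule subspace_0[OF subspace_L2])

lemma L2_integrable:
  fixes w :: sfun
  assumes "w \<in> L2 U" "bounded U" "U \<in> sets lebesgue"
  shows "integrable (lebesgue_on U) w"
  using L2_real_integrable[OF continuous_in_L2[of "\<lambda>x. 1::real"] assms(1)] assms by simp

text \<open>A vector-valued integral may be read componentwise only if the integrand is integrable;
  otherwise it is 0 whatever the components do. Square integrability on a bounded \<open>U\<close>
  provides this.\<close>

lemma weak_grad_iff:
  assumes "v \<in> L2 U" "G \<in> L2 U" "bounded U" "U \<in> sets lebesgue"
  shows "weak_grad U v G \<longleftrightarrow> (\<forall>\<phi>\<in>test_functions U. \<forall>i.
    (\<integral>x. v x * classical_grad \<phi> x $ i \<partial>lebesgue_on U) = - (\<integral>x. \<phi> x * G x $ i \<partial>lebesgue_on U))"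
proof -
  have 1: "(\<integral>x. v x *\<^sub>R classical_grad \<phi> x \<partial>lebesgue_on U) $ i = (\<integral>x. v x * classical_grad \<phi> x $ i \<partial>lebesgue_on U)"
    and 2: "(\<integral>x. \<phi> x *\<^sub>R G x \<partial>lebesgue_on U) $ i = (\<integral>x. \<phi> x * G x $ i \<partial>lebesgue_on U)"
    if "\<phi> \<in> test_functions U" for \<phi> i
    using integral_bounded_linear[OF bounded_linear_vec_nth L2_scaleR_integrable, of v U "classical_grad \<phi>" i]
      integral_bounded_linear[OF bounded_linear_vec_nth L2_scaleR_integrable, of \<phi> U G i]
      test_function_L2[OF that assms(3,4)] assms by auto
  show ?thesis
    unfolding weak_grad_def vec_eq_iff using 1 2 by simp
qed

lemma weak_grad_lincomb:
  assumes "weak_grad U v G" "weak_grad U w H" "v \<in> L2 U" "w \<in> L2 U" "G \<in> L2 U" "H \<in> L2 U"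
    "bounded U" "U \<in> sets lebesgue"
  shows "weak_grad U (r *\<^sub>R v + s *\<^sub>R w) (r *\<^sub>R G + s *\<^sub>R H)"
  unfolding weak_grad_def
proof
  fix \<phi> assume \<phi>: "\<phi> \<in> test_functions U"
  note [simp] = test_function_L2[OF \<phi> assms(7,8)] assms(3-6) L2_scaleR_integrable
  show "(\<integral>x. (r *\<^sub>R v + s *\<^sub>R w) x *\<^sub>R classical_grad \<phi> x \<partial>lebesgue_on U)
      = - (\<integral>x. \<phi> x *\<^sub>R (r *\<^sub>R G + s *\<^sub>R H) x \<partial>lebesgue_on U)"
    using assms(1,2) \<phi>
    by (simp add: weak_grad_def scaleR_add_left scaleR_add_right scaleR_left_commute[of "\<phi> _"]
        flip: scaleR_scaleR)
qed

lemma weak_div_lincomb: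
  assumes "weak_div U v G" "weak_div U w H" "v \<in> L2 U" "w \<in> L2 U" "G \<in> L2 U" "H \<in> L2 U"
    "bounded U" "U \<in> sets lebesgue"
  shows "weak_div U (r *\<^sub>R v + s *\<^sub>R w) (r *\<^sub>R G + s *\<^sub>R H)"
  unfolding weak_div_def
proof
  fix \<phi> assume \<phi>: "\<phi> \<in> test_functions U"
  note [simp] = test_function_L2[OF \<phi> assms(7,8)] assms(3-6) L2_real_integrable integrable_inner_L2
  show "(\<integral>x. (r *\<^sub>R v + s *\<^sub>R w) x \<bullet> classical_grad \<phi> x \<partial>lebesgue_on U)
      = - (\<integral>x. \<phi> x * (r *\<^sub>R G + s *\<^sub>R H) x \<partial>lebesgue_on U)"
    using assms(1,2) \<phi>
    by (simp add: weak_div_def inner_add_left distrib_left mult.left_commute[of "\<phi> _"])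
qed

text \<open>The fundamental lemma is applied to each component of the difference. Boundedness of
  \<open>U\<close> makes square-integrable functions integrable, as that lemma requires.\<close>

lemma weak_grad_unique:
  assumes "weak_grad U v G" "weak_grad U v H" "v \<in> L2 U" "G \<in> L2 U" "H \<in> L2 U" "open U" "bounded U"
  shows "ae_eq U G H"
proof -
  have Us: "U \<in> sets lebesgue" using assms(6) by simp
  have c: "ae_eq U (\<lambda>x. G x $ i - H x $ i) 0" for i
  proof (rule fundamental_lemma_calculus_of_variations[OF assms(6)])
    have L: "(\<lambda>x. G x $ i) \<in> L2 U" "(\<lambda>x. H x $ i) \<in> L2 U"
      using assms(4,5) L2_vec_iff by blast+
    then show "integrable (lebesgue_on U) (\<lambda>x. G x $ i - H x $ i)"
      by (intro Bochner_Integration.integrable_diff L2_integrable assms(7) Us)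
    fix \<phi> assume \<phi>: "\<phi> \<in> test_functions U"
    show "(\<integral>x. \<phi> x * (G x $ i - H x $ i) \<partial>lebesgue_on U) = 0"
      using assms(1,2) weak_grad_iff[OF assms(3,4,7) Us] weak_grad_iff[OF assms(3,5,7) Us] \<phi>
        L2_real_integrable[OF test_function_L2(1)[OF \<phi> assms(7) Us]] L
      by (simp add: right_diff_distrib)
  qed
  have "AE x in lebesgue_on U. \<forall>i. G x $ i - H x $ i = 0"
    using c by (subst AE_all_countable) (simp add: ae_eq_def)
  then show ?thesis by (simp add: ae_eq_def vec_eq_iff)
qed

lemma weak_div_unique:
  assumes "weak_div U \<tau> d" "weak_div U \<tau> e" "d \<in> L2 U" "e \<in> L2 U" "open U" "bounded U"
  shows "ae_eq U d e"
proof -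
  have Us: "U \<in> sets lebesgue" using assms(5) by simp
  have "ae_eq U (\<lambda>x. d x - e x) 0"
  proof (rule fundamental_lemma_calculus_of_variations[OF assms(5)])
    show "integrable (lebesgue_on U) (\<lambda>x. d x - e x)"
      by (intro Bochner_Integration.integrable_diff L2_integrable assms Us)
    fix \<phi> assume \<phi>: "\<phi> \<in> test_functions U"
    show "(\<integral>x. \<phi> x * (d x - e x) \<partial>lebesgue_on U) = 0"
      using assms(1,2) \<phi> L2_real_integrable[OF test_function_L2(1)[OF \<phi> assms(6) Us]] assms(3,4)
      by (simp add: right_diff_distrib weak_div_def)
  qed
  then show ?thesis by (simp add: ae_eq_def)
qed

text \<open>\<open>Hm\<close> asks for square integrability of each component of the gradient,
  \<open>grad\<close> for that of the vector field. Reconciling the two ensures that the choice in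
  \<open>grad\<close> has a witness.\<close>

lemma H1_iff: "v \<in> H1 U \<longleftrightarrow> v \<in> L2 U \<and> (\<exists>G\<in>L2 U. weak_grad U v G)"
  unfolding One_nat_def Hm.simps using L2_vec_iff[of _ U] by blast

lemma grad_H1:
  assumes "v \<in> H1 U"
  shows "grad U v \<in> L2 U" "weak_grad U v (grad U v)"
proof -
  have "\<exists>G. G \<in> L2 U \<and> weak_grad U v G" using assms unfolding H1_iff by blast
  then have "grad U v \<in> L2 U \<and> weak_grad U v (grad U v)" unfolding grad_def by (rule someI_ex)
  then show "grad U v \<in> L2 U" "weak_grad U v (grad U v)" by auto
qed

lemma dvg_Hdiv:
  assumes "\<tau> \<in> Hdiv U"
  shows "dvg U \<tau> \<in> L2 U" "weak_div U \<tau> (dvg U \<tau>)"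
proof -
  have "\<exists>d. d \<in> L2 U \<and> weak_div U \<tau> d" using assms unfolding Hdiv_def by blast
  then have "dvg U \<tau> \<in> L2 U \<and> weak_div U \<tau> (dvg U \<tau>)" unfolding dvg_def by (rule someI_ex)
  then show "dvg U \<tau> \<in> L2 U" "weak_div U \<tau> (dvg U \<tau>)" by auto
qed

lemma Hdiv_L2: "\<tau> \<in> Hdiv U \<Longrightarrow> \<tau> \<in> L2 U"
  by (simp add: Hdiv_def)

lemma H1_L2: "v \<in> H1 U \<Longrightarrow> v \<in> L2 U"
  unfolding H1_iff by simp

context
  fixes U :: "pt set"
  assumes U: "open U" "bounded U"
begin

private lemma Us: "U \<in> sets lebesgue" using U by simp

lemma H1_lincomb:
  assumes "v \<in> H1 U" "w \<in> H1 U"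
  shows "r *\<^sub>R v + s *\<^sub>R w \<in> H1 U"
    "ae_eq U (grad U (r *\<^sub>R v + s *\<^sub>R w)) (r *\<^sub>R grad U v + s *\<^sub>R grad U w)"
proof -
  note L = H1_L2[OF assms(1)] H1_L2[OF assms(2)] grad_H1(1)[OF assms(1)] grad_H1(1)[OF assms(2)]
  have w: "weak_grad U (r *\<^sub>R v + s *\<^sub>R w) (r *\<^sub>R grad U v + s *\<^sub>R grad U w)"
    by (intro weak_grad_lincomb grad_H1 assms L U Us)
  have M: "r *\<^sub>R v + s *\<^sub>R w \<in> L2 U" "r *\<^sub>R grad U v + s *\<^sub>R grad U w \<in> L2 U"
    by (intro subspace_lincomb subspace_L2 L)+
  with w show H: "r *\<^sub>R v + s *\<^sub>R w \<in> H1 U" unfolding H1_iff by blast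
  show "ae_eq U (grad U (r *\<^sub>R v + s *\<^sub>R w)) (r *\<^sub>R grad U v + s *\<^sub>R grad U w)"
    by (rule weak_grad_unique[OF grad_H1(2)[OF H] w M(1) grad_H1(1)[OF H] M(2) U])
qed

lemma Hdiv_lincomb:
  assumes "v \<in> Hdiv U" "w \<in> Hdiv U"
  shows "r *\<^sub>R v + s *\<^sub>R w \<in> Hdiv U"
    "ae_eq U (dvg U (r *\<^sub>R v + s *\<^sub>R w)) (r *\<^sub>R dvg U v + s *\<^sub>R dvg U w)"
proof -
  note L = Hdiv_L2[OF assms(1)] Hdiv_L2[OF assms(2)] dvg_Hdiv(1)[OF assms(1)] dvg_Hdiv(1)[OF assms(2)]
  have w: "weak_div U (r *\<^sub>R v + s *\<^sub>R w) (r *\<^sub>R dvg U v + s *\<^sub>R dvg U w)"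
    by (intro weak_div_lincomb dvg_Hdiv assms L U Us)
  have M: "r *\<^sub>R v + s *\<^sub>R w \<in> L2 U" "r *\<^sub>R dvg U v + s *\<^sub>R dvg U w \<in> L2 U"
    by (intro subspace_lincomb subspace_L2 L)+
  with w show H: "r *\<^sub>R v + s *\<^sub>R w \<in> Hdiv U" unfolding Hdiv_def by blast
  show "ae_eq U (dvg U (r *\<^sub>R v + s *\<^sub>R w)) (r *\<^sub>R dvg U v + s *\<^sub>R dvg U w)"
    by (rule weak_div_unique[OF dvg_Hdiv(2)[OF H] w dvg_Hdiv(1)[OF H] M(2) U])
qed

lemma H1_0: "0 \<in> H1 U"
proof -
  have "weak_grad U 0 0" by (simp add: weak_grad_def)
  then show ?thesis unfolding H1_iff by (intro conjI bexI[OF _ zero_L2] zero_L2)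
qed

lemma Hdiv_0: "0 \<in> Hdiv U"
proof -
  have "weak_div U 0 0" by (simp add: weak_div_def)
  then show ?thesis unfolding Hdiv_def by (intro CollectI conjI bexI[OF _ zero_L2] zero_L2)
qed

lemma subspace_H1: "subspace (H1 U)"
  by (intro subspaceI_lincomb H1_0 H1_lincomb)

lemma subspace_Hdiv: "subspace (Hdiv U)"
  by (intro subspaceI_lincomb Hdiv_0 Hdiv_lincomb)

lemma grad_ae_unique:
  assumes "v \<in> H1 U" "G \<in> L2 U" "weak_grad U v G"
  shows "ae_eq U (grad U v) G"
  by (rule weak_grad_unique[OF grad_H1(2) assms(3) H1_L2 grad_H1(1) assms(2) U]) (rule assms)+

lemma dvg_ae_unique:
  assumes "\<tau> \<in> Hdiv U" "d \<in> L2 U" "weak_div U \<tau> d"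
  shows "ae_eq U (dvg U \<tau>) d"
  by (rule weak_div_unique[OF dvg_Hdiv(2) assms(3) dvg_Hdiv(1) assms(2) U]) (rule assms)+

text \<open>\<open>grad\<close> chooses a representative for each function separately; that null
  functions receive null gradients makes the discrete forms vanish on null functions.\<close>

lemma grad_ae_0:
  assumes "v \<in> H1 U" "ae_eq U v 0"
  shows "ae_eq U (grad U v) 0"
proof (rule grad_ae_unique[OF assms(1)])
  show "weak_grad U v 0"
    unfolding weak_grad_def
  proof
    fix \<phi> assume \<phi>: "\<phi> \<in> test_functions U"
    have "(\<integral>x. v x *\<^sub>R classical_grad \<phi> x \<partial>lebesgue_on U) = (\<integral>x. 0 \<partial>lebesgue_on U)"
    proof (rule integral_cong_AE)
      show "(\<lambda>x. v x *\<^sub>R classical_grad \<phi> x) \<in> borel_measurable (lebesgue_on U)"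
        by (intro borel_measurable_integrable L2_scaleR_integrable H1_L2 assms test_function_L2[OF \<phi>] U Us)
      show "AE x in lebesgue_on U. v x *\<^sub>R classical_grad \<phi> x = 0"
        using assms(2) unfolding ae_eq_def by eventually_elim simp
    qed auto
    then show "(\<integral>x. v x *\<^sub>R classical_grad \<phi> x \<partial>lebesgue_on U) = - (\<integral>x. \<phi> x *\<^sub>R 0 x \<partial>lebesgue_on U)"
      by simp
  qed
qed (rule zero_L2)

lemma dvg_ae_0:
  assumes "\<tau> \<in> Hdiv U" "ae_eq U \<tau> 0"
  shows "ae_eq U (dvg U \<tau>) 0"
proof (rule dvg_ae_unique[OF assms(1)])
  show "weak_div U \<tau> 0"
    unfolding weak_div_def
  proof
    fix \<phi> assume \<phi>: "\<phi> \<in> test_functions U"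
    have "(\<integral>x. \<tau> x \<bullet> classical_grad \<phi> x \<partial>lebesgue_on U) = (\<integral>x. 0 \<partial>lebesgue_on U)"
    proof (rule integral_cong_AE)
      show "(\<lambda>x. \<tau> x \<bullet> classical_grad \<phi> x) \<in> borel_measurable (lebesgue_on U)"
        by (intro borel_measurable_integrable integrable_inner_L2 Hdiv_L2 assms test_function_L2[OF \<phi>] U Us)
      show "AE x in lebesgue_on U. \<tau> x \<bullet> classical_grad \<phi> x = 0"
        using assms(2) unfolding ae_eq_def by eventually_elim simp
    qed auto
    then show "(\<integral>x. \<tau> x \<bullet> classical_grad \<phi> x \<partial>lebesgue_on U) = - (\<integral>x. \<phi> x * 0 x \<partial>lebesgue_on U)"
      by simp
  qed
qed (rule zero_L2)

end

lemma H1_mono: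
  assumes "v \<in> H1 U" "U' \<subseteq> U" "open U" "open U'" "bounded U"
  shows "v \<in> H1 U'" "ae_eq U' (grad U' v) (grad U v)"
proof -
  have s: "U \<in> sets lebesgue" "U' \<in> sets lebesgue" using assms by auto
  have b: "bounded U'" using assms bounded_subset by blast
  have G: "weak_grad U' v (grad U v)" "grad U v \<in> L2 U'" "v \<in> L2 U'"
    using weak_grad_mono[OF grad_H1(2)[OF assms(1)] assms(2) s] L2_mono[OF _ assms(2) s]
      grad_H1(1)[OF assms(1)] H1_L2[OF assms(1)] by auto
  then show H: "v \<in> H1 U'" unfolding H1_iff by blast
  show "ae_eq U' (grad U' v) (grad U v)"
    by (rule grad_ae_unique[OF assms(4) b H G(2,1)])
qed

section \<open>Arc length and traces\<close>

lemma sets_arc_length_on: "sets (arc_length_on S) = sets (restrict_space borel S)"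
  unfolding arc_length_on_def
  \<comment> \<open>\<open>measure_of\<close> fixes the sigma-algebra whether or not
    \<open>hausdorff1\<close> is countably additive on it, so measurability requires no property of
    Hausdorff measure.\<close>
  by (rule sets_restrict_space_cong) (metis sets_measure_of sets.space_closed sets.sigma_sets_eq space_borel)

lemma continuous_measurable_arc_length:
  fixes f :: sfun
  assumes "continuous_on UNIV f"
  shows "f \<in> borel_measurable (arc_length_on S)"
  using measurable_restrict_space1[OF borel_measurable_continuous_onI[OF assms], of S]
  by (simp add: measurable_cong_sets[OF sets_arc_length_on refl])

lemma tendsto_0_squeeze:
  fixes f :: "nat \<Rightarrow> real"
  assumes "\<And>n. 0 \<le> f n" "\<And>n. f n \<le> g n" "g \<longlonglongrightarrow> 0"
  shows "f \<longlonglongrightarrow> 0"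
  by (rule tendsto_sandwich[of "\<lambda>_. 0" f _ g]) (use assms in auto)

text \<open>The approximating sequences are combined linearly. The two L2 norms obey the triangle
  inequality; the boundary term is an extended nonnegative integral of a square and is split by (a +
  b)^2 \<le> 2 a^2 + 2 b^2.\<close>

lemma has_trace_lincomb:
  assumes U: "open U" "bounded U" and v: "v \<in> H1 U" "has_trace U S v p" and w: "w \<in> H1 U" "has_trace U S w q"
  shows "has_trace U S (r *\<^sub>R v + s *\<^sub>R w) (r *\<^sub>R p + s *\<^sub>R q)"
proof -
  have Us: "U \<in> sets lebesgue" using U by simp
  obtain \<phi> where \<phi>: "\<And>n. smooth (\<phi> n)" "(\<lambda>n. l2_norm U (\<lambda>x. \<phi> n x - v x)) \<longlonglongrightarrow> 0"
    "(\<lambda>n. l2_norm U (\<lambda>x. classical_grad (\<phi> n) x - grad U v x)) \<longlonglongrightarrow> 0"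
    "(\<lambda>n. \<integral>\<^sup>+x. ennreal ((\<phi> n x - p x)\<^sup>2) \<partial>(arc_length_on S)) \<longlonglongrightarrow> 0"
    "p \<in> borel_measurable (arc_length_on S)"
    using v(2) unfolding has_trace_def by auto
  obtain \<psi> where \<psi>: "\<And>n. smooth (\<psi> n)" "(\<lambda>n. l2_norm U (\<lambda>x. \<psi> n x - w x)) \<longlonglongrightarrow> 0"
    "(\<lambda>n. l2_norm U (\<lambda>x. classical_grad (\<psi> n) x - grad U w x)) \<longlonglongrightarrow> 0"
    "(\<lambda>n. \<integral>\<^sup>+x. ennreal ((\<psi> n x - q x)\<^sup>2) \<partial>(arc_length_on S)) \<longlonglongrightarrow> 0"
    "q \<in> borel_measurable (arc_length_on S)"
    using w(2) unfolding has_trace_def by auto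
  define \<chi>' where "\<chi>' n x = r * \<phi> n x + s * \<psi> n x" for n x
  have smooth: "smooth (\<chi>' n)" for n
    unfolding \<chi>'_def[abs_def] by (intro smooth_lincomb \<phi> \<psi>)
  have cg: "classical_grad (\<chi>' n) = r *\<^sub>R classical_grad (\<phi> n) + s *\<^sub>R classical_grad (\<psi> n)" for n
    unfolding \<chi>'_def[abs_def] by (intro classical_grad_lincomb \<phi> \<psi>)
  have sL: "smooth f \<Longrightarrow> f \<in> L2 U" "smooth f \<Longrightarrow> classical_grad f \<in> L2 U" for f
    using continuous_in_L2 continuous_classical_grad smooth_continuous U(2) Us by auto
  have l2: "l2_norm U (r *\<^sub>R a + s *\<^sub>R b) \<le> \<bar>r\<bar> * l2_norm U a + \<bar>s\<bar> * l2_norm U b"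
    if "a \<in> L2 U" "b \<in> L2 U" for a b :: "pt \<Rightarrow> 'b::euclidean_space"
    using L2.triangle[of "r *\<^sub>R a" U "s *\<^sub>R b"] L2.scale_sqrt[OF that(1), of r] L2.scale_sqrt[OF that(2), of s] that
    by (simp add: l2_norm_def subspace_scale[OF subspace_L2])
  have "(\<lambda>n. l2_norm U (\<lambda>x. \<chi>' n x - (r *\<^sub>R v + s *\<^sub>R w) x)) \<longlonglongrightarrow> 0"
  proof (rule tendsto_0_squeeze)
    show "(\<lambda>n. \<bar>r\<bar> * l2_norm U (\<lambda>x. \<phi> n x - v x) + \<bar>s\<bar> * l2_norm U (\<lambda>x. \<psi> n x - w x)) \<longlonglongrightarrow> 0"
      using tendsto_add[OF tendsto_mult_right_zero[OF \<phi>(2)] tendsto_mult_right_zero[OF \<psi>(2)]] by simp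
    fix n
    have "(\<lambda>x. \<chi>' n x - (r *\<^sub>R v + s *\<^sub>R w) x) = r *\<^sub>R (\<phi> n - v) + s *\<^sub>R (\<psi> n - w)"
      by (auto simp: \<chi>'_def fun_eq_iff algebra_simps)
    moreover have "\<phi> n - v \<in> L2 U" "\<psi> n - w \<in> L2 U"
      by (intro subspace_diff subspace_L2 sL \<phi> \<psi> H1_L2 v w)+
    ultimately show "l2_norm U (\<lambda>x. \<chi>' n x - (r *\<^sub>R v + s *\<^sub>R w) x)
        \<le> \<bar>r\<bar> * l2_norm U (\<lambda>x. \<phi> n x - v x) + \<bar>s\<bar> * l2_norm U (\<lambda>x. \<psi> n x - w x)"
      using l2[of "\<phi> n - v" "\<psi> n - w"] by (simp add: fun_diff_def)
  qed (rule l2_norm_nonneg)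
  moreover have "(\<lambda>n. l2_norm U (\<lambda>x. classical_grad (\<chi>' n) x - grad U (r *\<^sub>R v + s *\<^sub>R w) x)) \<longlonglongrightarrow> 0"
  proof (rule tendsto_0_squeeze)
    show "(\<lambda>n. \<bar>r\<bar> * l2_norm U (\<lambda>x. classical_grad (\<phi> n) x - grad U v x)
        + \<bar>s\<bar> * l2_norm U (\<lambda>x. classical_grad (\<psi> n) x - grad U w x)) \<longlonglongrightarrow> 0"
      using tendsto_add[OF tendsto_mult_right_zero[OF \<phi>(3)] tendsto_mult_right_zero[OF \<psi>(3)]] by simp
    fix n
    let ?A = "classical_grad (\<phi> n) - grad U v" and ?B = "classical_grad (\<psi> n) - grad U w"
    have AB: "?A \<in> L2 U" "?B \<in> L2 U"
      by (intro subspace_diff subspace_L2 sL \<phi> \<psi> grad_H1 v w)+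
    \<comment> \<open>The chosen gradient of a combination equals the combination of chosen
      gradients only almost everywhere, so the norms are compared by
      \<open>l2_norm_cong\<close>.\<close>
    have "ae_eq U (\<lambda>x. classical_grad (\<chi>' n) x - grad U (r *\<^sub>R v + s *\<^sub>R w) x) (r *\<^sub>R ?A + s *\<^sub>R ?B)"
      using H1_lincomb(2)[OF U v(1) w(1), of r s] unfolding ae_eq_def cg
      by eventually_elim (simp add: algebra_simps)
    moreover have "(\<lambda>x. classical_grad (\<chi>' n) x - grad U (r *\<^sub>R v + s *\<^sub>R w) x) \<in> L2 U"
      using subspace_diff[OF subspace_L2 sL(2)[OF smooth] grad_H1(1)[OF H1_lincomb(1)[OF U v(1) w(1)]]]
      by (simp add: fun_diff_def)
    moreover have "r *\<^sub>R ?A + s *\<^sub>R ?B \<in> L2 U" by (rule subspace_lincomb[OF subspace_L2 AB])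
    ultimately have "l2_norm U (\<lambda>x. classical_grad (\<chi>' n) x - grad U (r *\<^sub>R v + s *\<^sub>R w) x)
        = l2_norm U (r *\<^sub>R ?A + s *\<^sub>R ?B)" by (rule l2_norm_cong)
    then show "l2_norm U (\<lambda>x. classical_grad (\<chi>' n) x - grad U (r *\<^sub>R v + s *\<^sub>R w) x)
        \<le> \<bar>r\<bar> * l2_norm U (\<lambda>x. classical_grad (\<phi> n) x - grad U v x)
          + \<bar>s\<bar> * l2_norm U (\<lambda>x. classical_grad (\<psi> n) x - grad U w x)"
      using l2[OF AB] by (simp add: fun_diff_def)
  qed (rule l2_norm_nonneg)
  moreover have "(\<lambda>n. \<integral>\<^sup>+x. ennreal ((\<chi>' n x - (r *\<^sub>R p + s *\<^sub>R q) x)\<^sup>2) \<partial>(arc_length_on S)) \<longlonglongrightarrow> 0"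
  proof (rule tendsto_sandwich[OF _ _ tendsto_const])
    let ?I = "\<lambda>n. (\<integral>\<^sup>+x. ennreal ((\<phi> n x - p x)\<^sup>2) \<partial>(arc_length_on S))"
    let ?J = "\<lambda>n. (\<integral>\<^sup>+x. ennreal ((\<psi> n x - q x)\<^sup>2) \<partial>(arc_length_on S))"
    have "(\<lambda>n. ennreal (2 * r\<^sup>2) * ?I n + ennreal (2 * s\<^sup>2) * ?J n)
        \<longlonglongrightarrow> ennreal (2 * r\<^sup>2) * 0 + ennreal (2 * s\<^sup>2) * 0"
      by (intro tendsto_add ennreal_tendsto_cmult \<phi>(4) \<psi>(4)) auto
    then show "(\<lambda>n. ennreal (2 * r\<^sup>2) * ?I n + ennreal (2 * s\<^sup>2) * ?J n) \<longlonglongrightarrow> 0" by simp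
    have "(\<integral>\<^sup>+x. ennreal ((\<chi>' n x - (r *\<^sub>R p + s *\<^sub>R q) x)\<^sup>2) \<partial>(arc_length_on S))
        \<le> ennreal (2 * r\<^sup>2) * ?I n + ennreal (2 * s\<^sup>2) * ?J n" for n
    proof -
      have m: "\<phi> n \<in> borel_measurable (arc_length_on S)" "\<psi> n \<in> borel_measurable (arc_length_on S)"
        by (intro continuous_measurable_arc_length smooth_continuous \<phi> \<psi>)+
      have "(\<integral>\<^sup>+x. ennreal ((\<chi>' n x - (r *\<^sub>R p + s *\<^sub>R q) x)\<^sup>2) \<partial>(arc_length_on S))
          \<le> (\<integral>\<^sup>+x. ennreal (2 * r\<^sup>2) * ennreal ((\<phi> n x - p x)\<^sup>2)
              + ennreal (2 * s\<^sup>2) * ennreal ((\<psi> n x - q x)\<^sup>2) \<partial>(arc_length_on S))"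
      proof (rule nn_integral_mono)
        fix x
        have sq: "(r * a + s * b)\<^sup>2 \<le> 2 * r\<^sup>2 * a\<^sup>2 + 2 * s\<^sup>2 * b\<^sup>2" for a b :: real
          using sum_squares_bound[of "r * a" "s * b"] by (auto simp: power2_sum power_mult_distrib ac_simps)
        have "(\<chi>' n x - (r *\<^sub>R p + s *\<^sub>R q) x)\<^sup>2 = (r * (\<phi> n x - p x) + s * (\<psi> n x - q x))\<^sup>2"
          by (simp add: \<chi>'_def algebra_simps)
        also have "\<dots> \<le> 2 * r\<^sup>2 * (\<phi> n x - p x)\<^sup>2 + 2 * s\<^sup>2 * (\<psi> n x - q x)\<^sup>2" by (rule sq)
        finally show "ennreal ((\<chi>' n x - (r *\<^sub>R p + s *\<^sub>R q) x)\<^sup>2)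
            \<le> ennreal (2 * r\<^sup>2) * ennreal ((\<phi> n x - p x)\<^sup>2) + ennreal (2 * s\<^sup>2) * ennreal ((\<psi> n x - q x)\<^sup>2)"
          by (simp add: ennreal_mult[symmetric] ennreal_plus[symmetric] del: ennreal_plus)
      qed
      also have "\<dots> = ennreal (2 * r\<^sup>2) * ?I n + ennreal (2 * s\<^sup>2) * ?J n"
        using m \<phi>(5) \<psi>(5) by (simp add: nn_integral_add nn_integral_cmult)
      finally show ?thesis .
    qed
    then show "\<forall>\<^sub>F n in sequentially. (\<integral>\<^sup>+x. ennreal ((\<chi>' n x - (r *\<^sub>R p + s *\<^sub>R q) x)\<^sup>2) \<partial>(arc_length_on S))
        \<le> ennreal (2 * r\<^sup>2) * ?I n + ennreal (2 * s\<^sup>2) * ?J n" by simp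
  qed auto
  moreover have "r *\<^sub>R p + s *\<^sub>R q \<in> borel_measurable (arc_length_on S)"
    using \<phi>(5) \<psi>(5) by (simp add: plus_fun_def scaleR_fun_def)
  ultimately show ?thesis unfolding has_trace_def using smooth by blast
qed

lemma has_trace_0:
  assumes U: "open U" "bounded U"
  shows "has_trace U S 0 0"
proof -
  have Us: "U \<in> sets lebesgue" using U by simp
  have cg: "classical_grad (\<lambda>x. 0) = 0"
    by (auto simp: classical_grad_def fun_eq_iff vec_eq_iff)
  have "l2_norm U (\<lambda>x. classical_grad (\<lambda>x. 0) x - grad U 0 x) = l2_norm U (0 :: vfun)"
  proof (rule l2_norm_cong)
    \<comment> \<open>Even for the zero function \<open>grad\<close> is a chosen representative,
      zero only almost everywhere.\<close>
    have g: "ae_eq U (grad U 0) 0" by (rule grad_ae_0[OF U H1_0[OF U]]) simp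
    show "ae_eq U (\<lambda>x. classical_grad (\<lambda>x. 0) x - grad U 0 x) 0"
      using g unfolding ae_eq_def cg by eventually_elim simp
    show "(\<lambda>x. classical_grad (\<lambda>x. 0) x - grad U 0 x) \<in> L2 U"
      using subspace_neg[OF subspace_L2 grad_H1(1)[OF H1_0[OF U]]]
      by (simp add: cg fun_Compl_def)
  qed (rule zero_L2)
  then show ?thesis
    unfolding has_trace_def
    by (intro conjI exI[of _ "\<lambda>_ _. 0"])
      (auto simp: smooth_def C_k_const l2_norm_0 zero_fun_def l2_norm_0[unfolded zero_fun_def])
qed

text \<open>Replaces a datum that vanishes almost everywhere by 0, which puts a solution into the
  homogeneous space \<open>Vp0_h\<close>.\<close>

lemma has_trace_cong_AE:
  assumes "has_trace U S v p" "AE x in arc_length_on S. p x = p' x" "p' \<in> borel_measurable (arc_length_on S)"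
  shows "has_trace U S v p'"
proof -
  have "(\<integral>\<^sup>+x. ennreal ((\<phi> x - p x)\<^sup>2) \<partial>(arc_length_on S)) = (\<integral>\<^sup>+x. ennreal ((\<phi> x - p' x)\<^sup>2) \<partial>(arc_length_on S))"
    for \<phi> :: sfun
    by (rule nn_integral_cong_AE) (use assms(2) in \<open>auto elim: eventually_mono\<close>)
  then show ?thesis using assms unfolding has_trace_def by simp
qed

section \<open>The discrete forms and spaces\<close>

declare One_nat_def [simp del] Hm.simps [simp del]
  \<comment> \<open>otherwise the simplifier unfolds \<open>H1\<close>, which is \<open>Hm 1\<close>\<close>

lemma lincomb_fun: "(\<lambda>x. r *\<^sub>R a x + s *\<^sub>R b x) = r *\<^sub>R a + s *\<^sub>R b"
  by (simp add: fun_eq_iff)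

lemma bilinear_on_lin:
  assumes "bilinear_on X Y p"
  shows "c \<in> Y \<Longrightarrow> lin_on X (\<lambda>a. p a c)" "a \<in> X \<Longrightarrow> lin_on Y (p a)"
  using assms by (simp_all add: bilinear_on_def lin_on_def lincomb_fun)

lemma lin_on_fst: "lin_on A L \<Longrightarrow> lin_on (A \<times> B) (\<lambda>x. L (fst x))"
  by (auto simp: lin_on_def)

lemma lin_on_snd: "lin_on B L \<Longrightarrow> lin_on (A \<times> B) (\<lambda>x. L (snd x))"
  by (auto simp: lin_on_def)

lemma lin_on_cong: "(\<And>x. x \<in> S \<Longrightarrow> L x = M x) \<Longrightarrow> subspace S \<Longrightarrow> lin_on S M \<Longrightarrow> lin_on S L"
  by (simp add: lin_on_def subspace_lincomb)

lemma finite_dim_spaceE: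
  assumes "finite_dim_space S"
  obtains B where "finite B" "\<And>p. p \<in> S \<longleftrightarrow> (\<exists>c. p = (\<lambda>x. \<Sum>b\<in>B. c b *\<^sub>R b x))"
  using assms unfolding finite_dim_space_def by (elim exE conjE) simp

lemma finite_dim_space_lincomb:
  assumes "finite_dim_space S" "p \<in> S" "q \<in> S"
  shows "r *\<^sub>R p + s *\<^sub>R q \<in> S"
proof -
  obtain B where "finite B" and B: "\<And>p. p \<in> S \<longleftrightarrow> (\<exists>c. p = (\<lambda>x. \<Sum>b\<in>B. c b *\<^sub>R b x))"
    by (rule finite_dim_spaceE[OF assms(1)]) (rule that)
  obtain c d where "p = (\<lambda>x. \<Sum>b\<in>B. c b *\<^sub>R b x)" "q = (\<lambda>x. \<Sum>b\<in>B. d b *\<^sub>R b x)"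
    using assms(2,3)[unfolded B] by (elim exE)
  then have "r *\<^sub>R p + s *\<^sub>R q = (\<lambda>x. \<Sum>b\<in>B. (r * c b + s * d b) *\<^sub>R b x)"
    by (simp add: fun_eq_iff scaleR_sum_right scaleR_add_left sum.distrib)
  then show ?thesis unfolding B by (rule exI[of _ "\<lambda>b. r * c b + s * d b"])
qed

lemma finite_dim_space_0:
  assumes "finite_dim_space S"
  shows "0 \<in> S"
proof -
  obtain B where "finite B" and B: "\<And>p. p \<in> S \<longleftrightarrow> (\<exists>c. p = (\<lambda>x. \<Sum>b\<in>B. c b *\<^sub>R b x))"
    by (rule finite_dim_spaceE[OF assms(1)]) (rule that)
  show ?thesis unfolding B by (rule exI[of _ "\<lambda>_. 0"]) (simp add: fun_eq_iff)
qed

text \<open>The elementwise condition shared by the three discrete spaces. Agreement is asked only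
  on the part of \<open>K\<close> inside \<open>U\<close>, because a shape function lives on the
  whole element even if the interface cuts it.\<close>

definition piecewise :: "pt set set \<Rightarrow> pt set \<Rightarrow> (pt set \<Rightarrow> (pt \<Rightarrow> 'b) set) \<Rightarrow> (pt \<Rightarrow> 'b) set" where
  "piecewise M U S = {w. \<forall>K\<in>M. \<exists>p\<in>S K. ae_eq (K \<inter> U) w p}"

lemma piecewise_lincomb:
  fixes S :: "pt set \<Rightarrow> (pt \<Rightarrow> 'b::real_vector) set"
  assumes "\<And>K. K \<in> M \<Longrightarrow> finite_dim_space (S K)" "v \<in> piecewise M U S" "w \<in> piecewise M U S"
  shows "r *\<^sub>R v + s *\<^sub>R w \<in> piecewise M U S"
  unfolding piecewise_def
proof (intro CollectI ballI)
  fix K assume K: "K \<in> M"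
  obtain p q where "p \<in> S K" "q \<in> S K" "ae_eq (K \<inter> U) v p" "ae_eq (K \<inter> U) w q"
    using assms(2,3) K unfolding piecewise_def by blast
  then show "\<exists>p\<in>S K. ae_eq (K \<inter> U) (r *\<^sub>R v + s *\<^sub>R w) p"
    using finite_dim_space_lincomb[OF assms(1)[OF K]] ae_eq_lincomb by blast
qed

lemma piecewise_0:
  fixes S :: "pt set \<Rightarrow> (pt \<Rightarrow> 'b::real_vector) set"
  assumes "\<And>K. K \<in> M \<Longrightarrow> finite_dim_space (S K)"
  shows "0 \<in> piecewise M U S"
  using finite_dim_space_0[OF assms] ae_eq_refl unfolding piecewise_def by blast

text \<open>The coordinates are the local coefficients, indexed by an element and a member of its
  spanning set. If the combined coefficients vanish, so does the combination almost everywhere on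
  each element, and by the cover almost everywhere on \<open>U\<close>.\<close>

lemma piecewise_coordinates:
  fixes S :: "pt set \<Rightarrow> (pt \<Rightarrow> 'b::real_vector) set"
  assumes M: "finite M" "\<And>K. K \<in> M \<Longrightarrow> finite_dim_space (S K)" "\<And>K. K \<in> M \<Longrightarrow> K \<in> sets lebesgue"
    and U: "U \<in> sets lebesgue" and cover: "AE x in lebesgue. x \<in> U \<longrightarrow> x \<in> \<Union>M"
    and W: "W \<subseteq> piecewise M U S"
  shows "\<exists>J (\<kappa> :: _ \<Rightarrow> pt set \<times> (pt \<Rightarrow> 'b) \<Rightarrow> real). coordinates_modulo W {w. ae_eq U w 0} J \<kappa>"
proof -
  have "\<forall>K\<in>M. \<exists>B. finite B \<and> (\<forall>p. p \<in> S K \<longleftrightarrow> (\<exists>c. p = (\<lambda>x. \<Sum>b\<in>B. c b *\<^sub>R b x)))"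
    using M(2) by (intro ballI) (rule finite_dim_spaceE, blast+)
  from bchoice[OF this] obtain B where B: "\<And>K. K \<in> M \<Longrightarrow> finite (B K)"
    "\<And>K p. K \<in> M \<Longrightarrow> p \<in> S K \<longleftrightarrow> (\<exists>c. p = (\<lambda>x. \<Sum>b\<in>B K. c b *\<^sub>R b x))"
    by auto
  have "\<exists>c. \<forall>K\<in>M. ae_eq (K \<inter> U) w (\<lambda>x. \<Sum>b\<in>B K. c (K, b) *\<^sub>R b x)" if "w \<in> W" for w
  proof -
    have "\<exists>c. ae_eq (K \<inter> U) w (\<lambda>x. \<Sum>b\<in>B K. c b *\<^sub>R b x)" if K: "K \<in> M" for K
    proof -
      obtain p where "p \<in> S K" "ae_eq (K \<inter> U) w p"
        using subsetD[OF W \<open>w \<in> W\<close>] K unfolding piecewise_def by blast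
      then show ?thesis unfolding B(2)[OF K] by (elim exE) (intro exI, simp)
    qed
    then have "\<forall>K\<in>M. \<exists>c. ae_eq (K \<inter> U) w (\<lambda>x. \<Sum>b\<in>B K. c b *\<^sub>R b x)" by (intro ballI)
    from bchoice[OF this]
    obtain c where "\<forall>K\<in>M. ae_eq (K \<inter> U) w (\<lambda>x. \<Sum>b\<in>B K. c K b *\<^sub>R b x)" by (elim exE)
    then show ?thesis by (intro exI[of _ "\<lambda>(K, b). c K b"]) simp
  qed
  then have "\<forall>w\<in>W. \<exists>c. \<forall>K\<in>M. ae_eq (K \<inter> U) w (\<lambda>x. \<Sum>b\<in>B K. c (K, b) *\<^sub>R b x)" by (intro ballI)
  from bchoice[OF this] obtain \<kappa> where
    \<kappa>: "\<And>w K. w \<in> W \<Longrightarrow> K \<in> M \<Longrightarrow> ae_eq (K \<inter> U) w (\<lambda>x. \<Sum>b\<in>B K. \<kappa> w (K, b) *\<^sub>R b x)"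
    by auto
  have "coordinates_modulo W {w. ae_eq U w 0} (Sigma M B) \<kappa>"
    unfolding coordinates_modulo_def
  proof (intro conjI allI impI CollectI)
    show "finite (Sigma M B)" using M(1) B(1) by auto
    fix n :: nat and e c assume e: "\<forall>i<n. e i \<in> W" and z: "\<forall>j\<in>Sigma M B. (\<Sum>i<n. c i * \<kappa> (e i) j) = 0"
    have "AE x in lebesgue. x \<in> K \<inter> U \<longrightarrow> (\<Sum>i<n. c i *\<^sub>R e i x) = 0" if K: "K \<in> M" for K
    proof -
      have KU: "K \<inter> U \<in> sets lebesgue" using M(3)[OF K] U by simp
      \<comment> \<open>The finitely many exceptional sets, one for each \<open>e i\<close>, are
        merged before the pointwise computation.\<close>
      have "AE x in lebesgue. \<forall>i\<in>{..<n}. x \<in> K \<inter> U \<longrightarrow> e i x = (\<Sum>b\<in>B K. \<kappa> (e i) (K, b) *\<^sub>R b x)"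
        using \<kappa>[OF _ K] e by (intro AE_finite_allI) (auto simp: ae_eq_iff[OF KU])
      then show ?thesis
      proof eventually_elim
        fix x assume x: "\<forall>i\<in>{..<n}. x \<in> K \<inter> U \<longrightarrow> e i x = (\<Sum>b\<in>B K. \<kappa> (e i) (K, b) *\<^sub>R b x)"
        show "x \<in> K \<inter> U \<longrightarrow> (\<Sum>i<n. c i *\<^sub>R e i x) = 0"
        proof
          assume "x \<in> K \<inter> U"
          then have "(\<Sum>i<n. c i *\<^sub>R e i x) = (\<Sum>i<n. \<Sum>b\<in>B K. (c i * \<kappa> (e i) (K, b)) *\<^sub>R b x)"
            using x by (simp add: scaleR_sum_right)
          also have "\<dots> = (\<Sum>b\<in>B K. (\<Sum>i<n. c i * \<kappa> (e i) (K, b)) *\<^sub>R b x)"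
            by (subst sum.swap) (simp add: scaleR_sum_left)
          also have "\<dots> = 0" using z K by simp
          finally show "(\<Sum>i<n. c i *\<^sub>R e i x) = 0" .
        qed
      qed
    qed
    then have "AE x in lebesgue. \<forall>K\<in>M. x \<in> K \<inter> U \<longrightarrow> (\<Sum>i<n. c i *\<^sub>R e i x) = 0"
      using M(1) by (intro AE_finite_allI) auto
    with cover have "AE x in lebesgue. x \<in> U \<longrightarrow> (\<Sum>i<n. c i *\<^sub>R e i x) = 0"
      by eventually_elim auto
    then show "ae_eq U (\<Sum>i<n. c i *\<^sub>R e i) 0"
      by (simp add: ae_eq_iff[OF U] sum_fun_apply)
  qed
  then show ?thesis by blast
qed

section \<open>One mesh: geometry and discrete forms\<close>

locale discrete_interface_problem =
  fixes P :: setting and D :: discretization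
  assumes geometry: "interface_geometry P" and valid: "valid_discretization P D"
begin

abbreviation "\<Omega>p \<equiv> Oms P Plus"
abbreviation "\<Omega>m \<equiv> Oms P Minus"

lemma Om_open: "open (Om P)" and Om_bounded: "bounded (Om P)" and Om_convex: "convex (Om P)"
proof -
  have g: "open (Om P)" "convex (Om P)" "polytope (closure (Om P))"
    using geometry unfolding interface_geometry_def by blast+
  show "open (Om P)" "convex (Om P)" by (rule g)+
  show "bounded (Om P)"
    by (rule bounded_subset[OF polytope_imp_bounded[OF g(3)] closure_subset])
qed

lemma Oms_open: "open (Oms P s)"
  using geometry unfolding interface_geometry_def by blast

lemma Oms_subset: "Oms P s \<subseteq> Om P"
  using geometry unfolding interface_geometry_def by (cases s) blast+

lemma Oms_bounded: "bounded (Oms P s)"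
  using Om_bounded Oms_subset bounded_subset by blast

lemma Oms_sets: "Oms P s \<in> sets lebesgue" and Om_sets: "Om P \<in> sets lebesgue"
  using Oms_open Om_open by auto

lemma beta_pos: "beta P s > 0"
  using geometry unfolding interface_geometry_def by blast

lemma L2_Oms: "w \<in> L2 (Om P) \<Longrightarrow> w \<in> L2 (Oms P s)"
  by (rule L2_mono[OF _ Oms_subset Om_sets Oms_sets])

lemma mesh_finite: "finite (mesh D)"
  and mesh_simplex: "K \<in> mesh D \<Longrightarrow> 2 simplex K"
  and mesh_cover: "\<Union>(mesh D) = closure (Om P)"
  using valid unfolding valid_discretization_def triangulation_def by blast+

lemma mesh_sets: "K \<in> mesh D \<Longrightarrow> K \<in> sets lebesgue"
  using closed_simplex[OF mesh_simplex] by (simp add: borel_closed)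

lemma mesh_side_subset: "mesh_side P D s \<subseteq> mesh D"
  by (auto simp: mesh_side_def)

text \<open>An uncut element meets the interface only in vertices and edges. These are proper faces
  of the triangle and miss its interior, which therefore lies in the two open subdomains and, being
  connected, in one of them.\<close>

lemma interior_element_one_side:
  assumes K: "K \<in> mesh D" "\<not> interface_element P K"
  shows "interior K \<subseteq> \<Omega>p \<or> interior K \<subseteq> \<Omega>m"
proof -
  have dim: "aff_dim K = 2" using aff_dim_simplex[OF mesh_simplex[OF K(1)]] by simp
  have "interior K \<inter> interface P = {}"
  proof (rule ccontr)
    assume "interior K \<inter> interface P \<noteq> {}"
    then obtain x where x: "x \<in> interior K" "x \<in> interface P" by blast
    then have "x \<in> K" using interior_subset by blast
    then consider "x extreme_point_of K" | e where "e edge_of K" "x \<in> e"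
      using K(2) x unfolding interface_element_def by blast
    then obtain F where F: "F face_of K" "x \<in> F" "aff_dim F < 2"
    proof cases
      case 1
      then show ?thesis using that[of "{x}"] face_of_singleton by fastforce
    next
      case 2
      then show ?thesis using that[of e] by (auto simp: edge_of_def)
    qed
    then have "F \<noteq> K" using dim by auto
    with F x show False using face_of_disjoint_interior by blast
  qed
  \<comment> \<open>The elements cover the closure of the domain; an open convex set is the interior
    of its closure.\<close>
  moreover have "interior K \<subseteq> Om P"
  proof -
    have "K \<subseteq> closure (Om P)" using mesh_cover K(1) by blast
    then have "interior K \<subseteq> interior (closure (Om P))" by (rule interior_mono)
    then show ?thesis
      using convex_interior_closure[OF Om_convex] interior_open[OF Om_open] by simp
  qed
  ultimately have sub: "interior K \<subseteq> \<Omega>p \<union> \<Omega>m" and disj: "\<Omega>p \<inter> \<Omega>m = {}"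
    using geometry unfolding interface_geometry_def by blast+
  have "connected (interior K)"
    using convex_simplex[OF mesh_simplex[OF K(1)]] by (simp add: convex_connected convex_interior)
  then show ?thesis
    using connectedD[OF _ Oms_open Oms_open, of "interior K" Plus Minus] sub disj by blast
qed

text \<open>A point of side \<open>s\<close> in the interior of an uncut element forces that
  interior onto side \<open>s\<close>. Points on element boundaries escape the argument, but
  frontiers of convex sets are null.\<close>

lemma mesh_side_cover: "AE x in lebesgue. x \<in> Oms P s \<longrightarrow> x \<in> \<Union>(mesh_side P D s)"
proof -
  have "AE x in lebesgue. x \<notin> frontier K" if "K \<in> mesh D" for K
    using convex_simplex[OF mesh_simplex[OF that]]
    by (intro AE_not_in) (simp add: negligible_iff_null_sets[symmetric] negligible_convex_frontier)
  then have "AE x in lebesgue. \<forall>K\<in>mesh D. x \<notin> frontier K"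
    using mesh_finite by (intro AE_finite_allI) auto
  then show ?thesis
  proof eventually_elim
    fix x assume x: "\<forall>K\<in>mesh D. x \<notin> frontier K"
    show "x \<in> Oms P s \<longrightarrow> x \<in> \<Union>(mesh_side P D s)"
    proof
      assume s: "x \<in> Oms P s"
      then have "x \<in> \<Union>(mesh D)" using Oms_subset closure_subset mesh_cover by blast
      then obtain K where K: "K \<in> mesh D" "x \<in> K" by blast
      have xi: "x \<in> interior K"
        using x K closed_simplex[OF mesh_simplex[OF K(1)]] by (auto simp: frontier_def)
      have "\<Omega>p \<inter> \<Omega>m = {}" using geometry unfolding interface_geometry_def by blast
      then have "interface_element P K \<or> interior K \<subseteq> Oms P s"
        using interior_element_one_side[OF K(1)] xi s by (cases s) blast+
      then show "x \<in> \<Union>(mesh_side P D s)" using K by (auto simp: mesh_side_def)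
    qed
  qed
qed

lemma element_props:
  assumes "K \<in> mesh D"
  shows "finite_dim_space (Su D s K)" "finite_dim_space (Ssig D K)"
    "discrete_inner_product (K \<inter> Oms P s) (quad D s K)"
    "bilinear_on (Hdiv \<Omega>m) (H1 \<Omega>p) (quadG D K)"
    "\<And>\<tau> \<tau>' v v'. \<tau> \<in> Hdiv \<Omega>m \<Longrightarrow> \<tau>' \<in> Hdiv \<Omega>m \<Longrightarrow> v \<in> H1 \<Omega>p \<Longrightarrow> v' \<in> H1 \<Omega>p \<Longrightarrow>
      ae_eq \<Omega>m \<tau> \<tau>' \<Longrightarrow> ae_eq \<Omega>p v v' \<Longrightarrow> quadG D K \<tau> v = quadG D K \<tau>' v'"
proof -
  note v = valid[unfolded valid_discretization_def, THEN conjunct2, THEN conjunct2, THEN conjunct2,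
      THEN conjunct1, THEN bspec, OF assms]
  note t = v[THEN conjunct2, THEN conjunct2, THEN conjunct2, THEN conjunct2, THEN conjunct2]
  show "finite_dim_space (Su D s K)" by (rule v[THEN conjunct1, THEN spec])
  show "finite_dim_space (Ssig D K)" by (rule v[THEN conjunct2, THEN conjunct1])
  show "discrete_inner_product (K \<inter> Oms P s) (quad D s K)" by (rule t[THEN conjunct1, THEN spec])
  show "bilinear_on (Hdiv \<Omega>m) (H1 \<Omega>p) (quadG D K)" by (rule t[THEN conjunct2, THEN conjunct1])
  show "quadG D K \<tau> v = quadG D K \<tau>' v'"
    if "\<tau> \<in> Hdiv \<Omega>m" "\<tau>' \<in> Hdiv \<Omega>m" "v \<in> H1 \<Omega>p" "v' \<in> H1 \<Omega>p"
      "ae_eq \<Omega>m \<tau> \<tau>'" "ae_eq \<Omega>p v v'" for \<tau> \<tau>' v v'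
    by (rule t[THEN conjunct2, THEN conjunct2, THEN bspec, OF that(1), THEN bspec, OF that(2),
          THEN bspec, OF that(3), THEN bspec, OF that(4), THEN mp, OF conjI[OF that(5,6)]])
qed

lemma L2_element:
  assumes "K \<in> mesh D" "w \<in> L2 (Oms P s)"
  shows "w \<in> L2 (K \<inter> Oms P s)"
  by (rule L2_mono[OF assms(2) Int_lower2 Oms_sets sets.Int[OF mesh_sets[OF assms(1)] Oms_sets]])

lemma quad_semi_inner:
  assumes "K \<in> mesh D"
  shows "semi_inner (L2 (K \<inter> Oms P s)) (quad D s K)"
proof -
  note q = element_props(3)[OF assms, of s, unfolded discrete_inner_product_def]
  show ?thesis
  proof
    show "subspace (L2 (K \<inter> Oms P s) :: sfun set)" by (rule subspace_L2)
    show "lin_on (L2 (K \<inter> Oms P s)) (\<lambda>x. quad D s K x z)" if "z \<in> L2 (K \<inter> Oms P s)" for z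
      by (rule bilinear_on_lin(1)[OF q[THEN conjunct1] that])
    show "quad D s K x y = quad D s K y x" if "x \<in> L2 (K \<inter> Oms P s)" "y \<in> L2 (K \<inter> Oms P s)" for x y
      by (rule q[THEN conjunct2, THEN conjunct1, THEN bspec, OF that(1), THEN bspec, OF that(2)])
    show "0 \<le> quad D s K x x" if "x \<in> L2 (K \<inter> Oms P s)" for x
      by (rule q[THEN conjunct2, THEN conjunct2, THEN conjunct1, THEN bspec, OF that])
  qed
qed

lemma inner_h_semi_inner: "semi_inner (L2 (Oms P s)) (inner_h P D s)"
proof
  show "subspace (L2 (Oms P s) :: sfun set)" by (rule subspace_L2)
  fix z :: sfun assume z: "z \<in> L2 (Oms P s)"
  have "lin_on (L2 (Oms P s)) (\<lambda>x. quad D s K x z)" if "K \<in> mesh D" for K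
    using semi_inner.lin[OF quad_semi_inner[OF that] L2_element[OF that z]]
    by (rule lin_on_subset) (use L2_element[OF that] in auto)
  then show "lin_on (L2 (Oms P s)) (\<lambda>x. inner_h P D s x z)"
    unfolding inner_h_def by (intro lin_on_setsum) auto
next
  fix x y :: sfun assume "x \<in> L2 (Oms P s)" "y \<in> L2 (Oms P s)"
  then show "inner_h P D s x y = inner_h P D s y x"
    unfolding inner_h_def
    by (intro sum.cong refl semi_inner.sym[OF quad_semi_inner]) (auto intro: L2_element)
next
  fix x :: sfun assume "x \<in> L2 (Oms P s)"
  then show "0 \<le> inner_h P D s x x"
    unfolding inner_h_def
    by (intro sum_nonneg semi_inner.nonneg[OF quad_semi_inner]) (auto intro: L2_element)
qed

sublocale ih: semi_inner "L2 (Oms P s)" "inner_h P D s" for s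
  by (rule inner_h_semi_inner)

lemma inner_h_cong:
  assumes "ae_eq (Oms P s) v v'" "v \<in> L2 (Oms P s)" "v' \<in> L2 (Oms P s)" "w \<in> L2 (Oms P s)"
  shows "inner_h P D s v w = inner_h P D s v' w"
  unfolding inner_h_def
proof (intro sum.cong refl)
  fix K assume "K \<in> {K \<in> mesh D. K \<inter> Oms P s \<noteq> {}}"
  then have K: "K \<in> mesh D" by simp
  have "ae_eq (K \<inter> Oms P s) v v'"
    by (rule ae_eq_mono[OF assms(1) Int_lower2 Oms_sets sets.Int[OF mesh_sets[OF K] Oms_sets]])
  moreover note element_props(3)[OF K, of s, unfolded discrete_inner_product_def, THEN conjunct2,
      THEN conjunct2, THEN conjunct2]
  ultimately show "quad D s K v w = quad D s K v' w"
    using L2_element[OF K] assms(2-4) by blast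
qed

lemma inner_h_ae_0:
  assumes "ae_eq (Oms P s) v 0" "v \<in> L2 (Oms P s)" "w \<in> L2 (Oms P s)"
  shows "inner_h P D s v w = 0" "inner_h P D s w v = 0"
proof -
  show "inner_h P D s v w = 0"
    using inner_h_cong[OF assms(1,2) zero_L2 assms(3)] lin_on_0[OF ih.lin[OF assms(3)] assms(3)] by simp
  then show "inner_h P D s w v = 0" using ih.sym[OF assms(3,2)] by simp
qed

lemma component_lincomb: "(\<lambda>x. (r *\<^sub>R \<sigma> + t *\<^sub>R \<tau>) x $ j) = r *\<^sub>R (\<lambda>x. \<sigma> x $ j) + t *\<^sub>R (\<lambda>x. \<tau> x $ j)"
  by (simp add: fun_eq_iff)

lemma component_L2: "(\<sigma>::vfun) \<in> L2 U \<Longrightarrow> (\<lambda>x. \<sigma> x $ j) \<in> L2 U"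
  using L2_vec_iff by blast

lemma vinner_h_semi_inner: "semi_inner (L2 (Oms P s)) (vinner_h P D s)"
proof
  show "subspace (L2 (Oms P s) :: vfun set)" by (rule subspace_L2)
  fix z :: vfun assume z: "z \<in> L2 (Oms P s)"
  have "lin_on (L2 (Oms P s)) (\<lambda>x. inner_h P D s (\<lambda>y. x y $ j) (\<lambda>y. z y $ j))" for j
    unfolding lin_on_def component_lincomb
    using lin_onD[OF ih.lin[OF component_L2[OF z]]] component_L2 by blast
  then show "lin_on (L2 (Oms P s)) (\<lambda>x. vinner_h P D s x z)"
    unfolding vinner_h_def by (intro lin_on_setsum) auto
next
  fix x y :: vfun assume "x \<in> L2 (Oms P s)" "y \<in> L2 (Oms P s)"
  then show "vinner_h P D s x y = vinner_h P D s y x"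
    unfolding vinner_h_def by (intro sum.cong refl ih.sym component_L2)
next
  fix x :: vfun assume "x \<in> L2 (Oms P s)"
  then show "0 \<le> vinner_h P D s x x"
    unfolding vinner_h_def by (intro sum_nonneg ih.nonneg component_L2)
qed

sublocale vh: semi_inner "L2 (Oms P s)" "vinner_h P D s" for s
  by (rule vinner_h_semi_inner)

lemma vinner_h_cong:
  assumes "ae_eq (Oms P s) v v'" "v \<in> L2 (Oms P s)" "v' \<in> L2 (Oms P s)" "w \<in> L2 (Oms P s)"
  shows "vinner_h P D s v w = vinner_h P D s v' w"
  unfolding vinner_h_def
  by (intro sum.cong refl inner_h_cong ae_eq_component component_L2 assms)

lemma vinner_h_ae_0:
  assumes "ae_eq (Oms P s) v 0" "v \<in> L2 (Oms P s)" "w \<in> L2 (Oms P s)"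
  shows "vinner_h P D s v w = 0" "vinner_h P D s w v = 0"
proof -
  show "vinner_h P D s v w = 0"
    using vinner_h_cong[OF assms(1,2) zero_L2 assms(3)] lin_on_0[OF vh.lin[OF assms(3)] assms(3)] by simp
  then show "vinner_h P D s w v = 0" using vh.sym[OF assms(3,2)] by simp
qed

text \<open>Exact linearity, although \<open>grad\<close> is linear only almost everywhere, because
  the quadrature respects equality almost everywhere.\<close>

lemma lin_on_vinner_grad:
  assumes "z \<in> L2 (Oms P s)"
  shows "lin_on (H1 (Oms P s)) (\<lambda>u. vinner_h P D s (grad (Oms P s) u) z)"
  unfolding lin_on_def
proof (intro ballI allI)
  fix u v r t assume uv: "u \<in> H1 (Oms P s)" "v \<in> H1 (Oms P s)"
  let ?g = "grad (Oms P s)"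
  have "vinner_h P D s (?g (r *\<^sub>R u + t *\<^sub>R v)) z = vinner_h P D s (r *\<^sub>R ?g u + t *\<^sub>R ?g v) z"
    by (intro vinner_h_cong H1_lincomb grad_H1 subspace_lincomb[OF subspace_L2] uv assms Oms_open Oms_bounded)
  also have "\<dots> = r * vinner_h P D s (?g u) z + t * vinner_h P D s (?g v) z"
    by (intro lin_onD[OF vh.lin[OF assms]] grad_H1 uv)
  finally show "vinner_h P D s (?g (r *\<^sub>R u + t *\<^sub>R v)) z
      = r * vinner_h P D s (?g u) z + t * vinner_h P D s (?g v) z" .
qed

lemma lin_on_inner_dvg:
  assumes "z \<in> L2 (Oms P s)"
  shows "lin_on (Hdiv (Oms P s)) (\<lambda>u. inner_h P D s (dvg (Oms P s) u) z)"
  unfolding lin_on_def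
proof (intro ballI allI)
  fix u v r t assume uv: "u \<in> Hdiv (Oms P s)" "v \<in> Hdiv (Oms P s)"
  let ?g = "dvg (Oms P s)"
  have "inner_h P D s (?g (r *\<^sub>R u + t *\<^sub>R v)) z = inner_h P D s (r *\<^sub>R ?g u + t *\<^sub>R ?g v) z"
    by (intro inner_h_cong Hdiv_lincomb dvg_Hdiv subspace_lincomb[OF subspace_L2] uv assms Oms_open Oms_bounded)
  also have "\<dots> = r * inner_h P D s (?g u) z + t * inner_h P D s (?g v) z"
    by (intro lin_onD[OF ih.lin[OF assms]] dvg_Hdiv uv)
  finally show "inner_h P D s (?g (r *\<^sub>R u + t *\<^sub>R v)) z
      = r * inner_h P D s (?g u) z + t * inner_h P D s (?g v) z" .
qed

lemmas grad_L2 = grad_H1(1) and dvg_L2 = dvg_Hdiv(1)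

lemma subspace_Hdiv_m: "subspace (Hdiv \<Omega>m)" and subspace_H1_p: "subspace (H1 \<Omega>p)"
  by (intro subspace_Hdiv subspace_H1 Oms_open Oms_bounded)+

lemma lin_on_b_h:
  shows "w \<in> L2 \<Omega>m \<Longrightarrow> lin_on (Hdiv \<Omega>m) (b_h P D w)"
    and "\<tau> \<in> Hdiv \<Omega>m \<Longrightarrow> lin_on (L2 \<Omega>m) (\<lambda>w. b_h P D w \<tau>)"
  unfolding b_h_def by (intro lin_on_inner_dvg ih.lin_right dvg_L2; assumption)+

lemma lin_on_pairG_h:
  shows "v \<in> H1 \<Omega>p \<Longrightarrow> lin_on (Hdiv \<Omega>m) (\<lambda>\<tau>. pairG_h P D \<tau> v)"
    and "\<tau> \<in> Hdiv \<Omega>m \<Longrightarrow> lin_on (H1 \<Omega>p) (pairG_h P D \<tau>)"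
  unfolding pairG_h_def[abs_def]
  using bilinear_on_lin[OF element_props(4)] by (auto intro!: lin_on_setsum)

lemma pairG_h_ae_0:
  assumes "\<tau> \<in> Hdiv \<Omega>m" "v \<in> H1 \<Omega>p"
  shows "ae_eq \<Omega>m \<tau> 0 \<Longrightarrow> pairG_h P D \<tau> v = 0" and "ae_eq \<Omega>p v 0 \<Longrightarrow> pairG_h P D \<tau> v = 0"
proof -
  assume a: "ae_eq \<Omega>m \<tau> 0"
  have "pairG_h P D \<tau> v = pairG_h P D 0 v"
    unfolding pairG_h_def
    by (intro sum.cong refl element_props(5)) (auto simp: assms a subspace_0 subspace_Hdiv_m)
  then show "pairG_h P D \<tau> v = 0" using lin_on_0[OF lin_on_pairG_h(1)[OF assms(2)] assms(1)] by simp
next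
  assume a: "ae_eq \<Omega>p v 0"
  have "pairG_h P D \<tau> v = pairG_h P D \<tau> 0"
    unfolding pairG_h_def
    by (intro sum.cong refl element_props(5)) (auto simp: assms a subspace_0[OF subspace_H1_p])
  then show "pairG_h P D \<tau> v = 0" using lin_on_0[OF lin_on_pairG_h(2)[OF assms(1)] assms(2)] by simp
qed

lemma a_h_eq:
  assumes "u \<in> H1 \<Omega>p" "v \<in> H1 \<Omega>p"
  shows "a_h P D \<sigma> u \<tau> v = 1 / beta P Minus * vinner_h P D Minus \<sigma> \<tau> +
    beta P Plus * vinner_h P D Plus (grad \<Omega>p u) (grad \<Omega>p v) + pairG_h P D \<sigma> v - pairG_h P D \<tau> u"
proof -
  have "vinner_h P D Plus (\<lambda>x. beta P Plus *\<^sub>R grad \<Omega>p u x) (grad \<Omega>p v)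
      = beta P Plus * vinner_h P D Plus (grad \<Omega>p u) (grad \<Omega>p v)"
    using lin_on_scale[OF vh.lin[OF grad_L2[OF assms(2)]] grad_L2[OF assms(1)], of "beta P Plus"]
    by (simp add: scaleR_fun_def)
  then show ?thesis by (simp add: a_h_def)
qed

abbreviation "HH \<equiv> Hdiv \<Omega>m \<times> H1 \<Omega>p"

lemma subspace_HH: "subspace HH"
  by (intro subspace_Times subspace_Hdiv_m subspace_H1_p)

lemma lin_on_a_h_left:
  assumes "\<tau> \<in> Hdiv \<Omega>m" "v \<in> H1 \<Omega>p"
  shows "lin_on HH (\<lambda>x. a_h P D (fst x) (snd x) \<tau> v)"
proof (rule lin_on_cong[OF _ subspace_HH])
  show "a_h P D (fst x) (snd x) \<tau> v = 1 / beta P Minus * vinner_h P D Minus (fst x) \<tau> +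
    beta P Plus * vinner_h P D Plus (grad \<Omega>p (snd x)) (grad \<Omega>p v) + pairG_h P D (fst x) v - pairG_h P D \<tau> (snd x)"
    if "x \<in> HH" for x
    using that by (intro a_h_eq assms) auto
  have "lin_on (Hdiv \<Omega>m) (\<lambda>\<sigma>. vinner_h P D Minus \<sigma> \<tau>)"
    by (rule lin_on_subset[OF vh.lin]) (use assms Hdiv_L2 in auto)
  then show "lin_on HH (\<lambda>x. 1 / beta P Minus * vinner_h P D Minus (fst x) \<tau> +
    beta P Plus * vinner_h P D Plus (grad \<Omega>p (snd x)) (grad \<Omega>p v) + pairG_h P D (fst x) v - pairG_h P D \<tau> (snd x))"
    by (intro lin_on_plus lin_on_minus lin_on_times lin_on_fst lin_on_fst[OF lin_on_pairG_h(1)]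
        lin_on_snd[OF lin_on_pairG_h(2)] lin_on_snd[OF lin_on_vinner_grad] grad_L2 assms)
qed

text \<open>Symmetry of the volume terms moves the test functions to the first argument, where
  linearity is available.\<close>

lemma lin_on_a_h_right:
  assumes "\<sigma> \<in> Hdiv \<Omega>m" "u \<in> H1 \<Omega>p"
  shows "lin_on HH (\<lambda>y. a_h P D \<sigma> u (fst y) (snd y))"
proof (rule lin_on_cong[OF _ subspace_HH])
  show "a_h P D \<sigma> u (fst x) (snd x) = 1 / beta P Minus * vinner_h P D Minus (fst x) \<sigma> +
    beta P Plus * vinner_h P D Plus (grad \<Omega>p (snd x)) (grad \<Omega>p u) + pairG_h P D \<sigma> (snd x) - pairG_h P D (fst x) u"
    if "x \<in> HH" for x
    using that a_h_eq[OF assms(2), of "snd x" \<sigma> "fst x"] vh.sym[of \<sigma> Minus "fst x"]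
      vh.sym[of "grad \<Omega>p u" Plus "grad \<Omega>p (snd x)"] assms Hdiv_L2 grad_L2 by auto
  have "lin_on (Hdiv \<Omega>m) (\<lambda>\<tau>. vinner_h P D Minus \<tau> \<sigma>)"
    by (rule lin_on_subset[OF vh.lin]) (use assms Hdiv_L2 in auto)
  then show "lin_on HH (\<lambda>x. 1 / beta P Minus * vinner_h P D Minus (fst x) \<sigma> +
    beta P Plus * vinner_h P D Plus (grad \<Omega>p (snd x)) (grad \<Omega>p u) + pairG_h P D \<sigma> (snd x) - pairG_h P D (fst x) u)"
    by (intro lin_on_plus lin_on_minus lin_on_times lin_on_fst lin_on_fst[OF lin_on_pairG_h(1)]
        lin_on_snd[OF lin_on_pairG_h(2)] lin_on_snd[OF lin_on_vinner_grad] grad_L2 assms)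
qed

lemma a_h_ae_0:
  assumes "\<sigma> \<in> Hdiv \<Omega>m" "u \<in> H1 \<Omega>p" "\<tau> \<in> Hdiv \<Omega>m" "v \<in> H1 \<Omega>p" "ae_eq \<Omega>m \<tau> 0" "ae_eq \<Omega>p v 0"
  shows "a_h P D \<sigma> u \<tau> v = 0"
  using assms grad_ae_0[OF Oms_open Oms_bounded assms(4,6)]
  by (simp add: a_h_eq vinner_h_ae_0 pairG_h_ae_0 Hdiv_L2 grad_L2)

lemma b_h_ae_0:
  assumes "\<tau> \<in> Hdiv \<Omega>m" "w \<in> L2 \<Omega>m"
  shows "ae_eq \<Omega>m \<tau> 0 \<Longrightarrow> b_h P D w \<tau> = 0" and "ae_eq \<Omega>m w 0 \<Longrightarrow> b_h P D w \<tau> = 0"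
  unfolding b_h_def
  by (simp_all add: inner_h_ae_0 dvg_L2 assms dvg_ae_0[OF Oms_open Oms_bounded])

text \<open>The polarised square of \<open>norm1_h\<close>. As a semi-inner product on all of
  \<open>HH\<close> it gives the triangle inequality also for errors of the exact solution.\<close>

definition n1 :: "vfun \<times> sfun \<Rightarrow> vfun \<times> sfun \<Rightarrow> real" where
  "n1 x y = 1 / beta P Minus * vinner_h P D Minus (fst x) (fst y)
     + inner_h P D Minus (dvg \<Omega>m (fst x)) (dvg \<Omega>m (fst y))
     + beta P Plus * vinner_h P D Plus (grad \<Omega>p (snd x)) (grad \<Omega>p (snd y))"

sublocale n1: semi_inner HH n1
proof
  show "subspace HH" by (rule subspace_HH)
  fix z assume z: "z \<in> HH"
  have "lin_on (Hdiv \<Omega>m) (\<lambda>\<tau>. vinner_h P D Minus \<tau> (fst z))"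
    by (rule lin_on_subset[OF vh.lin]) (use z Hdiv_L2 in auto)
  then show "lin_on HH (\<lambda>x. n1 x z)"
    unfolding n1_def using z
    by (intro lin_on_plus lin_on_times lin_on_fst lin_on_fst[OF lin_on_inner_dvg]
         lin_on_snd[OF lin_on_vinner_grad] grad_L2 dvg_L2) auto
next
  fix x y assume "x \<in> HH" "y \<in> HH"
  then show "n1 x y = n1 y x"
    unfolding n1_def by (auto simp: vh.sym ih.sym Hdiv_L2 dvg_L2 grad_L2)
next
  fix x assume "x \<in> HH"
  then show "0 \<le> n1 x x"
    unfolding n1_def using beta_pos
    by (intro add_nonneg_nonneg mult_nonneg_nonneg vh.nonneg ih.nonneg Hdiv_L2 dvg_L2 grad_L2)
      (auto simp: less_imp_le)
qed

lemma norm1_h_eq: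
  assumes "(\<tau>, v) \<in> HH"
  shows "norm1_h P D \<tau> v = sqrt (n1 (\<tau>, v) (\<tau>, v))"
  using assms unfolding norm1_h_def n1_def vnorm_h_def norm_h_def
  by (auto simp: vh.nonneg ih.nonneg Hdiv_L2 dvg_L2 grad_L2)

lemma norm1_h_nonneg: "(\<tau>, v) \<in> HH \<Longrightarrow> 0 \<le> norm1_h P D \<tau> v"
  using norm1_h_eq n1.nonneg by simp

lemma norm0_h_nonneg: "w \<in> L2 \<Omega>m \<Longrightarrow> 0 \<le> norm0_h P D w"
  using ih.nonneg by (simp add: norm_h_def)

lemma norm1_h_square:
  assumes "(\<tau>, v) \<in> HH"
  shows "(norm1_h P D \<tau> v)\<^sup>2 = a_h P D \<tau> v \<tau> v + (norm0_h P D (dvg \<Omega>m \<tau>))\<^sup>2"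
proof -
  have "(norm1_h P D \<tau> v)\<^sup>2 = n1 (\<tau>, v) (\<tau>, v)"
    using norm1_h_eq[OF assms] n1.nonneg[OF assms] by simp
  moreover have "(norm0_h P D (dvg \<Omega>m \<tau>))\<^sup>2 = inner_h P D Minus (dvg \<Omega>m \<tau>) (dvg \<Omega>m \<tau>)"
    using assms by (auto simp: norm_h_def ih.nonneg dvg_L2)
  ultimately show ?thesis
    using assms a_h_eq[of v v \<tau> \<tau>] by (auto simp: n1_def)
qed

lemma norm_dvg_le_norm1_h:
  assumes "(\<tau>, v) \<in> HH"
  shows "norm0_h P D (dvg \<Omega>m \<tau>) \<le> norm1_h P D \<tau> v"
proof -
  have "inner_h P D Minus (dvg \<Omega>m \<tau>) (dvg \<Omega>m \<tau>) \<le> n1 (\<tau>, v) (\<tau>, v)"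
    unfolding n1_def using assms beta_pos[of Minus] beta_pos[of Plus]
      vh.nonneg[of \<tau> Minus] vh.nonneg[of "grad \<Omega>p v" Plus]
    by (simp add: Hdiv_L2 grad_L2)
  then show ?thesis unfolding norm1_h_eq[OF assms] by (simp add: norm_h_def)
qed

text \<open>The divergence is part of \<open>norm1_h\<close>, so Cauchy-Schwarz gives constant 1.
  The bound is not confined to discrete functions, and the error estimate applies it to
  approximation errors.\<close>

lemma b_h_bound:
  assumes "(\<tau>, v) \<in> HH" "w \<in> L2 \<Omega>m"
  shows "\<bar>b_h P D w \<tau>\<bar> \<le> norm0_h P D w * norm1_h P D \<tau> v"
proof -
  have "\<bar>b_h P D w \<tau>\<bar> \<le> norm0_h P D (dvg \<Omega>m \<tau>) * norm0_h P D w"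
    unfolding b_h_def norm_h_def by (rule ih.cauchy_schwarz) (use assms dvg_L2 in auto)
  also have "\<dots> \<le> norm1_h P D \<tau> v * norm0_h P D w"
    by (intro mult_right_mono norm_dvg_le_norm1_h assms norm0_h_nonneg)
  finally show ?thesis by (simp add: mult.commute)
qed

section \<open>The discrete spaces\<close>

lemma Q_h_eq: "Q_h P D = Hdiv \<Omega>m \<inter> piecewise (mesh_side P D Minus) \<Omega>m (Ssig D)"
  and Vm_h_eq: "Vm_h P D = L2 \<Omega>m \<inter> piecewise (mesh_side P D Minus) \<Omega>m (Su D Minus)"
  and Vp_h_eq: "Vp_h P D g = {v \<in> H1 \<Omega>p \<inter> piecewise (mesh_side P D Plus) \<Omega>p (Su D Plus).
    has_trace \<Omega>p (outer P Plus) v g}"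
  by (auto simp: Q_h_def Vm_h_def Vp_h_def piecewise_def)

lemma finite_dim_mesh_side:
  assumes "K \<in> mesh_side P D s"
  shows "finite_dim_space (Su D s' K)" "finite_dim_space (Ssig D K)"
  using element_props assms mesh_side_subset by blast+

lemma Q_h_Hdiv: "\<tau> \<in> Q_h P D \<Longrightarrow> \<tau> \<in> Hdiv \<Omega>m"
  and Vm_h_L2: "w \<in> Vm_h P D \<Longrightarrow> w \<in> L2 \<Omega>m"
  and Vp_h_H1: "v \<in> Vp_h P D g \<Longrightarrow> v \<in> H1 \<Omega>p"
  by (simp_all add: Q_h_eq Vm_h_eq Vp_h_eq)

lemma subspace_Q_h: "subspace (Q_h P D)"
  unfolding Q_h_eq
  by (intro subspace_inter subspace_Hdiv_m subspaceI_lincomb[of "piecewise _ _ _"] piecewise_0 piecewise_lincomb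
      finite_dim_mesh_side)

lemma subspace_Vm_h: "subspace (Vm_h P D)"
  unfolding Vm_h_eq
  by (intro subspace_inter subspace_L2 subspaceI_lincomb[of "piecewise _ _ _"] piecewise_0 piecewise_lincomb
      finite_dim_mesh_side)

text \<open>Carrying the boundary datum along lets one statement serve the homogeneous subspace, the
  difference of two elements with equal datum, and the sum of a lift and a correction.\<close>

lemma Vp_h_lincomb:
  assumes "v \<in> Vp_h P D p" "w \<in> Vp_h P D q"
  shows "r *\<^sub>R v + s *\<^sub>R w \<in> Vp_h P D (r *\<^sub>R p + s *\<^sub>R q)"
proof -
  have "r *\<^sub>R v + s *\<^sub>R w \<in> H1 \<Omega>p"
    using assms by (intro subspace_lincomb[OF subspace_H1_p]) (auto dest: Vp_h_H1)
  moreover have "r *\<^sub>R v + s *\<^sub>R w \<in> piecewise (mesh_side P D Plus) \<Omega>p (Su D Plus)"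
    using assms unfolding Vp_h_eq by (intro piecewise_lincomb finite_dim_mesh_side) auto
  moreover have "has_trace \<Omega>p (outer P Plus) (r *\<^sub>R v + s *\<^sub>R w) (r *\<^sub>R p + s *\<^sub>R q)"
    using assms unfolding Vp_h_eq by (intro has_trace_lincomb Oms_open Oms_bounded) auto
  ultimately show ?thesis unfolding Vp_h_eq by blast
qed

lemma zero_Vp0_h: "0 \<in> Vp0_h P D"
  unfolding Vp_h_eq
  using subspace_0[OF subspace_H1_p] piecewise_0[of "mesh_side P D Plus" "Su D Plus" \<Omega>p] finite_dim_mesh_side(1)
    has_trace_0[OF Oms_open Oms_bounded]
  by (simp add: zero_fun_def)

lemma subspace_Vp0_h: "subspace (Vp0_h P D)"
proof (rule subspaceI_lincomb[OF zero_Vp0_h])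
  fix v w r s assume "v \<in> Vp0_h P D" "w \<in> Vp0_h P D"
  then have "r *\<^sub>R v + s *\<^sub>R w \<in> Vp_h P D (r *\<^sub>R (\<lambda>x. 0) + s *\<^sub>R (\<lambda>x. 0))"
    by (rule Vp_h_lincomb)
  then show "r *\<^sub>R v + s *\<^sub>R w \<in> Vp0_h P D" by (simp add: plus_fun_def scaleR_fun_def)
qed

lemma Vp_h_diff: "v \<in> Vp_h P D g \<Longrightarrow> w \<in> Vp_h P D g \<Longrightarrow> v - w \<in> Vp0_h P D"
  using Vp_h_lincomb[of v g w g 1 "-1"] by (simp add: zero_fun_def)

lemma Vp_h_add: "v \<in> Vp_h P D g \<Longrightarrow> w \<in> Vp0_h P D \<Longrightarrow> v + w \<in> Vp_h P D g"
  using Vp_h_lincomb[of v g w "\<lambda>x. 0" 1 1] by (simp add: plus_fun_def)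

end

section \<open>Stability, existence and error estimate\<close>

text \<open>With c = 2 + C / \<alpha> + 1 / \<alpha> this is (c + 1) + (1 + C * (c + 1)) / \<alpha>:
  the first summand bounds the flux and the primal variable, the second the multiplier through the
  inf-sup condition.\<close>

definition stability_constant :: "real \<Rightarrow> real \<Rightarrow> real" where
  "stability_constant C \<alpha> = (3 + C / \<alpha> + 1 / \<alpha>) + (1 + C * (3 + C / \<alpha> + 1 / \<alpha>)) / \<alpha>"

lemma stability_constant_pos: "C > 0 \<Longrightarrow> \<alpha> > 0 \<Longrightarrow> stability_constant C \<alpha> > 0"
  unfolding stability_constant_def
  by (intro add_pos_nonneg divide_nonneg_pos add_nonneg_nonneg mult_nonneg_nonneg) auto

text \<open>If \<open>n\<close> exceeded (c + 1) M, then c M \<le> n would turn c M^2 into at most M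
  n, and the right-hand side would fall below n^2.\<close>

lemma quadratic_bound:
  fixes n c M :: real
  assumes "0 \<le> n" "0 \<le> M" "0 \<le> c" "n\<^sup>2 \<le> c * M * n + c * M\<^sup>2"
  shows "n \<le> (c + 1) * M"
proof (rule ccontr)
  assume "\<not> n \<le> (c + 1) * M"
  then have n: "(c + 1) * M < n" by simp
  have "c * M \<le> n" using n assms by (simp add: distrib_right)
  then have "c * M * M \<le> n * M" using assms(2) by (rule mult_right_mono)
  then have "c * M * n + c * M\<^sup>2 \<le> (c + 1) * M * n"
    by (simp add: power2_eq_square algebra_simps)
  also have "\<dots> < n * n"
    using n assms mult_nonneg_nonneg[of "c + 1" M] by (intro mult_strict_right_mono) linarith+
  finally show False using assms(4) by (simp add: power2_eq_square)
qed

text \<open>A single mesh with the constants as parameters. Bounds proved here depend on the mesh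
  only through \<open>C\<close> and \<alpha>, so interpreting the locale with the same two numbers
  for every mesh makes them uniform.\<close>

locale stable_discretization = discrete_interface_problem P D for P D +
  fixes C \<alpha> :: real
  assumes C: "C > 0" and \<alpha>: "\<alpha> > 0"
    and definite: "seminorm_definite P"
    and Vm_l2_le: "w \<in> Vm_h P D \<Longrightarrow> l2_norm \<Omega>m w \<le> C * norm0_h P D w"
    and Q_l2_le: "\<tau> \<in> Q_h P D \<Longrightarrow> l2_norm \<Omega>m \<tau> \<le> C * vnorm_h P D Minus \<tau>"
    and grad_l2_le: "v \<in> Vp0_h P D \<Longrightarrow> l2_norm \<Omega>p (grad \<Omega>p v) \<le> C * vnorm_h P D Plus (grad \<Omega>p v)"
    and a_h_bound: "\<sigma> \<in> Q_h P D \<Longrightarrow> u \<in> Vp0_h P D \<Longrightarrow> \<tau> \<in> Q_h P D \<Longrightarrow> v \<in> Vp0_h P D \<Longrightarrow>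
      \<bar>a_h P D \<sigma> u \<tau> v\<bar> \<le> C * (norm1_h P D \<sigma> u * norm1_h P D \<tau> v)"
    and inf_sup: "ereal \<alpha> \<le> (INF w\<in>{w \<in> Vm_h P D. \<not> ae_eq \<Omega>m w (\<lambda>x. 0)}.
      SUP (\<tau>, v)\<in>Q_h P D \<times> Vp0_h P D. ereal (b_h P D w \<tau> / (norm1_h P D \<tau> v * norm0_h P D w)))"
    and dvg_Vm_h: "\<tau> \<in> Q_h P D \<Longrightarrow> dvg \<Omega>m \<tau> \<in> Vm_h P D"
begin

lemma QV_HH: "\<tau> \<in> Q_h P D \<Longrightarrow> v \<in> Vp_h P D g \<Longrightarrow> (\<tau>, v) \<in> HH"
  using Q_h_Hdiv Vp_h_H1 by blast

text \<open>For \<open>p\<close> not null, \<alpha> lies below a supremum of quotients that are all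
  at most \<open>R\<close> divided by the norm of \<open>p\<close>. A null \<open>p\<close> is
  outside the infimum, but its discrete norm is 0.\<close>

lemma inf_sup_bound:
  assumes p: "p \<in> Vm_h P D" and R: "0 \<le> R"
    and b: "\<And>\<tau> v. \<tau> \<in> Q_h P D \<Longrightarrow> v \<in> Vp0_h P D \<Longrightarrow> b_h P D p \<tau> \<le> R * norm1_h P D \<tau> v"
  shows "\<alpha> * norm0_h P D p \<le> R"
proof (cases "ae_eq \<Omega>m p 0")
  case True
  then show ?thesis using inner_h_ae_0[of Minus p p] Vm_h_L2[OF p] R by (simp add: norm_h_def)
next
  case False
  have n0: "0 \<le> norm0_h P D p" by (rule norm0_h_nonneg[OF Vm_h_L2[OF p]])
  have "ereal \<alpha> \<le> (SUP (\<tau>, v)\<in>Q_h P D \<times> Vp0_h P D.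
      ereal (b_h P D p \<tau> / (norm1_h P D \<tau> v * norm0_h P D p)))"
    by (rule order_trans[OF inf_sup INF_lower]) (use p False in \<open>simp add: zero_fun_def\<close>)
  also have "\<dots> \<le> ereal (R / norm0_h P D p)"
  proof (rule SUP_least, clarify)
    fix \<tau> v assume tv: "\<tau> \<in> Q_h P D" "v \<in> Vp0_h P D"
    have n: "0 \<le> norm1_h P D \<tau> v" by (rule norm1_h_nonneg[OF QV_HH[OF tv]])
    \<comment> \<open>A test pair of norm 0 contributes the quotient 0, which is harmless because
      \<open>R\<close> is nonnegative.\<close>
    have "b_h P D p \<tau> / norm1_h P D \<tau> v \<le> R"
      using b[OF tv] n R by (cases "norm1_h P D \<tau> v = 0") (auto simp: divide_le_eq)
    then have "b_h P D p \<tau> / norm1_h P D \<tau> v / norm0_h P D p \<le> R / norm0_h P D p"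
      by (rule divide_right_mono[OF _ n0])
    then show "ereal (b_h P D p \<tau> / (norm1_h P D \<tau> v * norm0_h P D p)) \<le> ereal (R / norm0_h P D p)"
      by simp
  qed
  finally have "\<alpha> \<le> R / norm0_h P D p" by simp
  then show ?thesis using n0 R by (cases "norm0_h P D p = 0") (auto simp: le_divide_eq)
qed

lemma saddle_point_stability:
  assumes \<sigma>: "\<sigma> \<in> Q_h P D" and u: "u \<in> Vp0_h P D" and p: "p \<in> Vm_h P D"
    and F0: "0 \<le> F" and G0: "0 \<le> G"
    and F: "\<And>\<tau> v. \<tau> \<in> Q_h P D \<Longrightarrow> v \<in> Vp0_h P D \<Longrightarrow>
      \<bar>a_h P D \<sigma> u \<tau> v + b_h P D p \<tau>\<bar> \<le> F * norm1_h P D \<tau> v"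
    and G: "\<And>w. w \<in> Vm_h P D \<Longrightarrow> \<bar>b_h P D w \<sigma>\<bar> \<le> G * norm0_h P D w"
  shows "norm1_h P D \<sigma> u + norm0_h P D p \<le> stability_constant C \<alpha> * (F + G)"
proof -
  define n d q M where "n = norm1_h P D \<sigma> u" and "d = norm0_h P D (dvg \<Omega>m \<sigma>)" and "q = norm0_h P D p"
    and "M = F + G"
  note HH = QV_HH[OF \<sigma> u]
  have nn: "0 \<le> n" "0 \<le> d" "0 \<le> q" "0 \<le> M"
    using norm1_h_nonneg[OF HH] norm0_h_nonneg Vm_h_L2 dvg_Vm_h[OF \<sigma>] p F0 G0
    by (auto simp: n_def d_def q_def M_def)
  have "d\<^sup>2 = b_h P D (dvg \<Omega>m \<sigma>) \<sigma>"
    using ih.nonneg[of "dvg \<Omega>m \<sigma>" Minus] Vm_h_L2[OF dvg_Vm_h[OF \<sigma>]]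
    by (simp add: d_def norm_h_def b_h_def)
  also have "\<dots> \<le> G * d" using G[OF dvg_Vm_h[OF \<sigma>]] by (simp add: d_def)
  finally have d: "d \<le> G"
    using nn G0 by (cases "d = 0") (auto simp: power2_eq_square)
  \<comment> \<open>Here \<open>b_h\<close> is written as the residual of the first equation minus
    \<open>a_h\<close>; the residual is bounded through \<open>F\<close>, the other part by
    continuity of \<open>a_h\<close>.\<close>
  have "\<alpha> * q \<le> F + C * n"
    unfolding q_def
  proof (rule inf_sup_bound[OF p])
    show "0 \<le> F + C * n" using F0 C nn by simp
    fix \<tau> v assume tv: "\<tau> \<in> Q_h P D" "v \<in> Vp0_h P D"
    show "b_h P D p \<tau> \<le> (F + C * n) * norm1_h P D \<tau> v"
      using F[OF tv] a_h_bound[OF \<sigma> u tv] by (simp add: n_def distrib_right mult.assoc)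
  qed
  then have q: "q \<le> (F + C * n) / \<alpha>" using \<alpha> by (simp add: field_simps)
  have M: "F \<le> M" "G \<le> M" using F0 G0 by (auto simp: M_def)
  \<comment> \<open>Dominates both coefficients, 1 + C / \<alpha> and 1 + 1 / \<alpha>, of the
    quadratic inequality below.\<close>
  define c where "c = 2 + C / \<alpha> + 1 / \<alpha>"
  have c0: "0 \<le> c" using C \<alpha> by (simp add: c_def)
  have "n\<^sup>2 = a_h P D \<sigma> u \<sigma> u + d\<^sup>2"
    unfolding n_def d_def by (rule norm1_h_square[OF HH])
  \<comment> \<open>\<open>b_h P D p \<sigma>\<close> is added and subtracted: the first residual is
    tested with the unknowns themselves, the second with \<open>p\<close>.\<close>
  also have "\<dots> \<le> F * n + G * q + d\<^sup>2"
    using F[OF \<sigma> u] G[OF p] by (simp add: n_def q_def)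
  also have "\<dots> \<le> M * n + M * ((M + C * n) / \<alpha>) + M\<^sup>2"
  proof (intro add_mono mult_mono power_mono M nn order_refl)
    show "q \<le> (M + C * n) / \<alpha>" using q M \<alpha> by (simp add: field_simps)
    show "d \<le> M" using d M by simp
  qed
  also have "\<dots> = (1 + C / \<alpha>) * (M * n) + (1 + 1 / \<alpha>) * M\<^sup>2"
    using \<alpha> by (simp add: field_simps power2_eq_square)
  also have "\<dots> \<le> c * (M * n) + c * M\<^sup>2"
    using C \<alpha> nn by (intro add_mono mult_right_mono) (auto simp: c_def)
  finally have "n \<le> (c + 1) * M"
    by (intro quadratic_bound nn c0) (simp add: mult.assoc)
  moreover have "q \<le> (1 + C * (c + 1)) / \<alpha> * M"
  proof -
    have "q \<le> (F + C * n) / \<alpha>" by (rule q)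
    also have "\<dots> \<le> (M + C * ((c + 1) * M)) / \<alpha>"
      using M \<open>n \<le> (c + 1) * M\<close> C \<alpha> by (intro divide_right_mono add_mono mult_left_mono) auto
    finally show ?thesis by (simp add: algebra_simps)
  qed
  ultimately have "n + q \<le> ((c + 1) + (1 + C * (c + 1)) / \<alpha>) * M"
    by (simp add: distrib_right)
  also have "(c + 1) + (1 + C * (c + 1)) / \<alpha> = stability_constant C \<alpha>"
    by (simp add: stability_constant_def c_def)
  finally show ?thesis by (simp add: n_def q_def M_def)
qed

text \<open>Each nonnegative summand vanishes, and the norm comparison on discrete functions carries
  this over to L2. For \<open>v\<close> only the gradient is reached;
  \<open>seminorm_definite\<close> gives \<open>v\<close> itself.\<close>

lemma norm1_h_eq_0_imp_ae:
  assumes \<tau>: "\<tau> \<in> Q_h P D" and v: "v \<in> Vp0_h P D" and 0: "norm1_h P D \<tau> v = 0"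
  shows "ae_eq \<Omega>m \<tau> 0" "ae_eq \<Omega>p v 0"
proof -
  note HH = QV_HH[OF \<tau> v]
  have L: "\<tau> \<in> L2 \<Omega>m" "dvg \<Omega>m \<tau> \<in> L2 \<Omega>m" "grad \<Omega>p v \<in> L2 \<Omega>p"
    using HH Hdiv_L2 dvg_L2 grad_L2 by auto
  have "n1 (\<tau>, v) (\<tau>, v) = 0" using 0 norm1_h_eq[OF HH] by simp
  moreover have "0 \<le> 1 / beta P Minus * vinner_h P D Minus \<tau> \<tau>"
    "0 \<le> beta P Plus * vinner_h P D Plus (grad \<Omega>p v) (grad \<Omega>p v)"
    using vh.nonneg[OF L(1)] vh.nonneg[OF L(3)] beta_pos[of Minus] beta_pos[of Plus] by auto
  ultimately have "1 / beta P Minus * vinner_h P D Minus \<tau> \<tau> = 0"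
    "beta P Plus * vinner_h P D Plus (grad \<Omega>p v) (grad \<Omega>p v) = 0"
    using ih.nonneg[OF L(2)] by (simp_all only: n1_def fst_conv snd_conv)
  then have "vnorm_h P D Minus \<tau> = 0" "vnorm_h P D Plus (grad \<Omega>p v) = 0"
    using beta_pos[of Minus] beta_pos[of Plus] by (auto simp: vnorm_h_def)
  then have "l2_norm \<Omega>m \<tau> = 0" "l2_norm \<Omega>p (grad \<Omega>p v) = 0"
    using Q_l2_le[OF \<tau>] grad_l2_le[OF v] l2_norm_nonneg[of \<Omega>m \<tau>] l2_norm_nonneg[of \<Omega>p "grad \<Omega>p v"] by auto
  then have "ae_eq \<Omega>m \<tau> 0" and g: "ae_eq \<Omega>p (grad \<Omega>p v) 0"
    using l2_norm_eq_0_imp_ae L by blast+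
  then show "ae_eq \<Omega>m \<tau> 0" by simp
  have "v \<in> V_plus P (\<lambda>x. 0)" using v by (simp add: V_plus_def Vp_h_def)
  then show "ae_eq \<Omega>p v 0" using definite g by (simp add: seminorm_definite_def zero_fun_def)
qed

lemma homogeneous_solution_ae_0:
  assumes \<sigma>: "\<sigma> \<in> Q_h P D" and u: "u \<in> Vp0_h P D" and p: "p \<in> Vm_h P D"
    and F: "\<And>\<tau> v. \<tau> \<in> Q_h P D \<Longrightarrow> v \<in> Vp0_h P D \<Longrightarrow> a_h P D \<sigma> u \<tau> v + b_h P D p \<tau> = 0"
    and G: "\<And>w. w \<in> Vm_h P D \<Longrightarrow> b_h P D w \<sigma> = 0"
  shows "ae_eq \<Omega>m \<sigma> 0" "ae_eq \<Omega>p u 0" "ae_eq \<Omega>m p 0"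
proof -
  have "norm1_h P D \<sigma> u + norm0_h P D p \<le> stability_constant C \<alpha> * (0 + 0)"
    by (rule saddle_point_stability[OF \<sigma> u p]) (use F G in auto)
  then have n: "norm1_h P D \<sigma> u = 0" "norm0_h P D p = 0"
    using norm1_h_nonneg[OF QV_HH[OF \<sigma> u]] norm0_h_nonneg[OF Vm_h_L2[OF p]] by auto
  show "ae_eq \<Omega>m \<sigma> 0" "ae_eq \<Omega>p u 0" by (rule norm1_h_eq_0_imp_ae[OF \<sigma> u n(1)])+
  have "l2_norm \<Omega>m p = 0" using Vm_l2_le[OF p] n(2) l2_norm_nonneg[of \<Omega>m p] by simp
  then show "ae_eq \<Omega>m p 0" by (rule l2_norm_eq_0_imp_ae[OF Vm_h_L2[OF p]])
qed

lemma lin_on_quadB: "g \<in> H_half (frontier (Om P)) \<Longrightarrow> lin_on (Hdiv \<Omega>m) (quadB D g)"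
  using valid bilinear_on_lin(2) unfolding valid_discretization_def by blast

lemma quadB_ae_0:
  assumes "g \<in> H_half (frontier (Om P))" "\<tau> \<in> Hdiv \<Omega>m" "ae_eq \<Omega>m \<tau> 0"
  shows "quadB D g \<tau> = 0"
proof -
  have "quadB D g \<tau> = quadB D g 0"
    using valid[unfolded valid_discretization_def, THEN conjunct2, THEN conjunct2, THEN conjunct2,
        THEN conjunct2, THEN conjunct2] assms subspace_0[OF subspace_Hdiv_m] by blast
  then show ?thesis using lin_on_0[OF lin_on_quadB[OF assms(1)] assms(2)] by simp
qed

text \<open>The lift \<open>v0\<close> of the boundary datum moves to the right-hand side, which
  leaves equal trial and test spaces. The two equations are then added into one form, whose
  nondegeneracy is uniqueness for the homogeneous problem.\<close>

lemma discrete_solution_exists: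
  assumes f: "f \<in> L2 (Om P)" and g: "g \<in> H_half (frontier (Om P))" and v0: "v0 \<in> Vp_h P D g"
  shows "\<exists>\<sigma> p u. direct_fem_solution P D f g \<sigma> p u"
proof -
  define W where "W = Q_h P D \<times> (Vm_h P D \<times> Vp0_h P D)"
  define N where "N = {\<tau>. ae_eq \<Omega>m \<tau> (0::vfun)} \<times> ({w. ae_eq \<Omega>m w (0::sfun)} \<times> {v. ae_eq \<Omega>p v (0::sfun)})"
  \<comment> \<open>Testing with \<open>(\<tau>, 0, v)\<close> and with \<open>(0, w, 0)\<close>
    separates the two equations again.\<close>
  define B where "B x y = a_h P D (fst x) (snd (snd x)) (fst y) (snd (snd y))
    + b_h P D (fst (snd x)) (fst y) + b_h P D (fst (snd y)) (fst x)" for x y :: "vfun \<times> sfun \<times> sfun"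
  \<comment> \<open>\<open>a_h\<close> is linear in its first pair of arguments, so the lift enters
    as the pair \<open>(0, v0)\<close>.\<close>
  define L where "L y = inner_h P D Plus f (snd (snd y)) + quadB D g (fst y)
    - a_h P D 0 v0 (fst y) (snd (snd y)) - inner_h P D Minus f (fst (snd y))" for y :: "vfun \<times> sfun \<times> sfun"
  have Wd: "fst x \<in> Q_h P D" "fst (snd x) \<in> Vm_h P D" "snd (snd x) \<in> Vp0_h P D"
    "fst x \<in> Hdiv \<Omega>m" "fst (snd x) \<in> L2 \<Omega>m" "snd (snd x) \<in> H1 \<Omega>p" "snd (snd x) \<in> L2 \<Omega>p"
    "(fst x, snd (snd x)) \<in> HH" if "x \<in> W" for x
    using that Q_h_Hdiv Vm_h_L2 Vp_h_H1 H1_L2 by (auto simp: W_def mem_Times_iff)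
  have z: "(0::vfun) \<in> Hdiv \<Omega>m" by (rule subspace_0[OF subspace_Hdiv_m])
  have fL: "f \<in> L2 (Oms P s)" for s by (rule L2_Oms[OF f])
  have subW: "subspace W"
    unfolding W_def by (intro subspace_Times subspace_Q_h subspace_Vm_h subspace_Vp0_h)
  have ms: "finite (mesh_side P D s)" "\<And>K. K \<in> mesh_side P D s \<Longrightarrow> K \<in> sets lebesgue" for s
    using mesh_finite mesh_sets mesh_side_subset finite_subset by blast+
  have "\<exists>J (\<kappa> :: vfun \<Rightarrow> pt set \<times> vfun \<Rightarrow> real). coordinates_modulo (Q_h P D) {w. ae_eq \<Omega>m w 0} J \<kappa>"
    by (rule piecewise_coordinates[where S = "Ssig D", OF ms(1) _ ms(2) Oms_sets mesh_side_cover])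
      (auto simp: Q_h_eq intro: finite_dim_mesh_side)
  then obtain J1 and \<kappa>1 :: "vfun \<Rightarrow> pt set \<times> vfun \<Rightarrow> real"
    where c1: "coordinates_modulo (Q_h P D) {w. ae_eq \<Omega>m w 0} J1 \<kappa>1" by blast
  have "\<exists>J (\<kappa> :: sfun \<Rightarrow> pt set \<times> sfun \<Rightarrow> real). coordinates_modulo (Vm_h P D) {w. ae_eq \<Omega>m w 0} J \<kappa>"
    by (rule piecewise_coordinates[where S = "Su D Minus", OF ms(1) _ ms(2) Oms_sets mesh_side_cover])
      (auto simp: Vm_h_eq intro: finite_dim_mesh_side)
  then obtain J2 and \<kappa>2 :: "sfun \<Rightarrow> pt set \<times> sfun \<Rightarrow> real"
    where c2: "coordinates_modulo (Vm_h P D) {w. ae_eq \<Omega>m w 0} J2 \<kappa>2" by blast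
  have "\<exists>J (\<kappa> :: sfun \<Rightarrow> pt set \<times> sfun \<Rightarrow> real). coordinates_modulo (Vp0_h P D) {w. ae_eq \<Omega>p w 0} J \<kappa>"
    by (rule piecewise_coordinates[where S = "Su D Plus", OF ms(1) _ ms(2) Oms_sets mesh_side_cover])
      (auto simp: Vp_h_eq intro: finite_dim_mesh_side)
  then obtain J3 and \<kappa>3 :: "sfun \<Rightarrow> pt set \<times> sfun \<Rightarrow> real"
    where c3: "coordinates_modulo (Vp0_h P D) {w. ae_eq \<Omega>p w 0} J3 \<kappa>3" by blast
  note coord = coordinates_modulo_Times[OF c1 coordinates_modulo_Times[OF c2 c3], folded W_def N_def]
  have "\<exists>x\<in>W. \<forall>y\<in>W. B x y = L y"
  proof (rule nondegenerate_form_solvable_modulo[OF subW coord])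
    fix y assume y: "y \<in> W"
    show "lin_on W (\<lambda>x. B x y)"
      unfolding B_def
    proof (intro lin_on_plus)
      show "lin_on W (\<lambda>x. a_h P D (fst x) (snd (snd x)) (fst y) (snd (snd y)))"
        unfolding lin_on_def using lin_onD[OF lin_on_a_h_left[OF Wd(4,6)[OF y]] Wd(8) Wd(8)] by simp
      show "lin_on W (\<lambda>x. b_h P D (fst (snd x)) (fst y))"
        unfolding lin_on_def using lin_onD[OF lin_on_b_h(2)[OF Wd(4)[OF y]] Wd(5) Wd(5)] by simp
      show "lin_on W (\<lambda>x. b_h P D (fst (snd y)) (fst x))"
        unfolding lin_on_def using lin_onD[OF lin_on_b_h(1)[OF Wd(5)[OF y]] Wd(4) Wd(4)] by simp
    qed
    show "lin_on W (B y)"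
      unfolding B_def[abs_def]
    proof (intro lin_on_plus)
      show "lin_on W (\<lambda>x. a_h P D (fst y) (snd (snd y)) (fst x) (snd (snd x)))"
        unfolding lin_on_def using lin_onD[OF lin_on_a_h_right[OF Wd(4,6)[OF y]] Wd(8) Wd(8)] by simp
      show "lin_on W (\<lambda>x. b_h P D (fst (snd x)) (fst y))"
        unfolding lin_on_def using lin_onD[OF lin_on_b_h(2)[OF Wd(4)[OF y]] Wd(5) Wd(5)] by simp
      show "lin_on W (\<lambda>x. b_h P D (fst (snd y)) (fst x))"
        unfolding lin_on_def using lin_onD[OF lin_on_b_h(1)[OF Wd(5)[OF y]] Wd(4) Wd(4)] by simp
    qed
  next
    fix x y assume x: "x \<in> W" and y: "y \<in> W" "y \<in> N"
    then have ae: "ae_eq \<Omega>m (fst y) 0" "ae_eq \<Omega>m (fst (snd y)) 0" "ae_eq \<Omega>p (snd (snd y)) 0"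
      by (auto simp: N_def)
    show "B x y = 0"
      unfolding B_def using a_h_ae_0[OF Wd(4,6)[OF x] Wd(4,6)[OF y(1)] ae(1,3)]
        b_h_ae_0(1)[OF Wd(4)[OF y(1)] Wd(5)[OF x] ae(1)]
        b_h_ae_0(2)[OF Wd(4)[OF x] Wd(5)[OF y(1)] ae(2)] by simp
  next
    show "lin_on W L"
      unfolding L_def[abs_def]
    proof (intro lin_on_plus lin_on_minus)
      show "lin_on W (\<lambda>y. inner_h P D Plus f (snd (snd y)))"
        unfolding lin_on_def using lin_onD[OF ih.lin_right[OF fL] Wd(7) Wd(7)] by simp
      show "lin_on W (\<lambda>y. quadB D g (fst y))"
        unfolding lin_on_def using lin_onD[OF lin_on_quadB[OF g] Wd(4) Wd(4)] by simp
      show "lin_on W (\<lambda>x. a_h P D 0 v0 (fst x) (snd (snd x)))"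
        unfolding lin_on_def using lin_onD[OF lin_on_a_h_right[OF z Vp_h_H1[OF v0]] Wd(8) Wd(8)] by simp
      show "lin_on W (\<lambda>y. inner_h P D Minus f (fst (snd y)))"
        unfolding lin_on_def using lin_onD[OF ih.lin_right[OF fL] Wd(5) Wd(5)] by simp
    qed
  next
    fix y assume y: "y \<in> W" "y \<in> N"
    then have ae: "ae_eq \<Omega>m (fst y) 0" "ae_eq \<Omega>m (fst (snd y)) 0" "ae_eq \<Omega>p (snd (snd y)) 0"
      by (auto simp: N_def)
    show "L y = 0"
      unfolding L_def using a_h_ae_0[OF z Vp_h_H1[OF v0] Wd(4,6)[OF y(1)] ae(1,3)]
        quadB_ae_0[OF g Wd(4)[OF y(1)] ae(1)] inner_h_ae_0(2)[OF ae(2) Wd(5)[OF y(1)] fL]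
        inner_h_ae_0(2)[OF ae(3) Wd(7)[OF y(1)] fL] by simp
  next
    fix x assume x: "x \<in> W" and 0: "\<forall>y\<in>W. B x y = 0"
    have "a_h P D (fst x) (snd (snd x)) \<tau> v + b_h P D (fst (snd x)) \<tau> = 0"
      if "\<tau> \<in> Q_h P D" "v \<in> Vp0_h P D" for \<tau> v
    proof -
      have "(\<tau>, 0, v) \<in> W" using that subspace_0[OF subspace_Vm_h] by (simp add: W_def)
      then have "B x (\<tau>, 0, v) = 0" using 0 by blast
      then show ?thesis
        using lin_on_0[OF lin_on_b_h(2)[OF Wd(4)[OF x]] Wd(5)[OF x]] by (simp add: B_def)
    qed
    moreover have "b_h P D w (fst x) = 0" if "w \<in> Vm_h P D" for w
    proof -
      have "(0, w, 0) \<in> W" using that zero_Vp0_h subspace_0[OF subspace_Q_h] by (simp add: W_def)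
      then have "B x (0, w, 0) = 0" using 0 by blast
      then show ?thesis
        using lin_on_0[OF lin_on_b_h(1)[OF Wd(5)[OF x]] Wd(4)[OF x]]
          lin_on_0[OF lin_on_a_h_right[OF Wd(4,6)[OF x]] Wd(8)[OF x]] by (simp add: B_def)
    qed
    ultimately show "x \<in> N"
      using homogeneous_solution_ae_0[OF Wd(1,3,2)[OF x]] by (auto simp: N_def mem_Times_iff)
  qed
  then obtain \<sigma> p u where x: "(\<sigma>, p, u) \<in> W" and eq: "\<And>y. y \<in> W \<Longrightarrow> B (\<sigma>, p, u) y = L y" by auto
  note xd = Wd[OF x, simplified]
  have "direct_fem_solution P D f g \<sigma> p (v0 + u)"
    unfolding direct_fem_solution_def
  proof (intro conjI ballI)
    show "\<sigma> \<in> Q_h P D" "p \<in> Vm_h P D" "v0 + u \<in> Vp_h P D g"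
      using xd Vp_h_add[OF v0] by auto
    fix \<tau> v assume tv: "\<tau> \<in> Q_h P D" "v \<in> Vp0_h P D"
    have y: "(\<tau>, 0, v) \<in> W" using tv subspace_0[OF subspace_Vm_h] by (simp add: W_def)
    have "a_h P D \<sigma> (v0 + u) \<tau> v = a_h P D 0 v0 \<tau> v + a_h P D \<sigma> u \<tau> v"
      using lin_on_add[OF lin_on_a_h_left[of \<tau> v], of "(0, v0)" "(\<sigma>, u)"] Wd[OF y] xd z Vp_h_H1[OF v0] by simp
    moreover have "b_h P D 0 \<sigma> = 0" "inner_h P D Minus f 0 = 0"
      using lin_on_0[OF lin_on_b_h(2), of \<sigma> p] xd lin_on_0[OF ih.lin_right[OF fL] fL] by auto
    ultimately show "a_h P D \<sigma> (v0 + u) \<tau> v + b_h P D p \<tau> = inner_h P D Plus f v + quadB D g \<tau>"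
      using eq[OF y] by (simp add: B_def L_def)
  next
    fix w assume w: "w \<in> Vm_h P D"
    have y: "(0, w, 0) \<in> W" using w zero_Vp0_h subspace_0[OF subspace_Q_h] by (simp add: W_def)
    have "a_h P D \<sigma> u 0 0 = 0" "a_h P D 0 v0 0 0 = 0"
      using lin_on_0[OF lin_on_a_h_right[of \<sigma> u], of "(\<sigma>, u)"]
        lin_on_0[OF lin_on_a_h_right[OF z Vp_h_H1[OF v0]], of "(0, v0)"] xd z Vp_h_H1[OF v0] by auto
    moreover have "b_h P D p 0 = 0" "inner_h P D Plus f 0 = 0" "quadB D g 0 = 0"
      using lin_on_0[OF lin_on_b_h(1), of p \<sigma>] xd lin_on_0[OF ih.lin_right[OF fL] fL]
        lin_on_0[OF lin_on_quadB[OF g] z] by auto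
    ultimately show "b_h P D w \<sigma> = - inner_h P D Minus f w"
      using eq[OF y] by (simp add: B_def L_def)
  qed
  then show ?thesis by blast
qed

lemma a_h_diff:
  assumes "(\<sigma>, u) \<in> HH" "(\<sigma>', u') \<in> HH" "(\<tau>, v) \<in> HH"
  shows "a_h P D (\<sigma> - \<sigma>') (u - u') \<tau> v = a_h P D \<sigma> u \<tau> v - a_h P D \<sigma>' u' \<tau> v"
  using lin_on_diff[OF lin_on_a_h_left[of \<tau> v] assms(1,2)] assms by auto

lemma b_h_diff:
  assumes "\<tau> \<in> Hdiv \<Omega>m" "w \<in> L2 \<Omega>m"
  shows "w' \<in> L2 \<Omega>m \<Longrightarrow> b_h P D (w - w') \<tau> = b_h P D w \<tau> - b_h P D w' \<tau>"
    and "\<tau>' \<in> Hdiv \<Omega>m \<Longrightarrow> b_h P D w (\<tau> - \<tau>') = b_h P D w \<tau> - b_h P D w \<tau>'"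
  using lin_on_diff[OF lin_on_b_h(2)[OF assms(1)] assms(2)]
    lin_on_diff[OF lin_on_b_h(1)[OF assms(2)] assms(1)] by auto

lemma discrete_solution_unique:
  assumes s: "direct_fem_solution P D f g \<sigma> p u" and s': "direct_fem_solution P D f g \<sigma>' p' u'"
  shows "ae_eq \<Omega>m \<sigma>' \<sigma>" "ae_eq \<Omega>m p' p" "ae_eq \<Omega>p u' u"
proof -
  note d = s[unfolded direct_fem_solution_def] and d' = s'[unfolded direct_fem_solution_def]
  have mem: "\<sigma>' - \<sigma> \<in> Q_h P D" "u' - u \<in> Vp0_h P D" "p' - p \<in> Vm_h P D"
    using d d' subspace_diff[OF subspace_Q_h] subspace_diff[OF subspace_Vm_h] Vp_h_diff by auto
  have HH: "(\<sigma>, u) \<in> HH" "(\<sigma>', u') \<in> HH" and L: "p \<in> L2 \<Omega>m" "p' \<in> L2 \<Omega>m"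
    using d d' QV_HH Vm_h_L2 by blast+
  have 1: "a_h P D (\<sigma>' - \<sigma>) (u' - u) \<tau> v + b_h P D (p' - p) \<tau> = 0"
    if tv: "\<tau> \<in> Q_h P D" "v \<in> Vp0_h P D" for \<tau> v
  proof -
    have "a_h P D \<sigma> u \<tau> v + b_h P D p \<tau> = a_h P D \<sigma>' u' \<tau> v + b_h P D p' \<tau>"
      using d d' tv by simp
    then show ?thesis
      using a_h_diff[OF HH(2,1) QV_HH[OF tv]] b_h_diff(1)[OF Q_h_Hdiv[OF tv(1)] L(2,1)] by simp
  qed
  have 2: "b_h P D w (\<sigma>' - \<sigma>) = 0" if w: "w \<in> Vm_h P D" for w
  proof -
    have "b_h P D w \<sigma> = b_h P D w \<sigma>'" using d d' w by simp
    then show ?thesis using b_h_diff(2)[of \<sigma>' w \<sigma>] HH Vm_h_L2[OF w] by simp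
  qed
  show "ae_eq \<Omega>m \<sigma>' \<sigma>" "ae_eq \<Omega>m p' p" "ae_eq \<Omega>p u' u"
    using homogeneous_solution_ae_0[OF mem 1 2] unfolding ae_eq_diff_0_iff by auto
qed

text \<open>Since \<open>g\<close> vanishes on the plus part of the outer boundary, \<open>u\<close>
  has zero boundary values and may be tested with itself; no lift enters the bound.\<close>

lemma discrete_solution_stable:
  assumes sol: "direct_fem_solution P D f g \<sigma> p u"
    and g: "AE x in arc_length_on (outer P Plus). g x = 0"
    and A: "0 \<le> A" and B: "0 \<le> B"
    and f_bound: "\<And>\<tau> v. \<tau> \<in> Q_h P D \<Longrightarrow> v \<in> Vp0_h P D \<Longrightarrow> \<bar>inner_h P D Plus f v\<bar> \<le> A * norm1_h P D \<tau> v"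
    and g_bound: "\<And>\<tau> v. \<tau> \<in> Q_h P D \<Longrightarrow> v \<in> Vp0_h P D \<Longrightarrow> \<bar>quadB D g \<tau>\<bar> \<le> B * norm1_h P D \<tau> v"
    and f_bound': "\<And>w. w \<in> Vm_h P D \<Longrightarrow> \<bar>inner_h P D Minus f w\<bar> \<le> A * norm0_h P D w"
  shows "norm1_h P D \<sigma> u + norm0_h P D p \<le> stability_constant C \<alpha> * (2 * (A + B))"
proof -
  note d = sol[unfolded direct_fem_solution_def]
  have u: "u \<in> Vp0_h P D"
    using d has_trace_cong_AE[OF _ g, of \<Omega>p u] by (simp add: Vp_h_def)
  \<comment> \<open>The loads of the first equation contribute \<open>A + B\<close>, that of the
    second another \<open>A\<close>.\<close>
  have "norm1_h P D \<sigma> u + norm0_h P D p \<le> stability_constant C \<alpha> * ((A + B) + A)"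
  proof (rule saddle_point_stability[OF _ u])
    fix \<tau> v assume tv: "\<tau> \<in> Q_h P D" "v \<in> Vp0_h P D"
    then show "\<bar>a_h P D \<sigma> u \<tau> v + b_h P D p \<tau>\<bar> \<le> (A + B) * norm1_h P D \<tau> v"
      using d f_bound[OF tv] g_bound[OF tv] by (simp add: distrib_right)
  qed (use d A B f_bound' in auto)
  also have "\<dots> \<le> stability_constant C \<alpha> * (2 * (A + B))"
    using stability_constant_pos[OF C \<alpha>] B by (intro mult_left_mono) auto
  finally show ?thesis .
qed

end

section \<open>The exact solution in the mixed formulation\<close>

context discrete_interface_problem
begin

context
  fixes f g u
  assumes pairings: "normal_trace_pairings P" and f: "f \<in> L2 (Om P)"
    and g: "g \<in> H_half (frontier (Om P))" and u: "solves_interface_problem P f g u"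
begin

lemma u_H1: "u \<in> H1 (Om P)" "u \<in> H1 (Oms P s)"
proof -
  show "u \<in> H1 (Om P)" using u by (simp add: solves_interface_problem_def)
  then show "u \<in> H1 (Oms P s)" by (rule H1_mono(1)[OF _ Oms_subset Om_open Oms_open Om_bounded])
qed

lemma flux_Hdiv: "flux P s u \<in> Hdiv (Oms P s)"
  and dvg_flux: "ae_eq (Oms P s) (dvg (Oms P s) (flux P s u)) (- f)"
proof -
  have L: "flux P s u \<in> L2 (Oms P s)"
    using subspace_scale[OF subspace_L2 grad_L2[OF u_H1(2)[of s]], of "beta P s"]
    by (simp add: flux_def[abs_def] scaleR_fun_def)
  have d: "weak_div (Oms P s) (flux P s u) (- f)"
    using u by (simp add: solves_interface_problem_def fun_Compl_def)
  have fL: "- f \<in> L2 (Oms P s)" by (rule subspace_neg[OF subspace_L2 L2_Oms[OF f]])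
  show F: "flux P s u \<in> Hdiv (Oms P s)" using L d fL by (auto simp: Hdiv_def)
  show "ae_eq (Oms P s) (dvg (Oms P s) (flux P s u)) (- f)"
    by (rule dvg_ae_unique[OF Oms_open Oms_bounded F fL d])
qed

lemma l2_inner_dvg_flux:
  assumes "w \<in> L2 (Oms P s)"
  shows "l2_inner (Oms P s) (dvg (Oms P s) (flux P s u)) w = - l2_inner (Oms P s) f w"
proof -
  have "l2_inner (Oms P s) (dvg (Oms P s) (flux P s u)) w = l2_inner (Oms P s) (- f) w"
    by (rule l2_inner_cong[OF dvg_flux dvg_L2[OF flux_Hdiv] subspace_neg[OF subspace_L2 L2_Oms[OF f]] assms])
  also have "\<dots> = - l2_inner (Oms P s) f w"
    using lin_on_scale[OF L2.lin[OF assms] L2_Oms[OF f], of "-1"] by simp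
  finally show ?thesis .
qed

text \<open>Green's formula for \<open>u\<close> with boundary values \<open>g\<close> turns (div
  \<tau>, u) + (\<tau>, grad u) on the minus side into pairings; dividing the flux by its
  coefficient identifies (\<tau>, grad u). Flux continuity, with divergence -f on the plus side,
  turns the pairing with \<open>v\<close> into load minus energy.\<close>

lemma continuous_equation_1:
  assumes \<tau>: "\<tau> \<in> Hdiv \<Omega>m" and v: "v \<in> V_plus P (\<lambda>x. 0)"
  shows "a_form P (flux P Minus u) u \<tau> v + b_form P u \<tau> = l2_inner \<Omega>p f v + pairB P g \<tau>"
proof -
  have vL: "v \<in> L2 \<Omega>p" "v \<in> H1 \<Omega>p" using v H1_L2 by (auto simp: V_plus_def)
  have "has_trace (Om P) (frontier (Om P)) u g" using u by (simp add: solves_interface_problem_def)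
  then have green: "pairG P \<tau> u + pairB P g \<tau> = l2_inner \<Omega>m (dvg \<Omega>m \<tau>) u + l2_inner \<Omega>m \<tau> (grad \<Omega>m u)"
    using pairings \<tau> u_H1(1) g unfolding normal_trace_pairings_def by blast
  have jump: "pairG P (flux P Minus u) v =
      - (l2_inner \<Omega>p (dvg \<Omega>p (flux P Plus u)) v + l2_inner \<Omega>p (flux P Plus u) (grad \<Omega>p v))"
    using u v unfolding solves_interface_problem_def by blast
  have "l2_inner \<Omega>m (flux P Minus u) \<tau> = l2_inner \<Omega>m (beta P Minus *\<^sub>R grad \<Omega>m u) \<tau>"
    by (simp add: flux_def[abs_def] scaleR_fun_def)
  also have "\<dots> = beta P Minus * l2_inner \<Omega>m \<tau> (grad \<Omega>m u)"
    using lin_on_scale[OF L2.lin[OF Hdiv_L2[OF \<tau>]] grad_L2[OF u_H1(2)]]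
      L2.sym[OF Hdiv_L2[OF \<tau>] grad_L2[OF u_H1(2)]]
    by simp
  finally have "1 / beta P Minus * l2_inner \<Omega>m (flux P Minus u) \<tau> = l2_inner \<Omega>m \<tau> (grad \<Omega>m u)"
    using beta_pos[of Minus] by simp
  moreover have "(\<lambda>x. beta P Plus *\<^sub>R grad \<Omega>p u x) = flux P Plus u"
    by (simp add: flux_def[abs_def])
  ultimately show ?thesis
    using green jump l2_inner_dvg_flux[OF vL(1)] by (simp add: a_form_def b_form_def)
qed

lemma continuous_equation_2:
  "w \<in> L2 \<Omega>m \<Longrightarrow> b_form P w (flux P Minus u) = - l2_inner \<Omega>m f w"
  unfolding b_form_def by (rule l2_inner_dvg_flux)

end

end

context stable_discretization
begin

text \<open>\<open>H\<close> is a common bound for all approximation and quadrature errors. The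
  first residual collects four quadrature errors, \<open>b_h\<close> of one approximation error and
  \<open>a_h\<close> of the other, giving 5 + E; the second collects two quadrature errors and one
  \<open>b_h\<close> term, giving 3. The final 2 comes from the triangle inequalities.\<close>

lemma error_estimate:
  fixes u f g
  defines "s \<equiv> flux P Minus u"
  assumes pairings: "normal_trace_pairings P" and f: "f \<in> L2 (Om P)"
    and g: "g \<in> H_half (frontier (Om P))" and u: "solves_interface_problem P f g u"
    and sol: "direct_fem_solution P D f g \<sigma> p v"
    and E: "0 \<le> E" and H: "0 \<le> H"
    and \<sigma>': "\<sigma>' \<in> Q_h P D" and v': "v' \<in> Vp_h P D g" and p': "p' \<in> Vm_h P D"
    and approx1: "norm1_h P D (s - \<sigma>') (u - v') \<le> H" and approx0: "norm0_h P D (u - p') \<le> H"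
    and a_error: "\<And>\<tau> w. \<tau> \<in> Q_h P D \<Longrightarrow> w \<in> Vp0_h P D \<Longrightarrow>
      \<bar>a_h P D (s - \<sigma>') (u - v') \<tau> w\<bar> \<le> E * (norm1_h P D (s - \<sigma>') (u - v') * norm1_h P D \<tau> w)"
    and quad1: "\<And>\<tau> w. \<tau> \<in> Q_h P D \<Longrightarrow> w \<in> Vp0_h P D \<Longrightarrow>
      \<bar>a_form P s u \<tau> w - a_h P D s u \<tau> w\<bar> / norm1_h P D \<tau> w \<le> H"
    and quad2: "\<And>\<tau> w. \<tau> \<in> Q_h P D \<Longrightarrow> w \<in> Vp0_h P D \<Longrightarrow>
      \<bar>b_form P u \<tau> - b_h P D u \<tau>\<bar> / norm1_h P D \<tau> w \<le> H"
    and quad3: "\<And>w. w \<in> Vm_h P D \<Longrightarrow> \<bar>b_form P w s - b_h P D w s\<bar> / norm0_h P D w \<le> H"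
    and quad4: "\<And>\<tau> w. \<tau> \<in> Q_h P D \<Longrightarrow> w \<in> Vp0_h P D \<Longrightarrow>
      \<bar>l2_inner \<Omega>p f w - inner_h P D Plus f w\<bar> / norm1_h P D \<tau> w \<le> H"
    and quad5: "\<And>w. w \<in> Vm_h P D \<Longrightarrow> \<bar>l2_inner \<Omega>m f w - inner_h P D Minus f w\<bar> / norm0_h P D w \<le> H"
    and quad6: "\<And>\<tau> w. \<tau> \<in> Q_h P D \<Longrightarrow> w \<in> Vp0_h P D \<Longrightarrow>
      \<bar>pairB P g \<tau> - quadB D g \<tau>\<bar> / norm1_h P D \<tau> w \<le> H"
  shows "norm1_h P D (s - \<sigma>) (u - v) + norm0_h P D (u - p)
    \<le> (stability_constant C \<alpha> * (8 + E) + 2) * H"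
proof -
  note d = sol[unfolded direct_fem_solution_def]
  note ctx = pairings f g u
  \<comment> \<open>\<open>v\<close> and \<open>v'\<close> carry the same datum \<open>g\<close>, so
    their difference has zero boundary values and the stability bound applies.\<close>
  have mem: "\<sigma> - \<sigma>' \<in> Q_h P D" "v - v' \<in> Vp0_h P D" "p - p' \<in> Vm_h P D"
    using d \<sigma>' v' p' subspace_diff[OF subspace_Q_h] subspace_diff[OF subspace_Vm_h] Vp_h_diff by auto
  have HH: "(s, u) \<in> HH" "(\<sigma>', v') \<in> HH" "(\<sigma>, v) \<in> HH"
    using flux_Hdiv[OF ctx, of Minus] u_H1(2)[OF ctx, of Plus] QV_HH[OF \<sigma>' v'] QV_HH[of \<sigma> v g] d
    by (auto simp: s_def)
  have L: "u \<in> L2 \<Omega>m" "p' \<in> L2 \<Omega>m" "p \<in> L2 \<Omega>m"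
    using H1_L2[OF u_H1(2)[OF ctx]] Vm_h_L2 p' d by auto
  have HHd: "(s - \<sigma>', u - v') \<in> HH" and Ld: "u - p' \<in> L2 \<Omega>m"
    using subspace_diff[OF subspace_HH HH(1,2)] subspace_diff[OF subspace_L2 L(1,2)] by auto
  have F: "\<bar>a_h P D (\<sigma> - \<sigma>') (v - v') \<tau> w + b_h P D (p - p') \<tau>\<bar> \<le> (5 + E) * H * norm1_h P D \<tau> w"
    if tw: "\<tau> \<in> Q_h P D" "w \<in> Vp0_h P D" for \<tau> w
  proof -
    note tH = QV_HH[OF tw]
    define n where "n = norm1_h P D \<tau> w"
    have n0: "0 \<le> n" unfolding n_def by (rule norm1_h_nonneg[OF tH])
    show ?thesis
    proof (cases "n = 0")
      case True
      \<comment> \<open>Terms with vanishing denominator drop out of the suprema (\<open>x / 0 = 0\<close>), so that here the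
        quadrature bounds say nothing and boundedness of the forms is used instead.\<close>
      then have "a_h P D (\<sigma> - \<sigma>') (v - v') \<tau> w = 0" "b_h P D (p - p') \<tau> = 0"
        using a_h_bound[OF mem(1,2) tw] b_h_bound[OF tH Vm_h_L2[OF mem(3)]] by (auto simp: n_def)
      then show ?thesis using True by (simp add: n_def)
    next
      case False
      then have n: "0 < n" using n0 by simp
      have q: "\<bar>a_form P s u \<tau> w - a_h P D s u \<tau> w\<bar> \<le> H * n" "\<bar>b_form P u \<tau> - b_h P D u \<tau>\<bar> \<le> H * n"
        "\<bar>l2_inner \<Omega>p f w - inner_h P D Plus f w\<bar> \<le> H * n" "\<bar>pairB P g \<tau> - quadB D g \<tau>\<bar> \<le> H * n"
        using quad1[OF tw] quad2[OF tw] quad4[OF tw] quad6[OF tw] n by (simp_all add: divide_le_eq n_def)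
      have e: "\<bar>a_h P D (s - \<sigma>') (u - v') \<tau> w\<bar> \<le> E * H * n"
      proof -
        have "\<bar>a_h P D (s - \<sigma>') (u - v') \<tau> w\<bar> \<le> E * (norm1_h P D (s - \<sigma>') (u - v') * n)"
          unfolding n_def by (rule a_error[OF tw])
        also have "\<dots> \<le> E * (H * n)" by (intro mult_left_mono mult_right_mono approx1 n0 E)
        finally show ?thesis by (simp add: mult.assoc)
      qed
      have b: "\<bar>b_h P D (u - p') \<tau>\<bar> \<le> H * n"
        using b_h_bound[OF tH Ld] mult_right_mono[OF approx0 n0] by (simp add: n_def)
      have wV: "w \<in> V_plus P (\<lambda>x. 0)" using tw(2) by (simp add: V_plus_def Vp_h_def)
      have cont: "a_form P s u \<tau> w + b_form P u \<tau> = l2_inner \<Omega>p f w + pairB P g \<tau>"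
        unfolding s_def by (rule continuous_equation_1[OF ctx Q_h_Hdiv[OF tw(1)] wV])
      have disc: "a_h P D \<sigma> v \<tau> w + b_h P D p \<tau> = inner_h P D Plus f w + quadB D g \<tau>"
        using d tw by blast
      have tD: "\<tau> \<in> Hdiv \<Omega>m" by (rule Q_h_Hdiv[OF tw(1)])
      \<comment> \<open>Inserting the exact pair writes the residual as (a - a_h) + (b - b_h) at the
        exact solution, minus the quadrature errors of the two loads, plus the discrete forms of the
        approximation errors.\<close>
      show ?thesis
        using q e b cont disc a_h_diff[OF HH(3,2) tH] a_h_diff[OF HH(1,2) tH]
          b_h_diff(1)[OF tD L(3,2)] b_h_diff(1)[OF tD L(1,2)]
        unfolding n_def[symmetric] by (simp add: distrib_right mult.assoc)
    qed
  qed
  have G: "\<bar>b_h P D w (\<sigma> - \<sigma>')\<bar> \<le> 3 * H * norm0_h P D w" if w: "w \<in> Vm_h P D" for w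
  proof -
    have wL: "w \<in> L2 \<Omega>m" by (rule Vm_h_L2[OF w])
    define n where "n = norm0_h P D w"
    have n0: "0 \<le> n" unfolding n_def by (rule norm0_h_nonneg[OF wL])
    show ?thesis
    proof (cases "n = 0")
      case True
      then have "b_h P D w (\<sigma> - \<sigma>') = 0"
        using b_h_bound[OF QV_HH[OF mem(1,2)] wL] by (simp add: n_def)
      then show ?thesis using True by (simp add: n_def)
    next
      case False
      then have n: "0 < n" using n0 by simp
      have q: "\<bar>b_form P w s - b_h P D w s\<bar> \<le> H * n" "\<bar>l2_inner \<Omega>m f w - inner_h P D Minus f w\<bar> \<le> H * n"
        using quad3[OF w] quad5[OF w] n by (simp_all add: divide_le_eq n_def)
      have b: "\<bar>b_h P D w (s - \<sigma>')\<bar> \<le> H * n"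
        using b_h_bound[OF HHd wL] mult_left_mono[OF approx1 n0] by (simp add: n_def mult.commute)
      have cont: "b_form P w s = - l2_inner \<Omega>m f w"
        unfolding s_def by (rule continuous_equation_2[OF ctx wL])
      have disc: "b_h P D w \<sigma> = - inner_h P D Minus f w" using d w by blast
      show ?thesis
        using q b cont disc b_h_diff(2)[of \<sigma> w \<sigma>'] b_h_diff(2)[of s w \<sigma>'] HH wL
        unfolding n_def[symmetric] by simp
    qed
  qed
  have "norm1_h P D (\<sigma> - \<sigma>') (v - v') + norm0_h P D (p - p')
      \<le> stability_constant C \<alpha> * ((5 + E) * H + 3 * H)"
    by (rule saddle_point_stability[OF mem _ _ F G]) (use E H in auto)
  moreover have "norm1_h P D (s - \<sigma>) (u - v) \<le> norm1_h P D (s - \<sigma>') (u - v') + norm1_h P D (\<sigma> - \<sigma>') (v - v')"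
    using n1.triangle_diff[OF HH] norm1_h_eq[OF HHd] norm1_h_eq[OF QV_HH[OF mem(1,2)]]
      norm1_h_eq[of "s - \<sigma>" "u - v"] subspace_diff[OF subspace_HH HH(1,3)] by simp
  moreover have "norm0_h P D (u - p) \<le> norm0_h P D (u - p') + norm0_h P D (p - p')"
    unfolding norm_h_def by (rule ih.triangle_diff[OF L])
  moreover have "stability_constant C \<alpha> * ((5 + E) * H + 3 * H) = stability_constant C \<alpha> * (8 + E) * H"
    by (simp add: algebra_simps)
  ultimately show ?thesis
    using approx1 approx0 unfolding distrib_right[of "stability_constant C \<alpha> * (8 + E)" 2 H] by linarith
qed

end

section \<open>From suprema and infima over discrete functions to the final constants\<close>

lemma SUP_pair_le_D:
  assumes "(SUP (a, b)\<in>A. ereal (\<phi> a b)) \<le> ereal t" "(a, b) \<in> A"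
  shows "\<phi> a b \<le> t"
  using order_trans[OF SUP_upper[OF assms(2), of "\<lambda>(a, b). ereal (\<phi> a b)"] assms(1)] by simp

lemma SUP_le_D:
  assumes "(SUP a\<in>A. ereal (\<phi> a)) \<le> ereal t" "a \<in> A"
  shows "\<phi> a \<le> t"
  using order_trans[OF SUP_upper[OF assms(2), of "\<lambda>a. ereal (\<phi> a)"] assms(1)] by simp

lemma INF_le_D:
  assumes "(INF a\<in>A. ereal (\<phi> a)) \<le> ereal t" "0 < \<epsilon>"
  obtains a where "a \<in> A" "\<phi> a < t + \<epsilon>"
proof -
  have "(INF a\<in>A. ereal (\<phi> a)) < ereal (t + \<epsilon>)"
    using assms by (intro le_less_trans[OF assms(1)]) simp
  then show ?thesis using that by (auto simp: INF_less_iff)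
qed

text \<open>The assumptions bound sums of two suprema or infima. Without nonnegativity one summand
  could be minus infinity and hide the other.\<close>

lemma ereal_add_le_D:
  fixes a b :: ereal
  assumes "a + b \<le> t" "0 \<le> a" "0 \<le> b"
  shows "a \<le> t" "b \<le> t"
  using assms add_increasing[of a b b] add_increasing2[of b a a] by (auto intro: order_trans)

theorem theorem2p2:
  fixes P :: setting and D :: "'i \<Rightarrow> discretization" and k :: nat
    and data :: "(sfun \<times> sfun \<times> sfun) set"
  assumes k: "k > 0"
    and geometry: "interface_geometry P"
    and pairings: "normal_trace_pairings P"
    and definite: "seminorm_definite P"
    and discretizations: "\<And>i. valid_discretization P (D i)"
    and problem: "\<And>f g u. (f, g, u) \<in> data \<Longrightarrow>
      f \<in> L2 (Om P) \<and> g \<in> H_half (frontier (Om P)) \<and> solves_interface_problem P f g u"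
    and dirichlet_data: "\<And>f g u i. (f, g, u) \<in> data \<Longrightarrow> Vp_h P (D i) g \<noteq> {}"
    and A1: "boundedness P D"
    and A1_errors: "\<And>f g u. (f, g, u) \<in> data \<Longrightarrow> boundedness_on_errors P D k g u"
    and A1_loads: "bounded_loads P D {(f, g). (\<exists>u. (f, g, u) \<in> data) \<and>
      (AE x in arc_length_on (outer P Plus). g x = 0)}"
    and A2: "inf_sup P D"
    and A3_div: "div_inclusion P D"
    and A3: "\<And>f g u. (f, g, u) \<in> data \<Longrightarrow> approximation_property P D k g u"
    and A4: "\<And>f g u. (f, g, u) \<in> data \<Longrightarrow> quadrature_accuracy P D k f g u"
  shows "(\<forall>(f, g, u)\<in>data. \<forall>i. \<exists>\<sigma>\<^sub>h um\<^sub>h up\<^sub>h. direct_fem_solution P (D i) f g \<sigma>\<^sub>h um\<^sub>h up\<^sub>h \<and>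
            (\<forall>\<sigma>' um' up'. direct_fem_solution P (D i) f g \<sigma>' um' up' \<longrightarrow>
               ae_eq (Oms P Minus) \<sigma>' \<sigma>\<^sub>h \<and> ae_eq (Oms P Minus) um' um\<^sub>h \<and> ae_eq (Oms P Plus) up' up\<^sub>h)) \<and>
         (\<exists>C>0. \<forall>(f, g, u)\<in>data. (AE x in arc_length_on (outer P Plus). g x = 0) \<longrightarrow>
            (\<forall>i \<sigma>\<^sub>h um\<^sub>h up\<^sub>h. direct_fem_solution P (D i) f g \<sigma>\<^sub>h um\<^sub>h up\<^sub>h \<longrightarrow>
               norm1_h P (D i) \<sigma>\<^sub>h up\<^sub>h + norm0_h P (D i) um\<^sub>h
                 \<le> C * (l2_norm (Om P) f + half_norm (outer P Minus) g))) \<and>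
         (\<forall>(f, g, u)\<in>data. regular P k u \<longrightarrow>
            (\<exists>C>0. \<forall>i \<sigma>\<^sub>h um\<^sub>h up\<^sub>h. direct_fem_solution P (D i) f g \<sigma>\<^sub>h um\<^sub>h up\<^sub>h \<longrightarrow>
               norm1_h P (D i) (\<lambda>x. flux P Minus u x - \<sigma>\<^sub>h x) (\<lambda>x. u x - up\<^sub>h x) +
               norm0_h P (D i) (\<lambda>x. u x - um\<^sub>h x) \<le> C * mesh_size (D i) ^ k))"
proof -
  obtain C where C: "C > 0" and C_bounds: "\<And>i.
     (\<forall>w\<in>Vm_h P (D i). l2_norm (Oms P Minus) w \<le> C * norm_h P (D i) Minus w) \<and>
     (\<forall>\<tau>\<in>Q_h P (D i). l2_norm (Oms P Minus) \<tau> \<le> C * vnorm_h P (D i) Minus \<tau>) \<and>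
     (\<forall>v\<in>Vp0_h P (D i). l2_norm (Oms P Plus) (grad (Oms P Plus) v) \<le> C * vnorm_h P (D i) Plus (grad (Oms P Plus) v)) \<and>
     (\<forall>\<sigma>\<in>Q_h P (D i). \<forall>u\<in>Vp0_h P (D i). \<forall>\<tau>\<in>Q_h P (D i). \<forall>v\<in>Vp0_h P (D i).
        \<bar>a_h P (D i) \<sigma> u \<tau> v\<bar> \<le> C * (norm1_h P (D i) \<sigma> u * norm1_h P (D i) \<tau> v))"
    using A1 unfolding boundedness_def Let_def by (elim exE conjE) (rule that; auto)
  obtain \<alpha> where \<alpha>: "\<alpha> > 0" and inf_sup: "\<And>i.
     ereal \<alpha> \<le> (INF w\<in>{w \<in> Vm_h P (D i). \<not> ae_eq (Oms P Minus) w (\<lambda>x. 0)}.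
       SUP (\<tau>, v)\<in>Q_h P (D i) \<times> Vp0_h P (D i).
         ereal (b_h P (D i) w \<tau> / (norm1_h P (D i) \<tau> v * norm0_h P (D i) w)))"
    using A2 unfolding inf_sup_def by blast
  interpret S: stable_discretization P "D i" C \<alpha> for i
  proof
    show "interface_geometry P" by (rule geometry)
    show "valid_discretization P (D i)" by (rule discretizations)
    show "C > 0" "\<alpha> > 0" by (rule C \<alpha>)+
    show "seminorm_definite P" by (rule definite)
    show "dvg (Oms P Minus) \<tau> \<in> Vm_h P (D i)" if "\<tau> \<in> Q_h P (D i)" for \<tau>
      using A3_div that unfolding div_inclusion_def by blast
  qed (use C_bounds[of i] inf_sup[of i] in \<open>(blast | assumption)+\<close>)
  have stab: "stability_constant C \<alpha> > 0" by (rule stability_constant_pos[OF C \<alpha>])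

  have "\<exists>\<sigma>\<^sub>h um\<^sub>h up\<^sub>h. direct_fem_solution P (D i) f g \<sigma>\<^sub>h um\<^sub>h up\<^sub>h \<and>
      (\<forall>\<sigma>' um' up'. direct_fem_solution P (D i) f g \<sigma>' um' up' \<longrightarrow>
        ae_eq (Oms P Minus) \<sigma>' \<sigma>\<^sub>h \<and> ae_eq (Oms P Minus) um' um\<^sub>h \<and> ae_eq (Oms P Plus) up' up\<^sub>h)"
    if fgu: "(f, g, u) \<in> data" for f g u i
  proof -
    obtain v0 where "v0 \<in> Vp_h P (D i) g" using dirichlet_data[OF fgu] by blast
    then obtain \<sigma> p w where "direct_fem_solution P (D i) f g \<sigma> p w"
      using S.discrete_solution_exists problem[OF fgu] by blast
    then show ?thesis
      by (intro exI conjI allI impI) (auto intro: S.discrete_solution_unique)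
  qed
  moreover have "\<exists>C>0. \<forall>(f, g, u)\<in>data. (AE x in arc_length_on (outer P Plus). g x = 0) \<longrightarrow>
      (\<forall>i \<sigma>\<^sub>h um\<^sub>h up\<^sub>h. direct_fem_solution P (D i) f g \<sigma>\<^sub>h um\<^sub>h up\<^sub>h \<longrightarrow>
        norm1_h P (D i) \<sigma>\<^sub>h up\<^sub>h + norm0_h P (D i) um\<^sub>h
          \<le> C * (l2_norm (Om P) f + half_norm (outer P Minus) g))"
  proof -
    \<comment> \<open>\<open>M\<close> precedes both the data and the mesh, so the stability
      constant is uniform in both.\<close>
    obtain M where M: "M > 0" and loads: "\<And>f g u i. (f, g, u) \<in> data \<Longrightarrow>
        (AE x in arc_length_on (outer P Plus). g x = 0) \<Longrightarrow>
        (\<forall>\<tau>\<in>Q_h P (D i). \<forall>v\<in>Vp0_h P (D i).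
          \<bar>inner_h P (D i) Plus f v\<bar> \<le> M * (l2_norm (Om P) f * norm1_h P (D i) \<tau> v) \<and>
          \<bar>quadB (D i) g \<tau>\<bar> \<le> M * (half_norm (outer P Minus) g * norm1_h P (D i) \<tau> v)) \<and>
        (\<forall>w\<in>Vm_h P (D i). \<bar>inner_h P (D i) Minus f w\<bar> \<le> M * (l2_norm (Om P) f * norm0_h P (D i) w))"
      using A1_loads unfolding bounded_loads_def by fast
    have "norm1_h P (D i) \<sigma> w + norm0_h P (D i) p
        \<le> (stability_constant C \<alpha> * (2 * M)) * (l2_norm (Om P) f + half_norm (outer P Minus) g)"
      if fgu: "(f, g, u) \<in> data" and g0: "AE x in arc_length_on (outer P Plus). g x = 0"
        and sol: "direct_fem_solution P (D i) f g \<sigma> p w" for f g u i \<sigma> p w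
    proof -
      have hn: "0 \<le> half_norm (outer P Minus) g"
        unfolding half_norm_def by (intro real_sqrt_ge_zero add_nonneg_nonneg Bochner_Integration.integral_nonneg) auto
      have "norm1_h P (D i) \<sigma> w + norm0_h P (D i) p
          \<le> stability_constant C \<alpha> * (2 * (M * l2_norm (Om P) f + M * half_norm (outer P Minus) g))"
        by (rule S.discrete_solution_stable[OF sol g0])
          (use loads[OF fgu g0, of i] M hn l2_norm_nonneg[of "Om P" f] in \<open>auto simp: mult.assoc\<close>)
      then show ?thesis by (simp add: algebra_simps)
    qed
    then show ?thesis
      using stab M by (intro exI[of _ "stability_constant C \<alpha> * (2 * M)"]) auto
  qed
  moreover have "\<exists>C>0. \<forall>i \<sigma>\<^sub>h um\<^sub>h up\<^sub>h. direct_fem_solution P (D i) f g \<sigma>\<^sub>h um\<^sub>h up\<^sub>h \<longrightarrow>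
      norm1_h P (D i) (\<lambda>x. flux P Minus u x - \<sigma>\<^sub>h x) (\<lambda>x. u x - up\<^sub>h x) +
      norm0_h P (D i) (\<lambda>x. u x - um\<^sub>h x) \<le> C * mesh_size (D i) ^ k"
    if fgu: "(f, g, u) \<in> data" and reg: "regular P k u" for f g u
  proof -
    let ?s = "flux P Minus u"
    have prob: "f \<in> L2 (Om P)" "g \<in> H_half (frontier (Om P))" "solves_interface_problem P f g u"
      using problem[OF fgu] by auto
    note ctx = pairings prob
    obtain E where E: "E > 0" and a_error: "\<And>i \<sigma>' u' \<tau> v. \<sigma>' \<in> Q_h P (D i) \<Longrightarrow> u' \<in> Vp_h P (D i) g \<Longrightarrow>
        \<tau> \<in> Q_h P (D i) \<Longrightarrow> v \<in> Vp0_h P (D i) \<Longrightarrow>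
        \<bar>a_h P (D i) (?s - \<sigma>') (u - u') \<tau> v\<bar>
          \<le> E * (norm1_h P (D i) (?s - \<sigma>') (u - u') * norm1_h P (D i) \<tau> v)"
      using A1_errors[OF fgu] reg unfolding boundedness_on_errors_def fun_diff_def by blast
    obtain C3 where C3: "C3 > 0" and app: "\<And>i.
        (INF (\<tau>, v)\<in>Q_h P (D i) \<times> Vp_h P (D i) g. ereal (norm1_h P (D i) (?s - \<tau>) (u - v))) +
        (INF w\<in>Vm_h P (D i). ereal (norm0_h P (D i) (u - w))) \<le> ereal (C3 * mesh_size (D i) ^ k)"
      using A3[OF fgu] reg unfolding approximation_property_def fun_diff_def by blast
    obtain C4 where C4: "C4 > 0" and quad: "\<And>i.
     (SUP (\<tau>, v)\<in>Q_h P (D i) \<times> Vp0_h P (D i).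
        ereal (\<bar>a_form P ?s u \<tau> v - a_h P (D i) ?s u \<tau> v\<bar> / norm1_h P (D i) \<tau> v))
       \<le> ereal (C4 * mesh_size (D i) ^ k) \<and>
     (SUP (\<tau>, v)\<in>Q_h P (D i) \<times> Vp0_h P (D i).
        ereal (\<bar>b_form P u \<tau> - b_h P (D i) u \<tau>\<bar> / norm1_h P (D i) \<tau> v)) +
     (SUP w\<in>Vm_h P (D i). ereal (\<bar>b_form P w ?s - b_h P (D i) w ?s\<bar> / norm0_h P (D i) w))
       \<le> ereal (C4 * mesh_size (D i) ^ k) \<and>
     (SUP (\<tau>, v)\<in>Q_h P (D i) \<times> Vp0_h P (D i).
        ereal (\<bar>l2_inner (Oms P Plus) f v - inner_h P (D i) Plus f v\<bar> / norm1_h P (D i) \<tau> v)) +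
     (SUP w\<in>Vm_h P (D i). ereal (\<bar>l2_inner (Oms P Minus) f w - inner_h P (D i) Minus f w\<bar> / norm0_h P (D i) w))
       \<le> ereal (C4 * mesh_size (D i) ^ k) \<and>
     (SUP (\<tau>, v)\<in>Q_h P (D i) \<times> Vp0_h P (D i). ereal (\<bar>pairB P g \<tau> - quadB (D i) g \<tau>\<bar> / norm1_h P (D i) \<tau> v))
       \<le> ereal (C4 * mesh_size (D i) ^ k)"
      using A4[OF fgu] reg unfolding quadrature_accuracy_def by blast
    \<comment> \<open>\<open>E\<close>, \<open>C3\<close> and \<open>C4\<close> may depend on the
      data but are fixed before the mesh, hence so is this factor from
      \<open>error_estimate\<close>.\<close>
    define K where "K = stability_constant C \<alpha> * (8 + E) + 2"
    have K: "K > 0" unfolding K_def using stab E by (intro add_pos_pos mult_pos_pos) auto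
    have "norm1_h P (D i) (?s - \<sigma>) (u - w) + norm0_h P (D i) (u - p) \<le> K * (C3 + C4) * mesh_size (D i) ^ k"
      if sol: "direct_fem_solution P (D i) f g \<sigma> p w" for i \<sigma> p w
    proof -
      let ?Q = "Q_h P (D i)" and ?V = "Vp0_h P (D i)" and ?W = "Vm_h P (D i)"
      define T3 T4 where "T3 = C3 * mesh_size (D i) ^ k" and "T4 = C4 * mesh_size (D i) ^ k"
      \<comment> \<open>Zero elements keep the index sets nonempty; an empty supremum would be minus
        infinity and not nonnegative.\<close>
      have QV: "(0, 0) \<in> ?Q \<times> ?V" and W0: "0 \<in> ?W"
        using subspace_0[OF S.subspace_Q_h] subspace_0[OF S.subspace_Vm_h] S.zero_Vp0_h by auto
      have n1: "0 \<le> norm1_h P (D i) \<tau> v" if "\<tau> \<in> ?Q" "v \<in> ?V" for \<tau> v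
        by (rule S.norm1_h_nonneg[OF S.QV_HH[OF that]])
      have n0: "0 \<le> norm0_h P (D i) w" if "w \<in> ?W" for w
        by (rule S.norm0_h_nonneg[OF S.Vm_h_L2[OF that]])
      have SUP1: "0 \<le> (SUP (\<tau>, v)\<in>?Q \<times> ?V. ereal (\<bar>\<phi> \<tau> v\<bar> / norm1_h P (D i) \<tau> v))" for \<phi>
        using n1[of 0 0] QV by (intro SUP_upper2[OF QV]) auto
      have SUP0: "0 \<le> (SUP w\<in>?W. ereal (\<bar>\<phi> w\<bar> / norm0_h P (D i) w))" for \<phi>
        using n0[OF W0] by (intro SUP_upper2[OF W0]) auto
      note q = quad[of i, folded T4_def]
      note q1 = q[THEN conjunct1]
        and q2 = ereal_add_le_D[OF q[THEN conjunct2, THEN conjunct1] SUP1 SUP0]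
        and q3 = ereal_add_le_D[OF q[THEN conjunct2, THEN conjunct2, THEN conjunct1] SUP1 SUP0]
        and q4 = q[THEN conjunct2, THEN conjunct2, THEN conjunct2]
      have T4: "0 \<le> T4" using order_trans[OF SUP1 q4] by simp
      have HHs: "(?s, u) \<in> Hdiv (Oms P Minus) \<times> H1 (Oms P Plus)" and uL: "u \<in> L2 (Oms P Minus)"
        using S.flux_Hdiv[OF ctx] S.u_H1(2)[OF ctx] H1_L2[OF S.u_H1(2)[OF ctx]] by auto
      have nonneg1: "0 \<le> norm1_h P (D i) (?s - \<tau>) (u - v)" if "\<tau> \<in> ?Q" "v \<in> Vp_h P (D i) g" for \<tau> v
        using S.norm1_h_nonneg[of "?s - \<tau>" "u - v" i]
          subspace_diff[OF S.subspace_HH HHs S.QV_HH[OF that]] by simp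
      have nonneg0: "0 \<le> norm0_h P (D i) (u - w)" if "w \<in> ?W" for w
        by (rule S.norm0_h_nonneg[OF subspace_diff[OF subspace_L2 uL S.Vm_h_L2[OF that]]])
      have INF1: "0 \<le> (INF (\<tau>, v)\<in>?Q \<times> Vp_h P (D i) g. ereal (norm1_h P (D i) (?s - \<tau>) (u - v)))"
        using nonneg1 by (intro INF_greatest) auto
      have INF0: "0 \<le> (INF w\<in>?W. ereal (norm0_h P (D i) (u - w)))"
        using nonneg0 by (intro INF_greatest) auto
      note a = ereal_add_le_D[OF app[of i, folded T3_def] INF1 INF0]
      have T3: "0 \<le> T3" using order_trans[OF INF0 a(2)] by simp
      \<comment> \<open>The infima need not be attained, so approximations within \<epsilon> of
        their bounds are used and \<epsilon> is removed afterwards.\<close>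
      have err: "norm1_h P (D i) (?s - \<sigma>) (u - w) + norm0_h P (D i) (u - p) \<le> K * (T3 + T4 + \<epsilon>)"
        if \<epsilon>: "\<epsilon> > 0" for \<epsilon>
      proof -
        obtain x where x: "x \<in> ?Q \<times> Vp_h P (D i) g" "norm1_h P (D i) (?s - fst x) (u - snd x) < T3 + \<epsilon>"
          using INF_le_D[OF a(1)[unfolded case_prod_beta] \<epsilon>] by blast
        obtain w' where w': "w' \<in> ?W" "norm0_h P (D i) (u - w') < T3 + \<epsilon>"
          using INF_le_D[OF a(2) \<epsilon>] by blast
        \<comment> \<open>One bound for everything: \<open>T3 + \<epsilon>\<close> controls the
          approximation errors and \<open>T4\<close> the quadrature errors.\<close>
        let ?H = "T3 + T4 + \<epsilon>"
        have up: "r \<le> T4 \<Longrightarrow> r \<le> ?H" for r using T3 \<epsilon> by simp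
        show ?thesis
          unfolding K_def
        proof (rule S.error_estimate[OF ctx sol, where \<sigma>' = "fst x" and v' = "snd x" and p' = w'])
          show "0 \<le> E" "0 \<le> ?H" using E T3 T4 \<epsilon> by auto
          show "fst x \<in> ?Q" "snd x \<in> Vp_h P (D i) g" "w' \<in> ?W" using x w' by auto
          show "norm1_h P (D i) (?s - fst x) (u - snd x) \<le> ?H" "norm0_h P (D i) (u - w') \<le> ?H"
            using x w' T4 by auto
          fix \<tau> v assume tv: "\<tau> \<in> ?Q" "v \<in> ?V"
          then have m: "(\<tau>, v) \<in> ?Q \<times> ?V" by simp
          show "\<bar>a_h P (D i) (?s - fst x) (u - snd x) \<tau> v\<bar>
              \<le> E * (norm1_h P (D i) (?s - fst x) (u - snd x) * norm1_h P (D i) \<tau> v)"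
            using a_error[of "fst x" i "snd x" \<tau> v] x tv by auto
          show "\<bar>a_form P ?s u \<tau> v - a_h P (D i) ?s u \<tau> v\<bar> / norm1_h P (D i) \<tau> v \<le> ?H"
            by (rule up[OF SUP_pair_le_D[OF q1 m]])
          show "\<bar>b_form P u \<tau> - b_h P (D i) u \<tau>\<bar> / norm1_h P (D i) \<tau> v \<le> ?H"
            by (rule up[OF SUP_pair_le_D[OF q2(1) m]])
          show "\<bar>l2_inner (Oms P Plus) f v - inner_h P (D i) Plus f v\<bar> / norm1_h P (D i) \<tau> v \<le> ?H"
            by (rule up[OF SUP_pair_le_D[OF q3(1) m]])
          show "\<bar>pairB P g \<tau> - quadB (D i) g \<tau>\<bar> / norm1_h P (D i) \<tau> v \<le> ?H"
            by (rule up[OF SUP_pair_le_D[OF q4 m]])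
        next
          fix v assume v: "v \<in> ?W"
          show "\<bar>b_form P v ?s - b_h P (D i) v ?s\<bar> / norm0_h P (D i) v \<le> ?H"
            by (rule up[OF SUP_le_D[OF q2(2) v]])
          show "\<bar>l2_inner (Oms P Minus) f v - inner_h P (D i) Minus f v\<bar> / norm0_h P (D i) v \<le> ?H"
            by (rule up[OF SUP_le_D[OF q3(2) v]])
        qed
      qed
      have "norm1_h P (D i) (?s - \<sigma>) (u - w) + norm0_h P (D i) (u - p) \<le> K * (T3 + T4)"
      proof (rule field_le_epsilon)
        fix e :: real assume "0 < e"
        then show "norm1_h P (D i) (?s - \<sigma>) (u - w) + norm0_h P (D i) (u - p) \<le> K * (T3 + T4) + e"
          using err[of "e / K"] K by (simp add: distrib_left)
      qed
      then show ?thesis by (simp add: T3_def T4_def algebra_simps)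
    qed
    then show ?thesis
      using K C3 C4 by (intro exI[of _ "K * (C3 + C4)"]) (auto simp: fun_diff_def)
  qed
  ultimately show ?thesis by blast
qed

end
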